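(* Let $n\ge1$, let $(\gamma_z)_{z\in\mathbb Z^n\setminus\{0\}}$ be nonnegative numbers with $\gamma_{-z}=\gamma_z$ for all $z$ and $\Gamma:=\sum_{z\ne0}\gamma_z<\infty$, and consider the quadratic model $\vec\omega=(\omega_i)_{i\in\mathbb Z^n}$ with interaction coefficients $\gamma_z$ (see context). Then: (i) The quadratic model is well-$\rho$-mixing. If moreover $\Gamma<1$, then for all disjoint $I,J\subset\mathbb Z^n$, $\{\vec\omega_I:\vec\omega_J\}\le\Gamma$. (ii) If $\gamma_z=O(1/|z|^{n+\alpha})$ for some $\alpha>0$, then the model is $\alpha$-polynomially $\rho$-mixing; and if $\gamma_z$ has exponential decay, then the model is exponentially $\rho$-mixing (the rate of decay not being in general that of $\gamma_z$).
   Context: $|\cdot|$ is a fixed norm. Quadratic model: $\vec\omega\in\mathbb R^{\mathbb Z^n}$ is distributed according to the Gibbs measure, at inverse temperature $1$ (correlations do not depend on the inverse temperature), of the formal Hamiltonian $$H(\vec\omega)=\tfrac12\sum_i\omega_i^2+\tfrac14\sum_{i\ne j}\gamma_{j-i}(\omega_j-\omega_i)^2,$$ that is, $\vec\omega$ is the centered Gaussian field with covariance $\operatorname{Cov}(\omega_i,\omega_j)=b(j-i)$, where $b\in\ell^1(\mathbb Z^n)$ is the convolution inverse of the function $a$ on $\mathbb Z^n$ given by $a(0)=1+\Gamma$, $a(z)=-\gamma_z$ for $z\ne0$. Write $\vec\omega_I=(\omega_i)_{i\in I}$. The Hilbertian (maximal) correlation $\{X:Y\}$ of random variables is the supremum of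 $|\operatorname{Cov}(f(X),g(Y))|/(\operatorname{sd}(f(X))\operatorname{sd}(g(Y)))$ over real measurable $f,g$ with $0<\operatorname{sd}(f(X)),\operatorname{sd}(g(Y))<\infty$. For $\sigma$-algebras, $\{\mathcal F:\mathcal G\}_{\mathcal H}$ is the smallest $\epsilon\in[0,1]$ such that $|\mathbf E[fg]|\le\epsilon\operatorname{sd}(f)\operatorname{sd}(g)$ for all real square-integrable $f$ ($\mathcal F\vee\mathcal H$-measurable) and $g$ ($\mathcal G\vee\mathcal H$-measurable) with $\mathbf E[f|\mathcal H]=\mathbf E[g|\mathcal H]=0$ a.s.; and $\{\omega_i:\omega_j\}_*=\sup_{K\subset\mathbb Z^n}\{\sigma(\omega_i):\sigma(\omega_j)\}_{\sigma(\vec\omega_K)}$. A spin model $\vec\omega$ on $\mathbb Z^n$ is well-$\rho$-mixing if there are $\epsilon:\mathbb Z^n\setminus\{0\}\to[0,1]$ with $\sum_{z\ne0}\epsilon(z)<\infty$ and $k_0<1$ such that $\{\omega_i:\omega_j\}_*\le\min(\epsilon(j-i),k_0)$ for all distinct $i,j$. It is moreover $\alpha$-polynomially $\rho$-mixing if one can take $\epsilon(z)=O(|z|^{-(n+\alpha)})$ as $|z|\to\infty$, and exponentially $\rho$-mixing if one can take $\epsilon$ with exponential decay. A function $u$ on $\mathbb Z^n$ (or on $\mathbb Z^n\setminus\{0\}$) has exponential decay if there is $\beta>0$ such that $u(z)=O(e^{-\beta'|z|})$ as $|z|\to\infty$ for all $\beta'<\beta$. *)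

theory Defs
  imports "HOL-Probability.Probability" "HOL-Library.Landau_Symbols"
begin

text \<open>The lattice is \<open>int ^ 'n\<close>, with \<open>n = CARD('n) \<ge> 1\<close>. Sizes of lattice points are measured by
  an arbitrary norm \<open>N\<close> on the surrounding Euclidean space.\<close>

definition is_norm :: "(real ^ 'n \<Rightarrow> real) \<Rightarrow> bool" where
  "is_norm N \<longleftrightarrow> (\<forall>x. 0 \<le> N x) \<and> (\<forall>x. N x = 0 \<longleftrightarrow> x = 0) \<and>
     (\<forall>c x. N (c *\<^sub>R x) = \<bar>c\<bar> * N x) \<and> (\<forall>x y. N (x + y) \<le> N x + N y)"

definition lattice_norm :: "(real ^ 'n \<Rightarrow> real) \<Rightarrow> int ^ 'n \<Rightarrow> real" where
  "lattice_norm N z = N (\<chi> k. real_of_int (z $ k))"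

definition lattice_at_infinity :: "(real ^ 'n \<Rightarrow> real) \<Rightarrow> (int ^ 'n) filter" where
  "lattice_at_infinity N = filtercomap (lattice_norm N) at_top"

definition poly_decay :: "(real ^ 'n \<Rightarrow> real) \<Rightarrow> real \<Rightarrow> (int ^ 'n \<Rightarrow> real) \<Rightarrow> bool" where
  "poly_decay N \<alpha> u \<longleftrightarrow>
     u \<in> O[lattice_at_infinity N](\<lambda>z. 1 / lattice_norm N z powr (real CARD('n) + \<alpha>))"

definition exp_decay_at :: "(real ^ 'n \<Rightarrow> real) \<Rightarrow> real \<Rightarrow> (int ^ 'n \<Rightarrow> real) \<Rightarrow> bool" where
  "exp_decay_at N \<beta> u \<longleftrightarrow>
     (\<forall>\<beta>'<\<beta>. u \<in> O[lattice_at_infinity N](\<lambda>z. exp (- \<beta>' * lattice_norm N z)))"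

definition exp_decay :: "(real ^ 'n \<Rightarrow> real) \<Rightarrow> (int ^ 'n \<Rightarrow> real) \<Rightarrow> bool" where
  "exp_decay N u \<longleftrightarrow> (\<exists>\<beta>>0. exp_decay_at N \<beta> u)"

definition covar :: "'a measure \<Rightarrow> ('a \<Rightarrow> real) \<Rightarrow> ('a \<Rightarrow> real) \<Rightarrow> real" where
  "covar M X Y = (\<integral>x. (X x - integral\<^sup>L M X) * (Y x - integral\<^sup>L M Y) \<partial>M)"

definition sd :: "'a measure \<Rightarrow> ('a \<Rightarrow> real) \<Rightarrow> real" where
  "sd M X = sqrt (covar M X X)"

text \<open>The integrability of the square expresses \<open>sd < \<infinity>\<close>, since the Bochner integral
  of a non-integrable function is \<open>0\<close>. The supremum is taken in \<^typ>\<open>ennreal\<close>, so that it is \<open>0\<close>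
  when there are no admissible functions (as for a constant random variable).\<close>

definition max_corr ::
  "'a measure \<Rightarrow> 'b measure \<Rightarrow> ('a \<Rightarrow> 'b) \<Rightarrow> 'c measure \<Rightarrow> ('a \<Rightarrow> 'c) \<Rightarrow> ennreal" where
  "max_corr M S X T Y =
     Sup {ennreal (\<bar>covar M (f \<circ> X) (g \<circ> Y)\<bar> / (sd M (f \<circ> X) * sd M (g \<circ> Y))) | f g.
       f \<in> borel_measurable S \<and> g \<in> borel_measurable T \<and>
       integrable M (\<lambda>x. (f (X x))\<^sup>2) \<and> integrable M (\<lambda>x. (g (Y x))\<^sup>2) \<and>
       0 < sd M (f \<circ> X) \<and> 0 < sd M (g \<circ> Y)}"

text \<open>\<open>\<sigma>\<close>-algebras on \<open>space M\<close> are represented by measures with that space; their measure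
  component is irrelevant.\<close>

definition sig_join :: "'a measure \<Rightarrow> 'a measure \<Rightarrow> 'a measure" where
  "sig_join F G = sigma (space F) (sets F \<union> sets G)"

definition admissible :: "'a measure \<Rightarrow> 'a measure \<Rightarrow> 'a measure \<Rightarrow> ('a \<Rightarrow> real) set" where
  "admissible M F H = {f \<in> borel_measurable (sig_join F H).
     integrable M (\<lambda>x. (f x)\<^sup>2) \<and> (AE x in M. real_cond_exp M H f x = 0)}"

text \<open>The set below is closed and, by Cauchy-Schwarz, contains \<open>1\<close>; its infimum is its minimum.\<close>

definition cond_corr :: "'a measure \<Rightarrow> 'a measure \<Rightarrow> 'a measure \<Rightarrow> 'a measure \<Rightarrow> real" where
  "cond_corr M F G H =
     Inf {\<epsilon> \<in> {0..1}. \<forall>f\<in>admissible M F H. \<forall>g\<in>admissible M G H.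
       \<bar>\<integral>x. f x * g x \<partial>M\<bar> \<le> \<epsilon> * sd M f * sd M g}"

definition spins :: "('i \<Rightarrow> 'a \<Rightarrow> real) \<Rightarrow> 'i set \<Rightarrow> 'a \<Rightarrow> ('i \<Rightarrow> real)" where
  "spins \<omega> I x = (\<lambda>i\<in>I. \<omega> i x)"

definition max_corr_spins ::
  "'a measure \<Rightarrow> ('i \<Rightarrow> 'a \<Rightarrow> real) \<Rightarrow> 'i set \<Rightarrow> 'i set \<Rightarrow> ennreal" where
  "max_corr_spins M \<omega> I J =
     max_corr M (Pi\<^sub>M I (\<lambda>_. borel)) (spins \<omega> I) (Pi\<^sub>M J (\<lambda>_. borel)) (spins \<omega> J)"

definition star_corr :: "'a measure \<Rightarrow> ('i \<Rightarrow> 'a \<Rightarrow> real) \<Rightarrow> 'i \<Rightarrow> 'i \<Rightarrow> real" where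
  "star_corr M \<omega> i j = (SUP K.
     cond_corr M (vimage_algebra (space M) (\<omega> i) borel) (vimage_algebra (space M) (\<omega> j) borel)
       (vimage_algebra (space M) (spins \<omega> K) (Pi\<^sub>M K (\<lambda>_. borel))))"

definition rho_mixing_with ::
  "'a measure \<Rightarrow> (int ^ 'n \<Rightarrow> 'a \<Rightarrow> real) \<Rightarrow> (int ^ 'n \<Rightarrow> real) \<Rightarrow> bool" where
  "rho_mixing_with M \<omega> \<epsilon> \<longleftrightarrow>
     (\<forall>z. z \<noteq> 0 \<longrightarrow> \<epsilon> z \<in> {0..1}) \<and> \<epsilon> summable_on (- {0}) \<and>
     (\<exists>k\<^sub>0<1. \<forall>i j. i \<noteq> j \<longrightarrow> star_corr M \<omega> i j \<le> min (\<epsilon> (j - i)) k\<^sub>0)"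

definition well_rho_mixing :: "'a measure \<Rightarrow> (int ^ 'n \<Rightarrow> 'a \<Rightarrow> real) \<Rightarrow> bool" where
  "well_rho_mixing M \<omega> \<longleftrightarrow> (\<exists>\<epsilon>. rho_mixing_with M \<omega> \<epsilon>)"

definition poly_rho_mixing ::
  "(real ^ 'n \<Rightarrow> real) \<Rightarrow> real \<Rightarrow> 'a measure \<Rightarrow> (int ^ 'n \<Rightarrow> 'a \<Rightarrow> real) \<Rightarrow> bool" where
  "poly_rho_mixing N \<alpha> M \<omega> \<longleftrightarrow> (\<exists>\<epsilon>. rho_mixing_with M \<omega> \<epsilon> \<and> poly_decay N \<alpha> \<epsilon>)"

definition exp_rho_mixing ::
  "(real ^ 'n \<Rightarrow> real) \<Rightarrow> 'a measure \<Rightarrow> (int ^ 'n \<Rightarrow> 'a \<Rightarrow> real) \<Rightarrow> bool" where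
  "exp_rho_mixing N M \<omega> \<longleftrightarrow> (\<exists>\<epsilon>. rho_mixing_with M \<omega> \<epsilon> \<and> exp_decay N \<epsilon>)"

text \<open>Only the values of \<open>\<gamma>\<close> away from \<open>0\<close> matter.\<close>

definition interaction :: "(int ^ 'n \<Rightarrow> real) \<Rightarrow> bool" where
  "interaction \<gamma> \<longleftrightarrow>
     (\<forall>z. z \<noteq> 0 \<longrightarrow> 0 \<le> \<gamma> z) \<and> (\<forall>z. \<gamma> (- z) = \<gamma> z) \<and> \<gamma> summable_on (- {0})"

definition total_interaction :: "(int ^ 'n \<Rightarrow> real) \<Rightarrow> real" where
  "total_interaction \<gamma> = (\<Sum>\<^sub>\<infinity>z\<in>- {0}. \<gamma> z)"

definition precision :: "(int ^ 'n \<Rightarrow> real) \<Rightarrow> int ^ 'n \<Rightarrow> real" where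
  "precision \<gamma> z = (if z = 0 then 1 + total_interaction \<gamma> else - \<gamma> z)"

definition conv_inverse :: "(int ^ 'n \<Rightarrow> real) \<Rightarrow> (int ^ 'n \<Rightarrow> real) \<Rightarrow> bool" where
  "conv_inverse a b \<longleftrightarrow> (\<lambda>z. \<bar>b z\<bar>) summable_on UNIV \<and>
     (\<forall>z. (\<Sum>\<^sub>\<infinity>y. a y * b (z - y)) = (if z = 0 then 1 else 0))"

definition gaussian_var :: "'a measure \<Rightarrow> ('a \<Rightarrow> real) \<Rightarrow> bool" where
  "gaussian_var M X \<longleftrightarrow> X \<in> borel_measurable M \<and>
     ((\<exists>\<mu>. AE x in M. X x = \<mu>) \<or>
      (\<exists>\<mu> \<sigma>. 0 < \<sigma> \<and> distributed M lborel X (\<lambda>x. ennreal (normal_density \<mu> \<sigma> x))))"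

definition gaussian_field :: "'a measure \<Rightarrow> ('i \<Rightarrow> 'a \<Rightarrow> real) \<Rightarrow> bool" where
  "gaussian_field M \<omega> \<longleftrightarrow> prob_space M \<and>
     (\<forall>F c. finite F \<longrightarrow> gaussian_var M (\<lambda>x. \<Sum>i\<in>F. c i * \<omega> i x))"

text \<open>The quadratic model, realised on an arbitrary probability space. The convolution inverse
  in \<open>\<ell>\<^sup>1\<close> is unique, so \<open>b\<close> is determined by \<open>\<gamma>\<close>.\<close>

definition quadratic_model ::
  "(int ^ 'n \<Rightarrow> real) \<Rightarrow> 'a measure \<Rightarrow> (int ^ 'n \<Rightarrow> 'a \<Rightarrow> real) \<Rightarrow> bool" where
  "quadratic_model \<gamma> M \<omega> \<longleftrightarrow> gaussian_field M \<omega> \<and> (\<forall>i. integral\<^sup>L M (\<omega> i) = 0) \<and>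
     (\<exists>b. conv_inverse (precision \<gamma>) b \<and> (\<forall>i j. covar M (\<omega> i) (\<omega> j) = b (j - i)))"

end

theory Submission
  imports Defs
begin

text \<open>The covariance \<open>b\<close> is the Green function of a killed walk: \<open>(1 + \<Gamma>) b = \<delta>\<^sub>0 + \<gamma> * b\<close>. Given
  finitely many spins, the conditional covariance \<open>c\<close> of \<open>\<omega>\<^sub>i\<close> with the field solves the same
  equation off the conditioning set and vanishes on it, so the maximum principle gives
  \<open>0 \<le> c \<le> b\<close>, \<open>c i \<ge> 1 / (1 + \<Gamma>)\<close> and \<open>c j \<le> \<Gamma> / (1 + \<Gamma>) c i\<close>. Hence partial correlations are at
  most \<open>min ((1 + \<Gamma>) b (j - i)) (\<Gamma> / (1 + \<Gamma>))\<close>, and \<open>b\<close> inherits the decay of \<open>\<gamma>\<close> from the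
  renewal equation.

  That Hilbertian correlations of Gaussian variables are linear correlations, also conditionally and
  for infinitely many variables, is seen on the finite sums of functions \<open>cos (X + t)\<close> with \<open>X\<close> in
  the Gaussian space, which are dense in \<open>L\<^sup>2\<close>. The covariances of their residuals given finitely
  many spins are power series in the covariances of the Gaussian variables, so that Schur's product
  theorem reduces the bound to the linear one. Only finite conditioning sets enter, because the
  residuals of approximating finite sums already converge to the given functions.

  For disjoint \<open>I\<close> and \<open>J\<close> with \<open>\<Gamma> < 1\<close>, flipping the sign on \<open>J\<close> changes the quadratic form of the
  precision operator by a factor of at most \<open>(1 + \<Gamma>) / (1 - \<Gamma>)\<close>; the form of the covariance
  inherits this, which is the claimed correlation bound.\<close>
section \<open>Density of bounded algebras in \<open>L\<^sup>2\<close>\<close>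

text \<open>Correlation bounds are carried in the form
  \<open>0 <= \<rho> |X|^2 + \<rho> |Y|^2 + 2 <X, Y>\<close>, which is linear in the inner products.
  For all combinations from two families it says that a block Gram matrix, weighted by \<rho> in the
  diagonal blocks and by 1 off them, is positive semidefinite; so it survives Schur products,
  convergent series and L2 limits. Rescaling \<open>X\<close> and \<open>Y\<close> at the very end
  recovers the usual inequality. Cosines with a phase serve as test functions because they are
  bounded, products of them are again sums of them, and their Gaussian inner products are explicit.
  Density is then a monotone class argument. On the infinite lattice a bounded function need not
  attain its infimum. The strict inequality \<open>\<Gamma> < 1 + \<Gamma>\<close> gives a
  contraction that takes the place of attainment, both in the maximum principle and in the weighted
  bounds behind the decay. The remark on the rate of decay is proved as an existence statement: an
  interaction and a rate \<beta> that the interaction has, but that no admissible \<epsilon> can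
  have.\<close>

definition sqint :: "'a measure \<Rightarrow> ('a \<Rightarrow> real) set" where
  "sqint M = {f \<in> borel_measurable M. integrable M (\<lambda>x. (f x)\<^sup>2)}"

lemma sqint_measurable [measurable_dest]: "f \<in> sqint M \<Longrightarrow> f \<in> borel_measurable M"
  and sqint_integrable: "f \<in> sqint M \<Longrightarrow> integrable M (\<lambda>x. (f x)\<^sup>2)"
  by (auto simp: sqint_def)

abbreviation sqnorm :: "'a measure \<Rightarrow> ('a \<Rightarrow> real) \<Rightarrow> real" where
  "sqnorm M f \<equiv> \<integral>x. (f x)\<^sup>2 \<partial>M"

lemma sqint_mult:
  assumes "f \<in> sqint M" "g \<in> sqint M"
  shows "integrable M (\<lambda>x. f x * g x)"
proof (rule Bochner_Integration.integrable_bound)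
  show "integrable M (\<lambda>x. (f x)\<^sup>2 + (g x)\<^sup>2)"
    using assms by (intro Bochner_Integration.integrable_add sqint_integrable)
  show "(\<lambda>x. f x * g x) \<in> borel_measurable M"
    using assms[THEN sqint_measurable] by measurable
  have "\<bar>a * b\<bar> \<le> a\<^sup>2 + b\<^sup>2" for a b :: real
    using sum_squares_bound[of "\<bar>a\<bar>" "\<bar>b\<bar>"] abs_ge_zero[of "a * b"]
    unfolding abs_mult power2_abs by linarith
  then show "AE x in M. norm (f x * g x) \<le> norm ((f x)\<^sup>2 + (g x)\<^sup>2)"
    by (auto intro!: AE_I2)
qed

lemma sqint_add:
  assumes "f \<in> sqint M" "g \<in> sqint M"
  shows "(\<lambda>x. f x + g x) \<in> sqint M"
proof -
  have "integrable M (\<lambda>x. (f x)\<^sup>2 + 2 * (f x * g x) + (g x)\<^sup>2)"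
    using assms by (intro Bochner_Integration.integrable_add sqint_integrable
        integrable_mult_right sqint_mult)
  then show ?thesis
    using assms[THEN sqint_measurable] by (simp add: sqint_def power2_sum algebra_simps)
qed

lemma sqint_cmult:
  assumes "f \<in> sqint M"
  shows "(\<lambda>x. c * f x) \<in> sqint M"
  using assms by (auto simp: sqint_def power_mult_distrib)

lemma sqint_diff:
  assumes "f \<in> sqint M" "g \<in> sqint M"
  shows "(\<lambda>x. f x - g x) \<in> sqint M"
  using sqint_add[OF assms(1) sqint_cmult[OF assms(2), of "-1"]] by simp

lemma sqint_sum:
  assumes "\<And>k. k \<in> F \<Longrightarrow> f k \<in> sqint M"
  shows "(\<lambda>x. \<Sum>k\<in>F. f k x) \<in> sqint M"
  using assms
proof (induction F rule: infinite_finite_induct)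
  case (insert k F)
  then show ?case using sqint_add[of "f k" M "\<lambda>x. \<Sum>k\<in>F. f k x"] by simp
qed (simp_all add: sqint_def)

section \<open>Inner products and norms of square-integrable functions\<close>

definition ip :: "'a measure \<Rightarrow> ('a \<Rightarrow> real) \<Rightarrow> ('a \<Rightarrow> real) \<Rightarrow> real" where
  "ip M f g = (\<integral>x. f x * g x \<partial>M)"

lemma ip_commute: "ip M f g = ip M g f"
  by (simp add: ip_def mult.commute)

lemma ip_add_left:
  assumes "f \<in> sqint M" "g \<in> sqint M" "h \<in> sqint M"
  shows "ip M (\<lambda>x. f x + g x) h = ip M f h + ip M g h"
  using sqint_mult[OF assms(1,3)] sqint_mult[OF assms(2,3)] by (simp add: ip_def distrib_right)

lemma ip_diff_left:
  assumes "f \<in> sqint M" "g \<in> sqint M" "h \<in> sqint M"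
  shows "ip M (\<lambda>x. f x - g x) h = ip M f h - ip M g h"
  using sqint_mult[OF assms(1,3)] sqint_mult[OF assms(2,3)] by (simp add: ip_def left_diff_distrib)

lemma ip_scale_left: "ip M (\<lambda>x. c * f x) h = c * ip M f h"
  by (simp add: ip_def mult.assoc)

lemma ip_add_right:
  assumes "f \<in> sqint M" "g \<in> sqint M" "h \<in> sqint M"
  shows "ip M h (\<lambda>x. f x + g x) = ip M h f + ip M h g"
  using ip_add_left[OF assms] by (simp add: ip_commute)

lemma ip_diff_right:
  assumes "f \<in> sqint M" "g \<in> sqint M" "h \<in> sqint M"
  shows "ip M h (\<lambda>x. f x - g x) = ip M h f - ip M h g"
  using ip_diff_left[OF assms] by (simp add: ip_commute)

lemma ip_scale_right: "ip M h (\<lambda>x. c * f x) = c * ip M h f"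
  using ip_scale_left[of M c f h] by (simp add: ip_commute)

lemma ip_self_nonneg: "0 \<le> ip M f f"
  unfolding ip_def by (rule integral_nonneg_AE) simp

lemma ip_self: "ip M f f = (\<integral>x. (f x)\<^sup>2 \<partial>M)"
  by (simp add: ip_def power2_eq_square)

lemma (in finite_measure) sqint_bounded:
  assumes "f \<in> borel_measurable M" "\<And>x. x \<in> space M \<Longrightarrow> \<bar>f x\<bar> \<le> B"
  shows "f \<in> sqint M"
proof -
  have "integrable M (\<lambda>x. (f x)\<^sup>2)"
  proof (rule integrable_const_bound[where B = "B\<^sup>2"])
    show "AE x in M. norm ((f x)\<^sup>2) \<le> B\<^sup>2"
      using assms(2) by (auto intro!: AE_I2 simp: abs_le_square_iff)
         (metis abs_ge_self assms(2) abs_le_square_iff order_trans)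
  qed (use assms in measurable)
  then show ?thesis using assms by (simp add: sqint_def)
qed

lemma sqint_bounded_mult:
  assumes "f \<in> sqint M" "h \<in> borel_measurable M" "\<And>x. x \<in> space M \<Longrightarrow> \<bar>h x\<bar> \<le> B"
  shows "(\<lambda>x. h x * f x) \<in> sqint M"
    and "sqnorm M (\<lambda>x. h x * f x) \<le> B\<^sup>2 * sqnorm M f"
proof -
  have le: "(h x * f x)\<^sup>2 \<le> B\<^sup>2 * (f x)\<^sup>2" if "x \<in> space M" for x
  proof -
    have "(h x)\<^sup>2 \<le> B\<^sup>2"
      using assms(3)[OF that] abs_le_square_iff by (metis abs_ge_self order_trans)
    then show ?thesis by (simp add: power_mult_distrib mult_right_mono)
  qed
  have int: "integrable M (\<lambda>x. B\<^sup>2 * (f x)\<^sup>2)"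
    using sqint_integrable[OF assms(1)] by simp
  have int': "integrable M (\<lambda>x. (h x * f x)\<^sup>2)"
    by (rule Bochner_Integration.integrable_bound[OF int])
      (use assms(2) sqint_measurable[OF assms(1)] in measurable, auto intro!: AE_I2 dest: le)
  then show "(\<lambda>x. h x * f x) \<in> sqint M"
    using assms(2) sqint_measurable[OF assms(1)] by (simp add: sqint_def)
  show "sqnorm M (\<lambda>x. h x * f x) \<le> B\<^sup>2 * sqnorm M f"
    using integral_mono[OF int' int] le by simp
qed

text \<open>The discriminant criterion for a binary form. It yields Cauchy-Schwarz, and later turns
  the quadratic-form version of a correlation bound into the usual one.\<close>

lemma nonneg_quadratic_form:
  fixes a b d :: real
  assumes "\<And>s t. 0 \<le> s\<^sup>2 * a + t\<^sup>2 * b + 2 * (s * t * d)"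
  shows "\<bar>d\<bar> \<le> sqrt a * sqrt b"
proof -
  have a: "0 \<le> a" using assms[of 1 0] by simp
  have b: "0 \<le> b" using assms[of 0 1] by simp
  have "d\<^sup>2 \<le> a * b"
  proof (cases "a = 0")
    case True
    have "0 \<le> b + 2 * (x * d)" for x using assms[of x 1] True by simp
    \<comment> \<open>With \<open>a = 0\<close> the form at \<open>t = 1\<close> is affine in
      \<open>s\<close>; this \<open>s\<close> gives it the value -1 unless
      \<open>d = 0\<close>.\<close>
    from this[of "- (b + 1) / (2 * d)"] b have "d = 0" by (cases "d = 0") (auto simp: field_simps)
    then show ?thesis using True by simp
  next
    case False
    with a have "0 < a" by simp
    have "0 \<le> d\<^sup>2 * a + a\<^sup>2 * b + 2 * (- d * a * d)" using assms[of "-d" a] by simp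
    then have "0 \<le> a * (a * b - d\<^sup>2)" by (simp add: power2_eq_square algebra_simps)
    then show ?thesis using \<open>0 < a\<close> by (simp add: zero_le_mult_iff)
  qed
  then show ?thesis
    using real_sqrt_le_mono[of "d\<^sup>2" "a * b"] by (simp add: real_sqrt_mult)
qed

lemma sqint_expand:
  assumes "f \<in> sqint M" "g \<in> sqint M"
  shows "sqnorm M (\<lambda>x. s * f x + t * g x) =
    s\<^sup>2 * sqnorm M f + t\<^sup>2 * sqnorm M g + 2 * (s * t * ip M f g)"
proof -
  have sq: "(\<lambda>x. s * f x) \<in> sqint M" "(\<lambda>x. t * g x) \<in> sqint M"
    by (rule sqint_cmult[OF assms(1)], rule sqint_cmult[OF assms(2)])
  show ?thesis
    unfolding ip_self[symmetric] ip_add_left[OF sq sqint_add[OF sq]] ip_scale_left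
      ip_add_right[OF sq assms(1)] ip_add_right[OF sq assms(2)] ip_scale_right ip_commute[of M g f]
    by (simp add: power2_eq_square algebra_simps)
qed

lemma Cauchy_Schwarz_ip:
  assumes "f \<in> sqint M" "g \<in> sqint M"
  shows "\<bar>ip M f g\<bar> \<le> sqrt (sqnorm M f) * sqrt (sqnorm M g)"
proof (rule nonneg_quadratic_form)
  fix s t :: real
  show "0 \<le> s\<^sup>2 * sqnorm M f + t\<^sup>2 * sqnorm M g + 2 * (s * t * ip M f g)"
    unfolding sqint_expand[OF assms, symmetric] by simp
qed

lemma sqint_add_bound:
  assumes "f \<in> sqint M" "g \<in> sqint M"
  shows "sqnorm M (\<lambda>x. f x + g x) \<le> 2 * sqnorm M f + 2 * sqnorm M g"
proof -
  have "sqnorm M (\<lambda>x. 1 * f x + 1 * g x) + sqnorm M (\<lambda>x. 1 * f x + (-1) * g x) =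
     2 * sqnorm M f + 2 * sqnorm M g"
    unfolding sqint_expand[OF assms] by simp
  moreover have "0 \<le> sqnorm M (\<lambda>x. 1 * f x + (-1) * g x)" by (intro integral_nonneg_AE) simp
  ultimately show ?thesis unfolding mult_1 by linarith
qed

lemma ip_tendsto:
  assumes f: "\<And>n. f n \<in> sqint M" "F \<in> sqint M" "(\<lambda>n. sqnorm M (\<lambda>x. f n x - F x)) \<longlonglongrightarrow> 0"
    and g: "\<And>n. g n \<in> sqint M" "G \<in> sqint M" "(\<lambda>n. sqnorm M (\<lambda>x. g n x - G x)) \<longlonglongrightarrow> 0"
  shows "(\<lambda>n. ip M (f n) (g n)) \<longlonglongrightarrow> ip M F G"
proof -
  let ?n = "\<lambda>f. sqrt (sqnorm M f)"
  have df: "(\<lambda>x. f n x - F x) \<in> sqint M" and dg: "(\<lambda>x. g n x - G x) \<in> sqint M" for n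
    using f g by (auto intro: sqint_diff)
  have eq: "ip M (f n) (g n) - ip M F G =
     ip M (\<lambda>x. f n x - F x) (\<lambda>x. g n x - G x) + ip M (\<lambda>x. f n x - F x) G + ip M F (\<lambda>x. g n x - G x)" for n
    by (simp add: ip_diff_left ip_diff_right f g dg)
  have bound: "\<bar>ip M (f n) (g n) - ip M F G\<bar> \<le> ?n (\<lambda>x. f n x - F x) * ?n (\<lambda>x. g n x - G x) +
     ?n (\<lambda>x. f n x - F x) * ?n G + ?n F * ?n (\<lambda>x. g n x - G x)" for n
    unfolding eq
    using Cauchy_Schwarz_ip[OF df[of n] dg[of n]] Cauchy_Schwarz_ip[OF df[of n] g(2)]
      Cauchy_Schwarz_ip[OF f(2) dg[of n]] by linarith
  have lim: "(\<lambda>n. ?n (\<lambda>x. f n x - F x) * ?n (\<lambda>x. g n x - G x) + ?n (\<lambda>x. f n x - F x) * ?n G +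
     ?n F * ?n (\<lambda>x. g n x - G x)) \<longlonglongrightarrow> sqrt 0 * sqrt 0 + sqrt 0 * ?n G + ?n F * sqrt 0"
    by (intro tendsto_intros f g)
  have "(\<lambda>n. ip M (f n) (g n) - ip M F G) \<longlonglongrightarrow> 0"
    by (rule Lim_null_comparison[OF _ lim[unfolded real_sqrt_zero mult_zero_left mult_zero_right add_0_left]])
      (simp only: real_norm_def, intro always_eventually allI bound)
  then show ?thesis by (simp add: LIM_zero_iff)
qed

section \<open>The L2 closure of an algebra of bounded functions\<close>

definition l2_closure :: "'a measure \<Rightarrow> ('a \<Rightarrow> real) set \<Rightarrow> ('a \<Rightarrow> real) set" where
  "l2_closure M A = {f \<in> sqint M. \<forall>e>0. \<exists>h\<in>A. sqnorm M (\<lambda>x. f x - h x) < e}"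

lemma l2_closure_closed:
  assumes A: "A \<subseteq> sqint M" and f: "f \<in> sqint M"
    and *: "\<And>e. e > 0 \<Longrightarrow> \<exists>h\<in>l2_closure M A. sqnorm M (\<lambda>x. f x - h x) < e"
  shows "f \<in> l2_closure M A"
  unfolding l2_closure_def
proof (intro CollectI conjI allI impI f)
  fix e :: real assume e: "e > 0"
  obtain h where h: "h \<in> l2_closure M A" "sqnorm M (\<lambda>x. f x - h x) < e / 4"
    using *[of "e/4"] e by auto
  obtain k where k: "k \<in> A" "sqnorm M (\<lambda>x. h x - k x) < e / 4"
    using h(1) e unfolding l2_closure_def by (auto dest: spec[of _ "e/4"])
  have "(\<lambda>x. f x - h x) \<in> sqint M" "(\<lambda>x. h x - k x) \<in> sqint M"
    using f h(1) k(1) A by (auto intro!: sqint_diff simp: l2_closure_def)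
  from sqint_add_bound[OF this] h(2) k(2) show "\<exists>h\<in>A. sqnorm M (\<lambda>x. f x - h x) < e"
    by (intro bexI[OF _ k(1)]) simp
qed

lemma l2_closure_closed_seq:
  assumes "A \<subseteq> sqint M" "f \<in> sqint M" "\<And>n. h n \<in> l2_closure M A"
    and "(\<lambda>n. sqnorm M (\<lambda>x. f x - h n x)) \<longlonglongrightarrow> 0"
  shows "f \<in> l2_closure M A"
proof (rule l2_closure_closed[OF assms(1,2)])
  fix e :: real assume "e > 0"
  from order_tendstoD(2)[OF assms(4) this]
  obtain n where "sqnorm M (\<lambda>x. f x - h n x) < e" by (auto simp: eventually_sequentially)
  then show "\<exists>h\<in>l2_closure M A. sqnorm M (\<lambda>x. f x - h x) < e" using assms(3) by blast
qed

text \<open>The setting of the multiplicative monotone class theorem, in an L2 version. The instance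
  used is the algebra \<open>trig (lin \<omega> S)\<close>.\<close>

locale bounded_algebra = finite_measure M for M :: "'a measure" +
  fixes A :: "('a \<Rightarrow> real) set"
  assumes A_meas: "f \<in> A \<Longrightarrow> f \<in> borel_measurable M"
    and A_bdd: "f \<in> A \<Longrightarrow> \<exists>B. \<forall>x\<in>space M. \<bar>f x\<bar> \<le> B"
    and A_one: "(\<lambda>x. 1) \<in> A"
    and A_add: "f \<in> A \<Longrightarrow> g \<in> A \<Longrightarrow> (\<lambda>x. f x + g x) \<in> A"
    and A_scale: "f \<in> A \<Longrightarrow> (\<lambda>x. c * f x) \<in> A"
    and A_mult: "f \<in> A \<Longrightarrow> g \<in> A \<Longrightarrow> (\<lambda>x. f x * g x) \<in> A"
begin

abbreviation "cl \<equiv> l2_closure M A"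

lemma A_sqint: "A \<subseteq> sqint M"
proof
  fix f assume f: "f \<in> A"
  obtain B where "\<forall>x\<in>space M. \<bar>f x\<bar> \<le> B" using A_bdd[OF f] by blast
  then show "f \<in> sqint M" using A_meas[OF f] by (intro sqint_bounded[where B = B]) auto
qed

lemma A_cl: "A \<subseteq> cl"
  using A_sqint by (force simp: l2_closure_def)

lemma cl_sqint: "f \<in> cl \<Longrightarrow> f \<in> sqint M"
  by (simp add: l2_closure_def)

lemma cl_approx: "f \<in> cl \<Longrightarrow> e > 0 \<Longrightarrow> \<exists>h\<in>A. sqnorm M (\<lambda>x. f x - h x) < e"
  by (simp add: l2_closure_def)

lemma cl_add:
  assumes f: "f \<in> cl" and g: "g \<in> cl"
  shows "(\<lambda>x. f x + g x) \<in> cl"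
  unfolding l2_closure_def
proof (intro CollectI conjI allI impI)
  show "(\<lambda>x. f x + g x) \<in> sqint M" using f g by (intro sqint_add cl_sqint)
  fix e :: real assume e: "e > 0"
  obtain h where h: "h \<in> A" "sqnorm M (\<lambda>x. f x - h x) < e / 4" using cl_approx[OF f, of "e/4"] e by auto
  obtain k where k: "k \<in> A" "sqnorm M (\<lambda>x. g x - k x) < e / 4" using cl_approx[OF g, of "e/4"] e by auto
  have "(\<lambda>x. f x - h x) \<in> sqint M" "(\<lambda>x. g x - k x) \<in> sqint M"
    using cl_sqint[OF f] cl_sqint[OF g] h(1) k(1) A_sqint by (auto intro!: sqint_diff)
  from sqint_add_bound[OF this] h(2) k(2)
  have "sqnorm M (\<lambda>x. f x + g x - (h x + k x)) < e"
    by (simp add: add_diff_add)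
  then show "\<exists>h\<in>A. sqnorm M (\<lambda>x. f x + g x - h x) < e"
    using A_add[OF h(1) k(1)] by (intro bexI[where x = "\<lambda>x. h x + k x"])
qed

text \<open>Multiplication by a bounded function is continuous in L2, so it maps \<open>cl\<close>
  into itself once it maps \<open>A\<close> into \<open>cl\<close>. Used first with a factor from
  \<open>A\<close>, then with a bounded factor from \<open>cl\<close>.\<close>

lemma cl_mult:
  assumes f: "f \<in> borel_measurable M" and B: "\<And>x. x \<in> space M \<Longrightarrow> \<bar>f x\<bar> \<le> B"
    and A: "\<And>h. h \<in> A \<Longrightarrow> (\<lambda>x. f x * h x) \<in> cl" and g: "g \<in> cl"
  shows "(\<lambda>x. f x * g x) \<in> cl"
proof (rule l2_closure_closed[OF A_sqint])
  show "(\<lambda>x. f x * g x) \<in> sqint M"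
    using sqint_bounded_mult(1)[OF cl_sqint[OF g] f B] by auto
  fix e :: real assume e: "e > 0"
  \<comment> \<open>The added 1 keeps the divisor positive when \<open>B = 0\<close>.\<close>
  have pos: "0 < B\<^sup>2 + 1" using zero_le_power2[of B] by linarith
  obtain h where h: "h \<in> A" "sqnorm M (\<lambda>x. g x - h x) < e / (B\<^sup>2 + 1)"
    using cl_approx[OF g, of "e / (B\<^sup>2 + 1)"] e pos by auto
  have "(\<lambda>x. g x - h x) \<in> sqint M" using cl_sqint[OF g] h(1) A_sqint by (auto intro!: sqint_diff)
  from sqint_bounded_mult(2)[OF this f B]
  have "sqnorm M (\<lambda>x. f x * (g x - h x)) \<le> B\<^sup>2 * sqnorm M (\<lambda>x. g x - h x)" by auto
  also have "\<dots> \<le> (B\<^sup>2 + 1) * sqnorm M (\<lambda>x. g x - h x)"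
    by (intro mult_right_mono) auto
  also have "\<dots> < e" using h(2) pos by (simp add: field_simps)
  finally have "sqnorm M (\<lambda>x. f x * g x - f x * h x) < e" by (simp add: algebra_simps)
  then show "\<exists>h\<in>cl. sqnorm M (\<lambda>x. f x * g x - h x) < e"
    using A[OF h(1)] by (intro bexI[where x = "\<lambda>x. f x * h x"])
qed

lemma cl_mult_A:
  assumes f: "f \<in> cl" and k: "k \<in> A"
  shows "(\<lambda>x. k x * f x) \<in> cl"
proof -
  obtain B where "\<And>x. x \<in> space M \<Longrightarrow> \<bar>k x\<bar> \<le> B" using A_bdd[OF k] by blast
  moreover have "(\<lambda>x. k x * h x) \<in> cl" if "h \<in> A" for h using A_mult[OF k that] A_cl by (rule subsetD[rotated])
  ultimately show ?thesis using f by (rule cl_mult[OF A_meas[OF k]])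
qed

lemma A_const: "(\<lambda>x. c) \<in> A" using A_scale[OF A_one, of c] by simp

lemma cl_scale: "f \<in> cl \<Longrightarrow> (\<lambda>x. c * f x) \<in> cl"
  using cl_mult_A[OF _ A_const] by simp

lemma cl_diff: "f \<in> cl \<Longrightarrow> g \<in> cl \<Longrightarrow> (\<lambda>x. f x - g x) \<in> cl"
  using cl_add[OF _ cl_scale[of g "-1"], of f] by simp

lemma cl_bounded_mult:
  assumes f: "f \<in> cl" and B: "\<And>x. x \<in> space M \<Longrightarrow> \<bar>f x\<bar> \<le> B" and g: "g \<in> cl"
  shows "(\<lambda>x. f x * g x) \<in> cl"
  using sqint_measurable[OF cl_sqint[OF f]] B _ g
proof (rule cl_mult)
  show "(\<lambda>x. f x * h x) \<in> cl" if "h \<in> A" for h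
    using cl_mult_A[OF f that] by (simp add: mult.commute)
qed

lemma cl_dominated:
  assumes h: "\<And>n. h n \<in> cl" and f: "f \<in> borel_measurable M"
    and lim: "\<And>x. x \<in> space M \<Longrightarrow> (\<lambda>n. h n x) \<longlonglongrightarrow> f x"
    and w: "integrable M w" "\<And>n x. x \<in> space M \<Longrightarrow> (f x - h n x)\<^sup>2 \<le> w x"
    and f2: "f \<in> sqint M"
  shows "f \<in> cl"
proof (rule l2_closure_closed_seq[OF A_sqint f2 h])
  have [measurable]: "h n \<in> borel_measurable M" for n using sqint_measurable[OF cl_sqint[OF h]] .
  note [measurable] = f
  have "(\<lambda>n. sqnorm M (\<lambda>x. f x - h n x)) \<longlonglongrightarrow> (\<integral>x. 0 \<partial>M)"
  proof (rule integral_dominated_convergence[OF _ _ w(1)])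
    show "AE x in M. (\<lambda>n. (f x - h n x)\<^sup>2) \<longlonglongrightarrow> 0"
    proof (rule AE_I2)
      fix x assume "x \<in> space M"
      then have "(\<lambda>n. (f x - h n x)\<^sup>2) \<longlonglongrightarrow> (f x - f x)\<^sup>2" by (intro tendsto_intros lim)
      then show "(\<lambda>n. (f x - h n x)\<^sup>2) \<longlonglongrightarrow> 0" by simp
    qed
  qed (use w(2) in \<open>auto intro!: AE_I2\<close>)
  then show "(\<lambda>n. sqnorm M (\<lambda>x. f x - h n x)) \<longlonglongrightarrow> 0" by simp
qed

lemma cl_bounded_limit:
  assumes h: "\<And>n. h n \<in> cl" and B: "\<And>n x. x \<in> space M \<Longrightarrow> \<bar>h n x\<bar> \<le> B"
    and lim: "\<And>x. x \<in> space M \<Longrightarrow> (\<lambda>n. h n x) \<longlonglongrightarrow> f x"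
  shows "f \<in> cl"
proof (rule cl_dominated[OF h _ lim, where w = "\<lambda>x. (2 * B)\<^sup>2"])
  have [measurable]: "h n \<in> borel_measurable M" for n using sqint_measurable[OF cl_sqint[OF h]] .
  show fm: "f \<in> borel_measurable M" by (rule borel_measurable_LIMSEQ_real[OF lim]) auto
  have fB: "\<bar>f x\<bar> \<le> B" if "x \<in> space M" for x
    by (rule LIMSEQ_le_const2[OF tendsto_rabs[OF lim[OF that]]]) (use B that in auto)
  then show "f \<in> sqint M" using fm by (intro sqint_bounded[where B = B])
  show "(f x - h n x)\<^sup>2 \<le> (2 * B)\<^sup>2" if "x \<in> space M" for n x
  proof -
    have "\<bar>f x - h n x\<bar> \<le> \<bar>2 * B\<bar>" using fB[OF that] B[OF that, of n] by linarith
    then show ?thesis unfolding abs_le_square_iff .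
  qed
qed auto

lemma A_polynomial:
  assumes "real_polynomial_function p" "h \<in> A"
  shows "(\<lambda>x. p (h x)) \<in> A"
  using assms
proof (induction p rule: real_polynomial_function.induct)
  case (linear f)
  then interpret bounded_linear f by simp
  have "f y = f 1 * y" for y using scaleR[of y 1] by (simp add: mult.commute)
  then have "(\<lambda>x. f (h x)) = (\<lambda>x. f 1 * h x)" by metis
  then show ?case using A_scale[OF assms(2)] by simp
next
  case (const c)
  then show ?case using A_const by simp
next
  case (add f g)
  then show ?case using A_add by simp
next
  case (mult f g)
  then show ?case using A_mult by simp
qed

text \<open>Weierstrass approximation on the compact interval \<open>{-B..B}\<close> that contains
  the range of \<open>h\<close>: the polynomials in \<open>h\<close> lie in \<open>A\<close> and
  converge boundedly.\<close>

lemma cl_continuous: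
  assumes h: "h \<in> A" and p: "continuous_on UNIV p"
  shows "(\<lambda>x. p (h x)) \<in> cl"
proof -
  obtain B where B: "\<And>x. x \<in> space M \<Longrightarrow> \<bar>h x\<bar> \<le> B" using A_bdd[OF h] by blast
  have "\<exists>q. real_polynomial_function q \<and> (\<forall>y\<in>{-B..B}. \<bar>p y - q y\<bar> < inverse (Suc n))" for n
    using Stone_Weierstrass_real_polynomial_function[of "{-B..B}" p "inverse (Suc n)"]
      continuous_on_subset[OF p] by (metis compact_Icc inverse_positive_iff_positive of_nat_0_less_iff subset_UNIV zero_less_Suc)
  then obtain q where q: "\<And>n. real_polynomial_function (q n)"
    and qp: "\<And>n y. y \<in> {-B..B} \<Longrightarrow> \<bar>p y - q n y\<bar> < inverse (Suc n)" by metis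
  obtain C where C: "\<And>y. y \<in> {-B..B} \<Longrightarrow> \<bar>p y\<bar> \<le> C"
    using compact_imp_bounded[OF compact_continuous_image[OF continuous_on_subset[OF p subset_UNIV] compact_Icc[of "-B" B]]]
    unfolding bounded_iff by (metis imageI real_norm_def)
  show ?thesis
  proof (rule cl_bounded_limit)
    show "(\<lambda>x. q n (h x)) \<in> cl" for n using A_polynomial[OF q h] A_cl by blast
    fix x assume "x \<in> space M"
    then have hx: "h x \<in> {-B..B}" using B[of x] by auto
    show "\<bar>q n (h x)\<bar> \<le> C + 1" for n
    proof -
      have "inverse (real (Suc n)) \<le> 1" by (simp add: field_simps)
      with C[OF hx] qp[OF hx, of n] show ?thesis by linarith
    qed
    have "(\<lambda>n. p (h x) - q n (h x)) \<longlonglongrightarrow> 0"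
      by (rule Lim_null_comparison[OF always_eventually LIMSEQ_inverse_real_of_nat])
        (use qp[OF hx] in \<open>auto intro: less_imp_le\<close>)
    from tendsto_diff[OF tendsto_const this, of "p (h x)"]
    show "(\<lambda>n. q n (h x)) \<longlonglongrightarrow> p (h x)" by simp
  qed
qed

lemma cl_indicator_level:
  assumes h: "h \<in> A"
  shows "indicator {x \<in> space M. c < h x} \<in> cl"
proof (rule cl_bounded_limit)
  \<comment> \<open>For \<open>n > 0\<close> a ramp that is 0 up to \<open>c\<close> and reaches 1
    at \<open>c + 1/n\<close>; the limit is the indicator of the open half-line above
    \<open>c\<close>.\<close>
  let ?p = "\<lambda>n y. min 1 (real n * max 0 (y - c))"
  show "(\<lambda>x. ?p n (h x)) \<in> cl" for n
    by (rule cl_continuous[OF h]) (intro continuous_intros)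
  fix x assume x: "x \<in> space M"
  show "\<bar>?p n (h x)\<bar> \<le> 1" for n by (auto simp: min_def)
  show "(\<lambda>n. ?p n (h x)) \<longlonglongrightarrow> indicator {x \<in> space M. c < h x} x"
  proof (cases "c < h x")
    case True
    obtain N :: nat where N: "1 / (h x - c) < N" using reals_Archimedean2 by blast
    have "?p n (h x) = 1" if "n \<ge> N" for n
    proof -
      have "1 / (h x - c) < n" using N that by (meson less_le_trans of_nat_le_iff)
      then have "1 < real n * (h x - c)" using True by (simp add: field_simps)
      then show ?thesis using True by (simp add: max_def min_def)
    qed
    then have "(\<lambda>n. ?p n (h x)) \<longlonglongrightarrow> 1"
      by (intro tendsto_eventually) (auto simp: eventually_sequentially)
    then show ?thesis using True x by simp
  qed (use x in \<open>simp add: max_def\<close>)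
qed

text \<open>The sets whose indicator lies in \<open>cl\<close> form a sigma-algebra: bounded
  products give intersections, constants give complements, bounded limits give countable unions. The
  generators are covered by \<open>cl_indicator_level\<close>.\<close>

lemma sigma_closure:
  "sets (sigma (space M) {{x \<in> space M. c < h x} |h c. h \<in> A}) \<subseteq> {S \<in> sets M. indicator S \<in> cl}"
proof -
  let ?D = "{S \<in> sets M. indicator S \<in> cl}"
  let ?G = "{{x \<in> space M. c < h x} |h c. h \<in> A}"
  have G: "?G \<subseteq> ?D"
    using cl_indicator_level A_meas by (auto intro!: borel_measurable_less)
  have one: "(\<lambda>x. 1) \<in> cl" using A_one A_cl by blast
  have Int: "S \<inter> T \<in> ?D" if "S \<in> ?D" "T \<in> ?D" for S T
    using cl_bounded_mult[of "indicator S" 1 "indicator T"] that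
    by (auto simp: indicator_inter_arith[abs_def] indicator_le_1)
  have Compl: "space M - S \<in> ?D" if "S \<in> ?D" for S
  proof -
    have "(\<lambda>x. 1 - indicator S x :: real) \<in> cl" using cl_diff[OF one] that by auto
    note compl = this
    \<comment> \<open>\<open>1 - indicator S\<close> agrees with this indicator only on
      \<open>space M\<close>. A constant sequence in \<open>cl_bounded_limit\<close>, which compares
      functions on \<open>space M\<close> alone, bridges the difference.\<close>
    have "indicator (space M - S) \<in> cl"
    proof (rule cl_bounded_limit)
      show "(\<lambda>x. 1 - indicator S x :: real) \<in> cl" for n :: nat by (rule compl)
      fix x assume "x \<in> space M"
      then have "indicator (space M - S) x = (1 - indicator S x :: real)"
        by (simp add: indicator_def)
      then show "(\<lambda>n. 1 - indicator S x :: real) \<longlonglongrightarrow> indicator (space M - S) x" by simp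
      show "\<bar>1 - indicator S x :: real\<bar> \<le> 1" by (simp add: indicator_def)
    qed
    then show ?thesis using that by auto
  qed
  have Un: "S \<union> T \<in> ?D" if "S \<in> ?D" "T \<in> ?D" for S T
  proof -
    have "S \<union> T = space M - ((space M - S) \<inter> (space M - T))"
      using that sets.sets_into_space by blast
    then show ?thesis using Compl Int that by simp
  qed
  have "indicator {} = (\<lambda>_ :: 'a. 0 :: real)" by (simp add: fun_eq_iff)
  with A_const[of 0] have "indicator {} \<in> A" by (simp only:)
  then have empty: "{} \<in> ?D"
    using A_cl by blast
  have fUn: "(\<Union>i<n. S i) \<in> ?D" if "\<And>i. S i \<in> ?D" for S :: "nat \<Rightarrow> _" and n
    by (induction n) (use Un that empty in \<open>simp_all add: lessThan_Suc\<close>)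
  have cUn: "(\<Union>i. S i) \<in> ?D" if S: "\<And>i. S i \<in> ?D" for S :: "nat \<Rightarrow> _"
  proof -
    have "indicator (\<Union>i. S i) \<in> cl"
    proof (rule cl_bounded_limit)
      show "indicator (\<Union>i<n. S i) \<in> cl" for n using fUn[OF S] by simp
      show "\<bar>indicator (\<Union>i<n. S i) x :: real\<bar> \<le> 1" for n x by (simp add: indicator_le_1)
      show "(\<lambda>n. indicator (\<Union>i<n. S i) x :: real) \<longlonglongrightarrow> indicator (\<Union>i. S i) x" for x
        by (rule LIMSEQ_indicator_UN)
    qed
    then show ?thesis using S by auto
  qed
  have "sigma_algebra (space M) ?D"
    unfolding sigma_algebra_iff2
  proof (intro conjI ballI allI impI)
    show "?D \<subseteq> Pow (space M)" using sets.sets_into_space by auto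
    show "\<Union> (range S) \<in> ?D" if "range S \<subseteq> ?D" for S :: "nat \<Rightarrow> _"
      using that by (intro cUn) blast
  qed (fact empty, fact Compl)
  from sigma_algebra.sigma_sets_subset[OF this G]
  show ?thesis by (subst sets_measure_of) auto
qed

text \<open>Induction over nonnegative measurable functions, starting from indicators. The pieces
  met on the way are square-integrable because the function built from them dominates them or is a
  nonzero multiple of them.\<close>

theorem l2_dense:
  assumes f: "f \<in> borel_measurable (sigma (space M) {{x \<in> space M. c < h x} |h c. h \<in> A})"
    and f2: "f \<in> sqint M"
  shows "f \<in> cl"
proof -
  let ?N = "sigma (space M) {{x \<in> space M. c < h x} |h c. h \<in> A}"
  have sp: "space ?N = space M" by (rule space_measure_of) auto
  have sub: "sets ?N \<subseteq> sets M" using sigma_closure by blast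
  have NM: "u \<in> borel_measurable M" if "u \<in> borel_measurable ?N" for u :: "'a \<Rightarrow> real"
    using that sub sp by (auto simp: measurable_def)
  have mono: "u \<in> sqint M" if "v \<in> sqint M" "u \<in> borel_measurable M"
     "\<And>x. x \<in> space M \<Longrightarrow> 0 \<le> u x \<and> u x \<le> v x" for u v
  proof -
    have "integrable M (\<lambda>x. (u x)\<^sup>2)"
      by (rule Bochner_Integration.integrable_bound[OF sqint_integrable[OF that(1)]])
        (use that(2) in measurable, use that(3) in \<open>auto intro!: AE_I2 power_mono\<close>)
    then show ?thesis using that by (simp add: sqint_def)
  qed
  have nonneg: "u \<in> cl" if u: "u \<in> borel_measurable ?N" "\<And>x. 0 \<le> u x" and u2: "u \<in> sqint M" for u
    using u u2
  proof (induction u rule: borel_measurable_induct_real)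
    case (set S)
    then show ?case using sigma_closure by blast
  next
    case (mult u c)
    show ?case
    proof (cases "c = 0")
      case True then show ?thesis using A_const[of 0] A_cl by auto
    next
      case False
      then have "u \<in> sqint M" using sqint_cmult[OF mult.prems, of "1 / c"] by simp
      then show ?thesis using cl_scale mult.IH by blast
    qed
  next
    case (add u v)
    have "u \<in> sqint M"
      by (rule mono[OF add.prems NM[OF add.hyps(1)]]) (simp add: add.hyps)
    moreover have "v \<in> sqint M"
      by (rule mono[OF add.prems NM[OF add.hyps(3)]]) (simp add: add.hyps)
    ultimately show ?case using cl_add add.IH by blast
  next
    case (seq U)
    have um: "u \<in> borel_measurable M" using seq.prems sqint_measurable by blast
    have Uu: "U i x \<le> u x" if "x \<in> space M" for i x
      using incseq_le[OF _ seq.hyps(4)[of x], of i] seq.hyps(3) that sp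
      by (auto simp: incseq_def le_fun_def)
    have U2: "U i \<in> sqint M" for i
      by (rule mono[OF seq.prems NM[OF seq.hyps(1)]]) (simp add: seq.hyps(2) Uu)
    show ?case
    \<comment> \<open>Since \<open>0 <= U n <= u\<close>, the squared errors are dominated by the
      square of \<open>u\<close> itself.\<close>
    proof (rule cl_dominated[where h = U and w = "\<lambda>x. (u x)\<^sup>2"])
      show "U n \<in> cl" for n using seq.IH U2 by blast
      show "(\<lambda>n. U n x) \<longlonglongrightarrow> u x" if "x \<in> space M" for x using seq.hyps(4) that sp by simp
      show "(u x - U n x)\<^sup>2 \<le> (u x)\<^sup>2" if "x \<in> space M" for n x
        using Uu[OF that, of n] seq.hyps(2)[of n x] by (intro power_mono) auto
    qed (use um seq.prems sqint_integrable[OF seq.prems] in simp_all)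
  qed
  have [measurable]: "f \<in> borel_measurable ?N" by (rule f)
  have "(\<lambda>x. max 0 (f x)) \<in> cl" "(\<lambda>x. max 0 (- f x)) \<in> cl"
  proof -
    have *: "(\<lambda>x. \<bar>f x\<bar>) \<in> sqint M" using f2 by (auto simp: sqint_def)
    have m1: "(\<lambda>x. max 0 (f x)) \<in> borel_measurable ?N" "(\<lambda>x. max 0 (- f x)) \<in> borel_measurable ?N"
      by measurable
    show "(\<lambda>x. max 0 (f x)) \<in> cl" using mono[OF * NM[OF m1(1)]] by (intro nonneg m1) auto
    show "(\<lambda>x. max 0 (- f x)) \<in> cl" using mono[OF * NM[OF m1(2)]] by (intro nonneg m1) auto
  qed
  from cl_diff[OF this] have "(\<lambda>x. max 0 (f x) - max 0 (- f x)) \<in> cl" .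
  moreover have "(\<lambda>x. max 0 (f x) - max 0 (- f x)) = f" by (auto simp: max_def)
  ultimately show ?thesis by simp
qed

end

section \<open>Gram matrices and Schur products\<close>

lemma ip_sum_left:
  assumes "\<And>k. k \<in> F \<Longrightarrow> f k \<in> sqint M" "h \<in> sqint M"
  shows "ip M (\<lambda>x. \<Sum>k\<in>F. c k * f k x) h = (\<Sum>k\<in>F. c k * ip M (f k) h)"
  using assms
proof (induction F rule: infinite_finite_induct)
  case (insert k F)
  have "(\<lambda>x. c k * f k x) \<in> sqint M" "(\<lambda>x. \<Sum>k\<in>F. c k * f k x) \<in> sqint M"
    using insert.prems by (auto intro!: sqint_sum sqint_cmult)
  from ip_add_left[OF this insert.prems(2)] show ?case
    using insert by (simp add: ip_scale_left)
qed (simp_all add: ip_def)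

lemma ip_sum_right:
  assumes "\<And>k. k \<in> F \<Longrightarrow> f k \<in> sqint M" "h \<in> sqint M"
  shows "ip M h (\<lambda>x. \<Sum>k\<in>F. c k * f k x) = (\<Sum>k\<in>F. c k * ip M h (f k))"
  using ip_sum_left[OF assms, where c = c] by (simp add: ip_commute)

lemma ip_sum_sum:
  assumes "\<And>k. k \<in> F \<Longrightarrow> f k \<in> sqint M" "\<And>l. l \<in> G \<Longrightarrow> g l \<in> sqint M"
  shows "ip M (\<lambda>x. \<Sum>k\<in>F. c k * f k x) (\<lambda>x. \<Sum>l\<in>G. d l * g l x) =
    (\<Sum>k\<in>F. \<Sum>l\<in>G. c k * d l * ip M (f k) (g l))"
proof -
  have "(\<lambda>x. \<Sum>l\<in>G. d l * g l x) \<in> sqint M" using assms(2) by (auto intro!: sqint_sum sqint_cmult)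
  then have "ip M (\<lambda>x. \<Sum>k\<in>F. c k * f k x) (\<lambda>x. \<Sum>l\<in>G. d l * g l x) =
     (\<Sum>k\<in>F. c k * ip M (f k) (\<lambda>x. \<Sum>l\<in>G. d l * g l x))"
    by (intro ip_sum_left assms(1))
  also have "\<dots> = (\<Sum>k\<in>F. c k * (\<Sum>l\<in>G. d l * ip M (f k) (g l)))"
    using assms by (intro sum.cong refl) (simp add: ip_sum_right)
  finally show ?thesis by (simp add: sum_distrib_left mult.assoc)
qed

lemma ip_null:
  assumes "f \<in> sqint M" "g \<in> sqint M" "ip M f f = 0"
  shows "ip M f g = 0"
  using Cauchy_Schwarz_ip[OF assms(1,2)] assms(3) by (simp add: ip_self)

definition psd :: "'k set \<Rightarrow> ('k \<Rightarrow> 'k \<Rightarrow> real) \<Rightarrow> bool" where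
  "psd F S \<longleftrightarrow> (\<forall>c. 0 \<le> (\<Sum>k\<in>F. \<Sum>l\<in>F. c k * c l * S k l))"

lemma psd_zero: "psd F (\<lambda>k l. 0)"
  by (simp add: psd_def)

lemma psd_add: "psd F S \<Longrightarrow> psd F T \<Longrightarrow> psd F (\<lambda>k l. S k l + T k l)"
  by (simp add: psd_def distrib_left sum.distrib add_nonneg_nonneg)

text \<open>Entrywise multiplication by a rank-one matrix is conjugation by a diagonal matrix, which
  the coefficients absorb.\<close>

lemma psd_rank_one:
  assumes "psd F S"
  shows "psd F (\<lambda>k l. u k * u l * S k l)"
  unfolding psd_def
proof
  fix c
  have "0 \<le> (\<Sum>k\<in>F. \<Sum>l\<in>F. (c k * u k) * (c l * u l) * S k l)"
    using assms unfolding psd_def by (rule spec)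
  then show "0 \<le> (\<Sum>k\<in>F. \<Sum>l\<in>F. c k * c l * (u k * u l * S k l))" by (simp add: ac_simps)
qed

text \<open>Schur's product theorem with a Gram matrix as one factor: the form of the product is the
  integral over \<open>x\<close> of the form of \<open>S\<close> at the vector
  \<open>c k * Z k x\<close>, which is nonnegative pointwise.\<close>

lemma schur_gram:
  assumes S: "psd F S" and Z: "\<And>k. k \<in> F \<Longrightarrow> Z k \<in> sqint M"
  shows "psd F (\<lambda>k l. S k l * ip M (Z k) (Z l))"
  unfolding psd_def
proof
  fix c
  have "(\<integral>x. (\<Sum>k\<in>F. \<Sum>l\<in>F. (c k * Z k x) * (c l * Z l x) * S k l) \<partial>M) =
    (\<integral>x. (\<Sum>k\<in>F. \<Sum>l\<in>F. (c k * c l * S k l) * (Z k x * Z l x)) \<partial>M)"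
    by (intro Bochner_Integration.integral_cong refl sum.cong) (simp_all add: ac_simps)
  also have "\<dots> = (\<Sum>k\<in>F. \<Sum>l\<in>F. (c k * c l * S k l) * ip M (Z k) (Z l))"
    using Z by (simp add: ip_def Bochner_Integration.integral_sum
        Bochner_Integration.integrable_sum sqint_mult)
  finally have "(\<integral>x. (\<Sum>k\<in>F. \<Sum>l\<in>F. (c k * Z k x) * (c l * Z l x) * S k l) \<partial>M) =
     (\<Sum>k\<in>F. \<Sum>l\<in>F. c k * c l * (S k l * ip M (Z k) (Z l)))"
    by (simp add: ac_simps)
  moreover have "0 \<le> (\<integral>x. (\<Sum>k\<in>F. \<Sum>l\<in>F. (c k * Z k x) * (c l * Z l x) * S k l) \<partial>M)"
    using S by (intro integral_nonneg_AE AE_I2) (simp add: psd_def)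
  ultimately show "0 \<le> (\<Sum>k\<in>F. \<Sum>l\<in>F. c k * c l * (S k l * ip M (Z k) (Z l)))" by simp
qed

lemma schur_gram_power:
  assumes S: "psd F S" and Z: "\<And>k. k \<in> F \<Longrightarrow> Z k \<in> sqint M"
  shows "psd F (\<lambda>k l. S k l * ip M (Z k) (Z l) ^ m)"
proof (induction m)
  case (Suc m)
  have "psd F (\<lambda>k l. S k l * ip M (Z k) (Z l) ^ m * ip M (Z k) (Z l))"
    by (rule schur_gram[OF Suc]) (rule Z)
  then show ?case by (simp add: ac_simps)
qed (use S in simp)

text \<open>Telescoping: with \<open>A\<close> and \<open>B\<close> the Gram matrices of
  \<open>Z\<close> and \<open>w\<close>, entrywise
  \<open>A^(m+1) - B^(m+1) = (A^m - B^m) A + (A - B) B^m\<close>. The weight \<psi> stays attached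
  to a difference throughout, so \<psi> by itself may be indefinite.\<close>

lemma schur_gram_power_diff:
  fixes Z w :: "'k \<Rightarrow> 'a \<Rightarrow> real"
  assumes Z: "\<And>k. k \<in> F \<Longrightarrow> Z k \<in> sqint M" and w: "\<And>k. k \<in> F \<Longrightarrow> w k \<in> sqint M"
    and r: "psd F (\<lambda>k l. \<psi> k l * (ip M (Z k) (Z l) - ip M (w k) (w l)))"
  shows "psd F (\<lambda>k l. \<psi> k l * (ip M (Z k) (Z l) ^ m - ip M (w k) (w l) ^ m))"
proof (induction m)
  case (Suc m)
  have "psd F (\<lambda>k l. \<psi> k l * (ip M (Z k) (Z l) ^ m - ip M (w k) (w l) ^ m) * ip M (Z k) (Z l) +
     \<psi> k l * (ip M (Z k) (Z l) - ip M (w k) (w l)) * ip M (w k) (w l) ^ m)"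
    by (rule psd_add, rule schur_gram[OF Suc], rule Z, assumption, rule schur_gram_power[OF r], rule w)
  then show ?case by (simp add: algebra_simps)
qed (simp add: psd_zero)

lemma psd_sums:
  assumes "\<And>m. psd F (S m)" "\<And>k l. k \<in> F \<Longrightarrow> l \<in> F \<Longrightarrow> (\<lambda>m. S m k l) sums T k l"
  shows "psd F T"
  unfolding psd_def
proof
  fix c
  have "(\<lambda>m. \<Sum>k\<in>F. \<Sum>l\<in>F. c k * c l * S m k l) sums (\<Sum>k\<in>F. \<Sum>l\<in>F. c k * c l * T k l)"
    by (intro sums_sum sums_mult assms)
  from sums_le[OF _ sums_zero this] assms(1)
  show "0 \<le> (\<Sum>k\<in>F. \<Sum>l\<in>F. c k * c l * T k l)" by (simp add: psd_def)
qed

text \<open>Equal to \<open>cos s cos t cosh y + sin s sin t sinh y\<close>. Up to a normalising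
  factor it is the inner product of two shifted cosines of Gaussian variables with covariance
  \<open>y\<close>, see \<open>ip_cos_cos\<close>.\<close>

definition cosh_mix :: "real \<Rightarrow> real \<Rightarrow> real \<Rightarrow> real" where
  "cosh_mix s t y = (cos (s - t) * exp y + cos (s + t) * exp (- y)) / 2"

text \<open>Even powers come from cosh and odd ones from sinh. In either case the coefficient is a
  product of the same function at \<open>s\<close> and at \<open>t\<close>, hence rank one, which is
  what \<open>psd_rank_one\<close> takes.\<close>

lemma cosh_mix_sums:
  "(\<lambda>m. (if even m then cos s else sin s) * (if even m then cos t else sin t) * (y ^ m / fact m))
     sums cosh_mix s t y"
proof -
  have "(\<lambda>m. (cos (s - t) * (y ^ m / fact m) + cos (s + t) * ((- y) ^ m / fact m)) / 2)
      sums cosh_mix s t y"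
    unfolding cosh_mix_def
    by (intro sums_divide sums_add sums_mult)
      (use exp_converges[of y] exp_converges[of "- y"] in \<open>simp_all add: field_simps\<close>)
  moreover have "(cos (s - t) * (y ^ m / fact m) + cos (s + t) * ((- y) ^ m / fact m)) / 2 =
     (if even m then cos s else sin s) * (if even m then cos t else sin t) * (y ^ m / fact m)" for m
    by (cases "even m") (simp_all add: cos_add cos_diff field_simps)
  ultimately show ?thesis by simp
qed

section \<open>Linear spans and trigonometric sums\<close>

definition lin :: "('i \<Rightarrow> 'a \<Rightarrow> real) \<Rightarrow> 'i set \<Rightarrow> ('a \<Rightarrow> real) set" where
  "lin \<omega> S = {\<lambda>x. \<Sum>i\<in>F. c i * \<omega> i x | F c. finite F \<and> F \<subseteq> S}"

lemma lin_finite: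
  assumes "X \<in> lin \<omega> S" "finite S"
  obtains c where "X = (\<lambda>x. \<Sum>i\<in>S. c i * \<omega> i x)"
proof -
  obtain F c where F: "finite F" "F \<subseteq> S" "X = (\<lambda>x. \<Sum>i\<in>F. c i * \<omega> i x)"
    using assms(1) by (auto simp: lin_def)
  have "X = (\<lambda>x. \<Sum>i\<in>S. (if i \<in> F then c i else 0) * \<omega> i x)"
    unfolding F(3)
  proof
    fix x
    show "(\<Sum>i\<in>F. c i * \<omega> i x) = (\<Sum>i\<in>S. (if i \<in> F then c i else 0) * \<omega> i x)"
      by (rule sum.mono_neutral_cong_left) (use assms(2) F in auto)
  qed
  then show ?thesis by (rule that)
qed

lemma lin_mono: "S \<subseteq> T \<Longrightarrow> lin \<omega> S \<subseteq> lin \<omega> T"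
  unfolding lin_def by blast

lemma lin_finite_support:
  assumes "X \<in> lin \<omega> S"
  shows "\<exists>F. finite F \<and> F \<subseteq> S \<and> X \<in> lin \<omega> F"
  using assms unfolding lin_def by auto

lemma lin_zero: "(\<lambda>x. 0) \<in> lin \<omega> S"
  unfolding lin_def by (auto intro!: exI[of _ "{}"])

lemma lin_empty: "lin \<omega> {} = {\<lambda>x. 0}"
  unfolding lin_def by auto

lemma lin_base: "i \<in> S \<Longrightarrow> \<omega> i \<in> lin \<omega> S"
  unfolding lin_def by (auto intro!: exI[of _ "{i}"] exI[of _ "\<lambda>_. 1"])

lemma lin_scale:
  assumes "X \<in> lin \<omega> S"
  shows "(\<lambda>x. c * X x) \<in> lin \<omega> S"
proof -
  obtain F d where "finite F" "F \<subseteq> S" "X = (\<lambda>x. \<Sum>i\<in>F. d i * \<omega> i x)"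
    using assms by (auto simp: lin_def)
  then show ?thesis unfolding lin_def
    by (auto intro!: exI[of _ F] exI[of _ "\<lambda>i. c * d i"] simp: sum_distrib_left mult.assoc)
qed

lemma lin_add:
  assumes "X \<in> lin \<omega> S" "Y \<in> lin \<omega> S"
  shows "(\<lambda>x. X x + Y x) \<in> lin \<omega> S"
proof -
  obtain F G where FG: "finite F" "F \<subseteq> S" "X \<in> lin \<omega> F" "finite G" "G \<subseteq> S" "Y \<in> lin \<omega> G"
    using assms[THEN lin_finite_support] by auto
  have "X \<in> lin \<omega> (F \<union> G)" "Y \<in> lin \<omega> (F \<union> G)"
    using FG lin_mono[of F "F \<union> G" \<omega>] lin_mono[of G "F \<union> G" \<omega>] by auto
  then obtain c d where "X = (\<lambda>x. \<Sum>i\<in>F\<union>G. c i * \<omega> i x)" "Y = (\<lambda>x. \<Sum>i\<in>F\<union>G. d i * \<omega> i x)"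
    using lin_finite FG by (metis finite_UnI)
  then have "(\<lambda>x. X x + Y x) = (\<lambda>x. \<Sum>i\<in>F\<union>G. (c i + d i) * \<omega> i x)"
    by (auto simp: sum.distrib distrib_right)
  moreover have "finite (F \<union> G)" "F \<union> G \<subseteq> S" using FG by auto
  ultimately show ?thesis unfolding lin_def
    by (intro CollectI exI[of _ "F \<union> G"] exI[of _ "\<lambda>i. c i + d i"] conjI)
qed

lemma lin_diff: "X \<in> lin \<omega> S \<Longrightarrow> Y \<in> lin \<omega> S \<Longrightarrow> (\<lambda>x. X x - Y x) \<in> lin \<omega> S"
  using lin_add[of X \<omega> S "\<lambda>x. -1 * Y x"] lin_scale[of Y \<omega> S "-1"] by simp

lemma lin_sum:
  assumes "\<And>k. k \<in> F \<Longrightarrow> X k \<in> lin \<omega> S"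
  shows "(\<lambda>x. \<Sum>k\<in>F. c k * X k x) \<in> lin \<omega> S"
  using assms
proof (induction F rule: infinite_finite_induct)
  case (insert k F)
  have "(\<lambda>x. c k * X k x + (\<Sum>k\<in>F. c k * X k x)) \<in> lin \<omega> S"
    using insert.IH insert.prems by (intro lin_add lin_scale) auto
  then show ?case by (simp only: sum.insert[OF insert.hyps])
qed (simp_all add: lin_zero)

text \<open>The phase \<open>t\<close> makes real cosines include sines and, when 0 is in
  \<open>V\<close>, constants. Over a linear span the product-to-sum formula makes the set an
  algebra (\<open>trig_lin_mult\<close>).\<close>

inductive_set trig :: "('a \<Rightarrow> real) set \<Rightarrow> ('a \<Rightarrow> real) set" for V where
  trig_cos: "X \<in> V \<Longrightarrow> (\<lambda>x. cos (X x + t)) \<in> trig V"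
| trig_add: "f \<in> trig V \<Longrightarrow> g \<in> trig V \<Longrightarrow> (\<lambda>x. f x + g x) \<in> trig V"
| trig_scale: "f \<in> trig V \<Longrightarrow> (\<lambda>x. c * f x) \<in> trig V"

lemma trig_mono:
  assumes "V \<subseteq> W" "f \<in> trig V"
  shows "f \<in> trig W"
  using assms(2,1) by induction (auto intro: trig.intros)

lemma trig_sum:
  assumes "\<And>k. k \<in> F \<Longrightarrow> f k \<in> trig V" "X \<in> V"
  shows "(\<lambda>x. \<Sum>k\<in>F. c k * f k x) \<in> trig V"
proof -
  have "(\<lambda>x. cos (X x + 0)) \<in> trig V" by (rule trig_cos[OF assms(2)])
  then have "(\<lambda>x. 0 * cos (X x + 0)) \<in> trig V" by (rule trig_scale)
  then have zero: "(\<lambda>x. 0) \<in> trig V" unfolding mult_zero_left .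
  show ?thesis
    using assms(1)
  proof (induction F rule: infinite_finite_induct)
    case (insert k F)
    have "(\<lambda>x. c k * f k x + (\<Sum>k\<in>F. c k * f k x)) \<in> trig V"
      using insert.IH insert.prems by (intro trig_add trig_scale) blast+
    then show ?case by (simp only: sum.insert[OF insert.hyps])
  qed (simp_all add: zero)
qed

lemma trig_finite_support:
  assumes "f \<in> trig (lin \<omega> S)"
  shows "\<exists>F. finite F \<and> F \<subseteq> S \<and> f \<in> trig (lin \<omega> F)"
  using assms
proof induction
  case (trig_cos X t)
  then obtain F where "finite F" "F \<subseteq> S" "X \<in> lin \<omega> F" using lin_finite_support by metis
  then show ?case by (intro exI[of _ F] conjI trig.trig_cos)
next
  case (trig_add f g)
  then obtain F G where FG: "finite F" "F \<subseteq> S" "f \<in> trig (lin \<omega> F)"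
     "finite G" "G \<subseteq> S" "g \<in> trig (lin \<omega> G)" by auto
  have "f \<in> trig (lin \<omega> (F \<union> G))" "g \<in> trig (lin \<omega> (F \<union> G))"
    by (rule trig_mono[OF lin_mono[OF Un_upper1] FG(3)], rule trig_mono[OF lin_mono[OF Un_upper2] FG(6)])
  then have "(\<lambda>x. f x + g x) \<in> trig (lin \<omega> (F \<union> G))" by (rule trig.trig_add)
  moreover have "finite (F \<union> G)" "F \<union> G \<subseteq> S" using FG by auto
  ultimately show ?case by blast
next
  case (trig_scale f c)
  then obtain F where F: "finite F" "F \<subseteq> S" "f \<in> trig (lin \<omega> F)" by auto
  from F(3) have "(\<lambda>x. c * f x) \<in> trig (lin \<omega> F)" by (rule trig.trig_scale)
  with F show ?case by blast
qed

lemma trig_explicit: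
  assumes "f \<in> trig V"
  obtains n :: nat and d Z t where "\<And>k. k < n \<Longrightarrow> Z k \<in> V"
    "f = (\<lambda>x. \<Sum>k<n. d k * cos (Z k x + t k))"
proof -
  have "\<exists>n d Z t. (\<forall>k<n. Z k \<in> V) \<and> f = (\<lambda>x. \<Sum>k<n::nat. d k * cos (Z k x + t k))"
    using assms
  proof induction
    case (trig_cos X t)
    then show ?case by (intro exI[of _ 1] exI[of _ "\<lambda>_. 1"] exI[of _ "\<lambda>_. X"] exI[of _ "\<lambda>_. t"]) auto
  next
    case (trig_add f g)
    obtain n d Z t where f: "\<forall>k<n. Z k \<in> V" "f = (\<lambda>x. \<Sum>k<n::nat. d k * cos (Z k x + t k))"
      using trig_add.IH(1) by blast
    obtain m e Y s where g: "\<forall>k<m. Y k \<in> V" "g = (\<lambda>x. \<Sum>k<m::nat. e k * cos (Y k x + s k))"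
      using trig_add.IH(2) by blast
    define D where "D k = (if k < n then d k else e (k - n))" for k
    define U where "U k = (if k < n then Z k else Y (k - n))" for k
    define T where "T k = (if k < n then t k else s (k - n))" for k
    have "(\<Sum>k<n+m. D k * cos (U k x + T k)) = f x + g x" for x
    proof -
      have "(\<Sum>k<n+m. D k * cos (U k x + T k)) =
          (\<Sum>k<n. D k * cos (U k x + T k)) + (\<Sum>k<m. D (n + k) * cos (U (n + k) x + T (n + k)))"
        by (induction m) (simp_all add: ac_simps)
      also have "\<dots> = f x + g x"
        unfolding f(2) g(2) D_def U_def T_def by (intro arg_cong2[of _ _ _ _ "(+)"] sum.cong) auto
      finally show ?thesis .
    qed
    moreover have "\<forall>k<n+m. U k \<in> V" using f(1) g(1) by (auto simp: U_def)
    ultimately show ?case by (intro exI[of _ "n+m"] exI[of _ D] exI[of _ U] exI[of _ T]) auto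
  next
    case (trig_scale f c)
    obtain n d Z t where f: "\<forall>k<n. Z k \<in> V" "f = (\<lambda>x. \<Sum>k<n::nat. d k * cos (Z k x + t k))"
      using trig_scale.IH by blast
    then have "(\<lambda>x. c * f x) = (\<lambda>x. \<Sum>k<n. (c * d k) * cos (Z k x + t k))"
      by (simp add: sum_distrib_left mult.assoc)
    then show ?case using f(1)
      by (intro exI[of _ n] exI[of _ "\<lambda>k. c * d k"] exI[of _ Z] exI[of _ t] conjI)
  qed
  then obtain n d Z t where Z: "\<forall>k<n. Z k \<in> V"
    and f: "f = (\<lambda>x. \<Sum>k<n::nat. d k * cos (Z k x + t k))" by blast
  show ?thesis by (rule that[OF _ f]) (use Z in simp)
qed

lemma trig_lin_mult:
  assumes "f \<in> trig (lin \<omega> S)" "g \<in> trig (lin \<omega> S)"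
  shows "(\<lambda>x. f x * g x) \<in> trig (lin \<omega> S)"
  using assms(1)
proof induction
  case (trig_cos X t)
  from assms(2) show ?case
  proof induction
    case (trig_cos Y s)
    have "(\<lambda>x. cos (X x + t) * cos (Y x + s)) =
      (\<lambda>x. (1/2) * cos ((X x - Y x) + (t - s)) + (1/2) * cos ((X x + Y x) + (t + s)))"
    proof
      fix x
      show "cos (X x + t) * cos (Y x + s) =
        (1/2) * cos ((X x - Y x) + (t - s)) + (1/2) * cos ((X x + Y x) + (t + s))"
        using cos_times_cos[of "X x + t" "Y x + s"] by (simp add: field_simps)
    qed
    moreover have "\<dots> \<in> trig (lin \<omega> S)"
      using trig_cos \<open>X \<in> lin \<omega> S\<close> by (intro trig.intros lin_add lin_diff)
    ultimately show ?case by simp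
  next
    case (trig_add f g)
    show ?case unfolding distrib_left by (intro trig.trig_add trig_add.IH)
  next
    case (trig_scale f c)
    show ?case unfolding mult.left_commute[of "cos _"] by (intro trig.trig_scale trig_scale.IH)
  qed
next
  case (trig_add f h)
  show ?case unfolding distrib_right by (intro trig.trig_add trig_add.IH)
next
  case (trig_scale f c)
  show ?case unfolding mult.assoc by (intro trig.trig_scale trig_scale.IH)
qed

lemma trig_bounded:
  assumes "f \<in> trig V"
  shows "\<exists>B. \<forall>x. \<bar>f x\<bar> \<le> B"
  using assms
proof induction
  case (trig_cos X t)
  then show ?case by (intro exI[of _ 1]) simp
next
  case (trig_add f g)
  then obtain A B where "\<forall>x. \<bar>f x\<bar> \<le> A" "\<forall>x. \<bar>g x\<bar> \<le> B" by auto
  then show ?case by (intro exI[of _ "A + B"] allI) (metis abs_triangle_ineq add_mono order_trans)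
next
  case (trig_scale f c)
  then obtain B where "\<forall>x. \<bar>f x\<bar> \<le> B" by auto
  then show ?case by (intro exI[of _ "\<bar>c\<bar> * B"]) (simp add: abs_mult mult_left_mono)
qed

lemma trig_measurable:
  assumes "f \<in> trig V" "V \<subseteq> borel_measurable N"
  shows "f \<in> borel_measurable N"
  using assms by induction auto

lemma lin_measurable:
  assumes "X \<in> lin \<omega> S" "\<And>i. i \<in> S \<Longrightarrow> \<omega> i \<in> borel_measurable N"
  shows "X \<in> borel_measurable N"
proof -
  obtain F c where F: "finite F" "F \<subseteq> S" "X = (\<lambda>x. \<Sum>i\<in>F. c i * \<omega> i x)"
    using assms(1) by (auto simp: lin_def)
  then show ?thesis using assms(2) by (auto intro!: borel_measurable_sum borel_measurable_times)
qed

section \<open>Gaussian families\<close>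

lemma (in prob_space) gaussian_var_sqint:
  assumes "gaussian_var M X"
  shows "X \<in> sqint M"
proof -
  have [measurable]: "X \<in> borel_measurable M" using assms by (simp add: gaussian_var_def)
  consider (const) \<mu> where "AE x in M. X x = \<mu>"
    | (normal) \<mu> \<sigma> where "0 < \<sigma>" "distributed M lborel X (\<lambda>x. ennreal (normal_density \<mu> \<sigma> x))"
    using assms by (auto simp: gaussian_var_def)
  then show ?thesis
  proof cases
    case const
    then have "AE x in M. (X x)\<^sup>2 = \<mu>\<^sup>2" by eventually_elim simp
    then have "integrable M (\<lambda>x. (X x)\<^sup>2) \<longleftrightarrow> integrable M (\<lambda>x. \<mu>\<^sup>2)"
      by (intro integrable_cong_AE) auto
    then show ?thesis by (simp add: sqint_def)
  next
    case normal
    have "integrable M (\<lambda>x. (X x - \<mu>)\<^sup>2)"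
      using distributed_integrable[OF normal(2), of "\<lambda>x. (x - \<mu>)\<^sup>2"] normal(1)
        integrable_normal_moment[OF normal(1), of \<mu> 2] by simp
    then have "(\<lambda>x. X x - \<mu>) \<in> sqint M" by (simp add: sqint_def)
    moreover have "(\<lambda>x. \<mu>) \<in> sqint M" by (simp add: sqint_def)
    ultimately have "(\<lambda>x. (X x - \<mu>) + \<mu>) \<in> sqint M" by (rule sqint_add)
    then show ?thesis by simp
  qed
qed

text \<open>Division by the standard deviation \<sigma> reduces this to the standard normal
  characteristic function at \<sigma>. A degenerate variable is almost everywhere 0 by centring and
  obeys the same formula with variance 0.\<close>

lemma (in prob_space) gaussian_var_characteristic:
  assumes "gaussian_var M X" "integral\<^sup>L M X = 0"
  shows "(\<integral>x. cos (X x) \<partial>M) = exp (- (ip M X X) / 2)" and "(\<integral>x. sin (X x) \<partial>M) = 0"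
proof -
  have [measurable]: "X \<in> borel_measurable M" using assms by (simp add: gaussian_var_def)
  consider (const) \<mu> where "AE x in M. X x = \<mu>"
    | (normal) \<mu> \<sigma> where "0 < \<sigma>" "distributed M lborel X (\<lambda>x. ennreal (normal_density \<mu> \<sigma> x))"
    using assms by (auto simp: gaussian_var_def)
  then have "(\<integral>x. cos (X x) \<partial>M) = exp (- (ip M X X) / 2) \<and> (\<integral>x. sin (X x) \<partial>M) = 0"
  proof cases
    case const
    have "integral\<^sup>L M X = (\<integral>x. \<mu> \<partial>M)"
      using const by (intro integral_cong_AE) auto
    then have "\<mu> = 0" using assms(2) by (simp add: prob_space)
    with const have ae: "AE x in M. X x = 0" by simp
    have "(\<integral>x. cos (X x) \<partial>M) = (\<integral>x. 1 \<partial>M)"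
      using ae by (intro integral_cong_AE) (auto elim: eventually_mono)
    moreover have "(\<integral>x. sin (X x) \<partial>M) = (\<integral>x. 0 \<partial>M)"
      using ae by (intro integral_cong_AE) (auto elim: eventually_mono)
    moreover have "ip M X X = (\<integral>x. 0 \<partial>M)"
      unfolding ip_def using ae by (intro integral_cong_AE) (auto elim: eventually_mono)
    ultimately show ?thesis by (simp add: prob_space)
  next
    case normal
    have \<mu>: "\<mu> = 0" using normal_distributed_expectation[OF normal] assms(2) by simp
    have var: "ip M X X = \<sigma>\<^sup>2"
      using normal_distributed_variance[OF normal] assms(2) by (simp add: ip_self)
    have D: "distributed M lborel (\<lambda>x. X x / \<sigma>) std_normal_density"
      using normal normal_standard_normal_convert[OF normal(1), of X \<mu>] \<mu> by simp
    have "(\<integral>x. iexp (X x) \<partial>M) = (\<integral>x. iexp (\<sigma> * (X x / \<sigma>)) \<partial>M)"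
      using normal(1) by simp
    also have "\<dots> = (\<integral>z. iexp (\<sigma> * z) \<partial>distr M lborel (\<lambda>x. X x / \<sigma>))"
      by (subst integral_distr) auto
    also have "\<dots> = char std_normal_distribution \<sigma>"
      unfolding distributed_distr_eq_density[OF D] char_def ..
    also have "\<dots> = complex_of_real (exp (- \<sigma>\<^sup>2 / 2))"
      by (simp add: char_std_normal_distribution)
    finally have *: "(\<integral>x. cis (X x) \<partial>M) = complex_of_real (exp (- \<sigma>\<^sup>2 / 2))"
      by (simp add: cis_conv_exp)
    have int: "integrable M (\<lambda>x. cis (X x))"
      unfolding cis_conv_exp by (rule integrable_iexp) auto
    have "(\<integral>x. cos (X x) \<partial>M) = Re (\<integral>x. cis (X x) \<partial>M)"
      by (subst integral_Re[OF int, symmetric]) simp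
    moreover have "(\<integral>x. sin (X x) \<partial>M) = Im (\<integral>x. cis (X x) \<partial>M)"
      by (subst integral_Im[OF int, symmetric]) simp
    ultimately show ?thesis unfolding * var by simp
  qed
  then show "(\<integral>x. cos (X x) \<partial>M) = exp (- (ip M X X) / 2)" and "(\<integral>x. sin (X x) \<partial>M) = 0" by auto
qed

locale centred_gaussian = prob_space M for M :: "'a measure" +
  fixes \<omega> :: "'i \<Rightarrow> 'a \<Rightarrow> real"
  assumes gaussian: "X \<in> lin \<omega> UNIV \<Longrightarrow> gaussian_var M X"
    and centred: "integral\<^sup>L M (\<omega> i) = 0"
begin

lemma lin_sqint: "X \<in> lin \<omega> S \<Longrightarrow> X \<in> sqint M"
  using gaussian_var_sqint gaussian lin_mono[of S UNIV \<omega>] by blast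

lemma omega_sqint: "\<omega> i \<in> sqint M"
  by (rule lin_sqint[OF lin_base[of i UNIV]]) simp

lemma lin_centred:
  assumes "X \<in> lin \<omega> S"
  shows "integral\<^sup>L M X = 0"
proof -
  obtain F c where "X = (\<lambda>x. \<Sum>i\<in>F. c i * \<omega> i x)"
    using assms by (auto simp: lin_def)
  moreover have "integrable M (\<omega> i)" for i
    using omega_sqint[of i] by (auto simp: sqint_def intro: square_integrable_imp_integrable)
  ultimately show ?thesis using centred by simp
qed

lemma integral_cos_shift:
  assumes "X \<in> lin \<omega> S"
  shows "(\<integral>x. cos (X x + t) \<partial>M) = cos t * exp (- (ip M X X) / 2)"
proof -
  have X: "X \<in> lin \<omega> UNIV" using assms lin_mono[of S UNIV \<omega>] by blast
  have [measurable]: "X \<in> borel_measurable M" using lin_sqint[OF X] by (rule sqint_measurable)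
  have int: "integrable M (\<lambda>x. cos (X x))" "integrable M (\<lambda>x. sin (X x))"
    by (rule integrable_const_bound[where B = 1], simp, measurable)+
  have "(\<integral>x. cos (X x + t) \<partial>M) = (\<integral>x. cos (X x) * cos t - sin (X x) * sin t \<partial>M)"
    by (simp add: cos_add)
  also have "\<dots> = (\<integral>x. cos (X x) \<partial>M) * cos t - (\<integral>x. sin (X x) \<partial>M) * sin t"
    using int by simp
  finally show ?thesis
    using gaussian_var_characteristic[OF gaussian[OF X] lin_centred[OF X]] by simp
qed

text \<open>The product is half the sum of cosines of \<open>X - Y\<close> and \<open>X + Y\<close>,
  whose variances differ from the sum of the variances by minus and plus twice the covariance; this
  produces the two exponentials in \<open>cosh_mix\<close>.\<close>

lemma ip_cos_cos:
  assumes "X \<in> lin \<omega> UNIV" "Y \<in> lin \<omega> UNIV"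
  shows "ip M (\<lambda>x. cos (X x + s)) (\<lambda>x. cos (Y x + t)) =
    exp (- (ip M X X + ip M Y Y) / 2) * cosh_mix s t (ip M X Y)"
proof -
  note sq = lin_sqint[OF assms(1)] lin_sqint[OF assms(2)]
  note [measurable] = sq[THEN sqint_measurable]
  have d: "(\<lambda>x. X x - Y x) \<in> lin \<omega> UNIV" and a: "(\<lambda>x. X x + Y x) \<in> lin \<omega> UNIV"
    by (rule lin_diff[OF assms], rule lin_add[OF assms])
  have dd: "ip M (\<lambda>x. X x - Y x) (\<lambda>x. X x - Y x) = ip M X X + ip M Y Y - 2 * ip M X Y"
    using sq lin_sqint[OF d] by (simp add: ip_diff_left ip_diff_right ip_commute[of M Y X])
  have aa: "ip M (\<lambda>x. X x + Y x) (\<lambda>x. X x + Y x) = ip M X X + ip M Y Y + 2 * ip M X Y"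
    using sq lin_sqint[OF a] by (simp add: ip_add_left ip_add_right ip_commute[of M Y X])
  have int: "integrable M (\<lambda>x. cos ((X x - Y x) + (s - t)))" "integrable M (\<lambda>x. cos ((X x + Y x) + (s + t)))"
    by (rule integrable_const_bound[where B = 1], simp, measurable)+
  have "ip M (\<lambda>x. cos (X x + s)) (\<lambda>x. cos (Y x + t)) =
     (\<integral>x. (cos ((X x - Y x) + (s - t)) + cos ((X x + Y x) + (s + t))) / 2 \<partial>M)"
    unfolding ip_def cos_times_cos by (simp add: algebra_simps)
  also have "\<dots> = ((\<integral>x. cos ((X x - Y x) + (s - t)) \<partial>M) + (\<integral>x. cos ((X x + Y x) + (s + t)) \<partial>M)) / 2"
    using int by simp
  also have "\<dots> = (cos (s - t) * exp (- (ip M X X + ip M Y Y) / 2 + ip M X Y) +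
     cos (s + t) * exp (- (ip M X X + ip M Y Y) / 2 + - ip M X Y)) / 2"
    unfolding integral_cos_shift[OF d] integral_cos_shift[OF a] dd aa
    by (simp add: field_simps)
  finally show ?thesis unfolding cosh_mix_def exp_add by (simp add: algebra_simps)
qed

text \<open>Gram-Schmidt, one site at a time: the new direction \<open>r\<close> is the residual of
  \<open>\<omega> k\<close> given the old sites, so adding a multiple of \<open>r\<close> preserves
  the orthogonality already obtained.\<close>

lemma projection_exists:
  assumes "finite K"
  shows "X \<in> lin \<omega> UNIV \<Longrightarrow> \<exists>w\<in>lin \<omega> K. \<forall>k\<in>K. ip M (\<lambda>x. X x - w x) (\<omega> k) = 0"
  using assms
proof (induction K arbitrary: X rule: finite_induct)
  case empty
  show ?case by (intro bexI[of _ "\<lambda>x. 0"] lin_zero) simp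
next
  case (insert k K)
  have sub: "lin \<omega> K \<subseteq> lin \<omega> (insert k K)" by (rule lin_mono) auto
  obtain w where w: "w \<in> lin \<omega> K" and wo: "\<And>j. j \<in> K \<Longrightarrow> ip M (\<lambda>x. X x - w x) (\<omega> j) = 0"
    using insert.IH[OF insert.prems] by blast
  obtain v where v: "v \<in> lin \<omega> K" and vo: "\<And>j. j \<in> K \<Longrightarrow> ip M (\<lambda>x. \<omega> k x - v x) (\<omega> j) = 0"
    using insert.IH[of "\<omega> k"] lin_base[of k UNIV \<omega>] by blast
  define r where "r = (\<lambda>x. \<omega> k x - v x)"
  define q where "q = (\<lambda>x. X x - w x)"
  have r: "r \<in> lin \<omega> (insert k K)"
    unfolding r_def using v sub by (intro lin_diff lin_base) auto
  note sq = lin_sqint[OF insert.prems] lin_sqint[OF w] lin_sqint[OF v] lin_sqint[OF r] omega_sqint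
  have q: "q \<in> sqint M" unfolding q_def using sq by (intro sqint_diff)
  have orth: "ip M Y v = 0" if "Y \<in> sqint M" "\<And>j. j \<in> K \<Longrightarrow> ip M Y (\<omega> j) = 0" for Y
  proof -
    obtain c where "v = (\<lambda>x. \<Sum>i\<in>K. c i * \<omega> i x)" using lin_finite[OF v insert.hyps(1)] .
    then show ?thesis using that by (simp add: ip_sum_right omega_sqint)
  qed
  have rv: "ip M r v = 0" and qv: "ip M q v = 0"
    using orth[OF lin_sqint[OF r]] orth[OF q] vo wo unfolding r_def q_def by blast+
  have wk: "ip M Y (\<omega> k) = ip M Y r" if "Y \<in> sqint M" "ip M Y v = 0" for Y
    using ip_diff_right[OF omega_sqint lin_sqint[OF v] that(1), of k] that(2) unfolding r_def by simp
  \<comment> \<open>If \<open>r\<close> is null, \<open>\<omega> k\<close> lies almost everywhere in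
    the old span; then \<open>ip M q r = 0\<close> by Cauchy-Schwarz, and the coefficient 0 is
    right.\<close>
  define a where "a = (if ip M r r = 0 then 0 else ip M q r / ip M r r)"
  have ar: "ip M q r = a * ip M r r"
    using ip_null[OF lin_sqint[OF r] q] by (simp add: a_def ip_commute)
  let ?w = "\<lambda>x. w x + a * r x"
  have sr: "(\<lambda>x. a * r x) \<in> sqint M" using sqint_cmult[OF lin_sqint[OF r]] .
  have eq: "ip M (\<lambda>x. X x - ?w x) Y = ip M q Y - a * ip M r Y" if "Y \<in> sqint M" for Y
  proof -
    have "(\<lambda>x. X x - ?w x) = (\<lambda>x. q x - a * r x)" by (simp add: q_def algebra_simps)
    then show ?thesis using ip_diff_left[OF q sr that] by (simp add: ip_scale_left)
  qed
  show ?case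
  proof (intro bexI[of _ ?w] ballI)
    show "?w \<in> lin \<omega> (insert k K)"
      using w sub r by (intro lin_add lin_scale) auto
    fix j assume j: "j \<in> insert k K"
    show "ip M (\<lambda>x. X x - ?w x) (\<omega> j) = 0"
    proof (cases "j = k")
      case True
      show ?thesis unfolding eq[OF omega_sqint] True wk[OF q qv] wk[OF lin_sqint[OF r] rv]
        by (simp add: ar)
    next
      case False
      with j have "j \<in> K" by simp
      then show ?thesis unfolding eq[OF omega_sqint] using wo[of j] vo[of j]
        by (simp add: q_def r_def)
    qed
  qed
qed

lemma ip_lin_zero:
  assumes "Y \<in> sqint M" "\<And>k. k \<in> K \<Longrightarrow> ip M Y (\<omega> k) = 0" "v \<in> lin \<omega> K"
  shows "ip M Y v = 0"
proof -
  obtain F c where "F \<subseteq> K" "v = (\<lambda>x. \<Sum>i\<in>F. c i * \<omega> i x)"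
    using assms(3) by (auto simp: lin_def)
  then show ?thesis using assms(1,2) by (auto simp: ip_sum_right omega_sqint subset_iff)
qed

lemma trig_sqint:
  assumes "f \<in> trig (lin \<omega> S)"
  shows "f \<in> sqint M"
proof -
  obtain B where "\<And>x. \<bar>f x\<bar> \<le> B" using trig_bounded[OF assms] by blast
  moreover have "f \<in> borel_measurable M"
    by (rule trig_measurable[OF assms]) (use lin_sqint sqint_measurable in blast)
  ultimately show ?thesis by (intro sqint_bounded[where B = B])
qed

text \<open>The residual of a cosine given the variables in \<open>K\<close>: if \<open>Z = w + r\<close> with \<open>w\<close> in the span
  of these variables and \<open>r\<close> orthogonal to it, then the conditional expectation of
  \<open>cos (Z + t)\<close> is \<open>exp (- Var r / 2) cos (w + t)\<close>.\<close>

definition cos_residual :: "('a \<Rightarrow> real) \<Rightarrow> ('a \<Rightarrow> real) \<Rightarrow> real \<Rightarrow> 'a \<Rightarrow> real" where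
  "cos_residual Z w t = (\<lambda>x. cos (Z x + t) - exp (- (ip M Z Z - ip M w w) / 2) * cos (w x + t))"

lemma cos_sqint: "X \<in> lin \<omega> S \<Longrightarrow> (\<lambda>x. cos (X x + t)) \<in> sqint M"
  by (rule trig_sqint[OF trig_cos])

lemma cos_residual_sqint: "Z \<in> lin \<omega> S \<Longrightarrow> w \<in> lin \<omega> T \<Longrightarrow> cos_residual Z w t \<in> sqint M"
  unfolding cos_residual_def by (intro sqint_diff sqint_cmult cos_sqint)

text \<open>The two terms have the same \<open>cosh_mix\<close> factor, because \<open>Z\<close> and
  \<open>w\<close> have equal covariance with \<open>Y\<close>. The exponential weight in the
  residual is exactly the quotient of the two prefactors in \<open>ip_cos_cos\<close>.\<close>

lemma ip_cos_residual_cos: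
  assumes Z: "Z \<in> lin \<omega> UNIV" and w: "w \<in> lin \<omega> UNIV" and Y: "Y \<in> lin \<omega> UNIV"
    and orth: "ip M Z Y = ip M w Y"
  shows "ip M (cos_residual Z w s) (\<lambda>x. cos (Y x + t)) = 0"
proof -
  have "ip M (cos_residual Z w s) (\<lambda>x. cos (Y x + t)) =
     exp (- (ip M Z Z + ip M Y Y) / 2) * cosh_mix s t (ip M Z Y) -
     exp (- (ip M Z Z - ip M w w) / 2) *
      (exp (- (ip M w w + ip M Y Y) / 2) * cosh_mix s t (ip M w Y))"
    unfolding cos_residual_def
    by (subst ip_diff_left; (intro sqint_cmult cos_sqint[OF Z] cos_sqint[OF w] cos_sqint[OF Y])?)
      (simp only: ip_scale_left ip_cos_cos[OF Z Y] ip_cos_cos[OF w Y])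
  also have "\<dots> = 0"
    unfolding orth mult.assoc[symmetric] exp_add[symmetric] by (simp add: field_simps)
  finally show ?thesis .
qed

text \<open>The first residual is orthogonal to the cosine of \<open>v\<close>, so the second may be
  replaced by its leading cosine. What remains is \<open>cosh_mix\<close> at the full covariance
  minus \<open>cosh_mix\<close> at the projected one.\<close>

lemma ip_cos_residual:
  assumes Z: "Z \<in> lin \<omega> UNIV" and w: "w \<in> lin \<omega> UNIV" and Y: "Y \<in> lin \<omega> UNIV" and v: "v \<in> lin \<omega> UNIV"
    and orth: "ip M Z v = ip M w v" "ip M Y w = ip M v w"
  shows "ip M (cos_residual Z w s) (cos_residual Y v t) =
    exp (- ip M Z Z / 2) * exp (- ip M Y Y / 2) * (cosh_mix s t (ip M Z Y) - cosh_mix s t (ip M w v))"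
proof -
  have "ip M (cos_residual Z w s) (cos_residual Y v t) = ip M (cos_residual Z w s) (\<lambda>x. cos (Y x + t))"
    unfolding cos_residual_def[of Y]
    by (subst ip_diff_right; (intro sqint_cmult cos_sqint[OF Y] cos_sqint[OF v] cos_residual_sqint[OF Z w])?)
      (simp add: ip_scale_right ip_cos_residual_cos[OF Z w v orth(1)])
  also have "\<dots> = exp (- (ip M Z Z + ip M Y Y) / 2) * cosh_mix s t (ip M Z Y) -
     exp (- (ip M Z Z - ip M w w) / 2) *
      (exp (- (ip M w w + ip M Y Y) / 2) * cosh_mix s t (ip M w Y))"
    unfolding cos_residual_def
    by (subst ip_diff_left; (intro sqint_cmult cos_sqint[OF Z] cos_sqint[OF w] cos_sqint[OF Y])?)
      (simp only: ip_scale_left ip_cos_cos[OF Z Y] ip_cos_cos[OF w Y])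
  also have "ip M w Y = ip M w v" using orth(2) by (simp add: ip_commute)
  also have "exp (- (ip M Z Z + ip M Y Y) / 2) = exp (- ip M Z Z / 2) * exp (- ip M Y Y / 2)"
    unfolding exp_add[symmetric] by (simp add: field_simps)
  also have "exp (- (ip M Z Z - ip M w w) / 2) *
      (exp (- (ip M w w + ip M Y Y) / 2) * cosh_mix s t (ip M w v)) =
      exp (- ip M Z Z / 2) * exp (- ip M Y Y / 2) * cosh_mix s t (ip M w v)"
    unfolding mult.assoc[symmetric] exp_add[symmetric] by (simp add: diff_divide_distrib add_divide_distrib)
  finally show ?thesis
    by (simp only: right_diff_distrib)
qed

text \<open>Each term of the series is a diagonal conjugate of \<psi> times a difference of powers
  of the Gram matrices of \<open>Z\<close> and \<open>w\<close>. For exponent 1 that difference is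
  the Gram matrix of the linear residuals, which is where the hypothesis enters.\<close>

lemma psd_cos_residual:
  assumes Z: "\<And>k. k \<in> F \<Longrightarrow> Z k \<in> lin \<omega> UNIV" and w: "\<And>k. k \<in> F \<Longrightarrow> w k \<in> lin \<omega> UNIV"
    and orth: "\<And>k l. k \<in> F \<Longrightarrow> l \<in> F \<Longrightarrow> ip M (Z k) (w l) = ip M (w k) (w l)"
    and r: "psd F (\<lambda>k l. \<psi> k l * ip M (\<lambda>x. Z k x - w k x) (\<lambda>x. Z l x - w l x))"
  shows "psd F (\<lambda>k l. \<psi> k l * ip M (cos_residual (Z k) (w k) (t k)) (cos_residual (Z l) (w l) (t l)))"
proof -
  have res: "ip M (\<lambda>x. Z k x - w k x) (\<lambda>x. Z l x - w l x) = ip M (Z k) (Z l) - ip M (w k) (w l)"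
    if "k \<in> F" "l \<in> F" for k l
    using lin_sqint[OF Z[OF that(1)]] lin_sqint[OF Z[OF that(2)]] lin_sqint[OF w[OF that(1)]]
      lin_sqint[OF w[OF that(2)]] orth[OF that] orth[OF that(2,1)]
    by (simp add: ip_diff_left ip_diff_right sqint_diff ip_commute[of M "w k"])
  have r': "psd F (\<lambda>k l. \<psi> k l * (ip M (Z k) (Z l) - ip M (w k) (w l)))"
    using r unfolding psd_def by (simp add: res cong: sum.cong)
  let ?s = "\<lambda>m x. if even (m :: nat) then cos x else sin x"
  \<comment> \<open>The factor shared by row and column; the square root splits
    \<open>1 / m!\<close> evenly between them.\<close>
  let ?u = "\<lambda>m k. exp (- ip M (Z k) (Z k) / 2) * ?s m (t k) / sqrt (fact m)"
  show ?thesis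
  proof (rule psd_sums)
    show "psd F (\<lambda>k l. ?u m k * ?u m l *
        (\<psi> k l * (ip M (Z k) (Z l) ^ m - ip M (w k) (w l) ^ m)))" for m
      by (intro psd_rank_one schur_gram_power_diff r' lin_sqint[OF Z] lin_sqint[OF w])
    fix k l assume kl: "k \<in> F" "l \<in> F"
    let ?a = "ip M (Z k) (Z l)" and ?b = "ip M (w k) (w l)"
    let ?c = "\<psi> k l * (exp (- ip M (Z k) (Z k) / 2) * exp (- ip M (Z l) (Z l) / 2))"
    have "(\<lambda>m. ?c * (?s m (t k) * ?s m (t l) * (?a ^ m / fact m) - ?s m (t k) * ?s m (t l) * (?b ^ m / fact m)))
      sums (?c * (cosh_mix (t k) (t l) ?a - cosh_mix (t k) (t l) ?b))"
      by (intro sums_mult sums_diff cosh_mix_sums)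
    moreover have "?c * (cosh_mix (t k) (t l) ?a - cosh_mix (t k) (t l) ?b) =
       \<psi> k l * ip M (cos_residual (Z k) (w k) (t k)) (cos_residual (Z l) (w l) (t l))"
      by (subst ip_cos_residual) (use Z w kl orth in simp_all)
    moreover have "?c * (?s m (t k) * ?s m (t l) * (?a ^ m / fact m) - ?s m (t k) * ?s m (t l) * (?b ^ m / fact m)) =
      ?u m k * ?u m l * (\<psi> k l * (?a ^ m - ?b ^ m))" for m
    proof -
      have "sqrt (fact m) * sqrt (fact m) = (fact m :: real)" by simp
      then show ?thesis by (simp add: field_simps del: real_sqrt_mult_self)
    qed
    ultimately show "(\<lambda>m. ?u m k * ?u m l * (\<psi> k l * (?a ^ m - ?b ^ m))) sums
       (\<psi> k l * ip M (cos_residual (Z k) (w k) (t k)) (cos_residual (Z l) (w l) (t l)))"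
      by (simp only:)
  qed
qed

end

section \<open>Conditional correlation in Gaussian families\<close>

text \<open>The disjoint sum \<open>F <+> G\<close> indexes a 2 by 2 block matrix with weight \<rho>
  on the diagonal blocks; its quadratic form is precisely the expression by which correlation bounds
  are encoded.\<close>

lemma ip_case_sum:
  assumes f: "\<And>k. k \<in> F \<Longrightarrow> f k \<in> sqint M" and g: "\<And>l. l \<in> G \<Longrightarrow> g l \<in> sqint M"
    and fin: "finite F" "finite G"
  shows "(\<Sum>k\<in>F <+> G. \<Sum>l\<in>F <+> G. c k * c l *
      ((if isl k = isl l then \<rho> else 1) * ip M (case_sum f g k) (case_sum f g l))) =
    \<rho> * ip M (\<lambda>x. \<Sum>k\<in>F. c (Inl k) * f k x) (\<lambda>x. \<Sum>k\<in>F. c (Inl k) * f k x) +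
    \<rho> * ip M (\<lambda>x. \<Sum>l\<in>G. c (Inr l) * g l x) (\<lambda>x. \<Sum>l\<in>G. c (Inr l) * g l x) +
    2 * ip M (\<lambda>x. \<Sum>k\<in>F. c (Inl k) * f k x) (\<lambda>x. \<Sum>l\<in>G. c (Inr l) * g l x)"
proof -
  let ?A = "\<Sum>k\<in>F. \<Sum>l\<in>F. c (Inl k) * c (Inl l) * ip M (f k) (f l)"
  let ?B = "\<Sum>k\<in>G. \<Sum>l\<in>G. c (Inr k) * c (Inr l) * ip M (g k) (g l)"
  let ?C = "\<Sum>k\<in>F. \<Sum>l\<in>G. c (Inl k) * c (Inr l) * ip M (f k) (g l)"
  let ?D = "\<Sum>k\<in>G. \<Sum>l\<in>F. c (Inr k) * c (Inl l) * ip M (g k) (f l)"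
  have "?D = (\<Sum>l\<in>F. \<Sum>k\<in>G. c (Inr k) * c (Inl l) * ip M (g k) (f l))" by (rule sum.swap)
  also have "\<dots> = ?C" by (intro sum.cong refl) (simp add: ip_commute)
  finally have D: "?D = ?C" .
  have e: "x * y * (\<rho> * z) = \<rho> * (x * y * z)" for x y z :: real by simp
  have "(\<Sum>k\<in>F <+> G. \<Sum>l\<in>F <+> G. c k * c l *
      ((if isl k = isl l then \<rho> else 1) * ip M (case_sum f g k) (case_sum f g l))) =
     \<rho> * ?A + ?C + (?D + \<rho> * ?B)"
    using fin by (simp add: sum.Plus sum.distrib sum_distrib_left e o_def)
  then show ?thesis unfolding D by (simp add: ip_sum_sum f g)
qed

context centred_gaussian
begin

text \<open>The bound \<rho> on partial correlations given \<open>K\<close>, in homogeneous form: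
  inserting arbitrary multiples of \<open>X\<close> and \<open>Y\<close> gives
  \<open>|ip M X Y| <= \<rho> |X| |Y|\<close> for \<open>\<rho> >= 0\<close>.\<close>

definition residual_bound :: "real \<Rightarrow> 'i set \<Rightarrow> 'i set \<Rightarrow> 'i set \<Rightarrow> bool" where
  "residual_bound \<rho> I J K \<longleftrightarrow> (\<forall>X\<in>lin \<omega> (I \<union> K). \<forall>Y\<in>lin \<omega> (J \<union> K).
     (\<forall>k\<in>K. ip M X (\<omega> k) = 0) \<longrightarrow> (\<forall>k\<in>K. ip M Y (\<omega> k) = 0) \<longrightarrow>
     0 \<le> \<rho> * ip M X X + \<rho> * ip M Y Y + 2 * ip M X Y)"

lemma residual_ip:
  assumes "X \<in> lin \<omega> S" "p \<in> lin \<omega> T" "\<And>j. j \<in> K \<Longrightarrow> ip M (\<lambda>x. X x - p x) (\<omega> j) = 0" "u \<in> lin \<omega> K"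
  shows "ip M X u = ip M p u"
proof -
  note sq = lin_sqint[OF assms(1)] lin_sqint[OF assms(2)]
  have "ip M (\<lambda>x. X x - p x) u = 0"
    by (rule ip_lin_zero[OF sqint_diff[OF sq] assms(3,4)])
  then show ?thesis using ip_diff_left[OF sq lin_sqint[OF assms(4)]] by simp
qed

lemma lin_UNIV: "X \<in> lin \<omega> S \<Longrightarrow> X \<in> lin \<omega> UNIV"
  using lin_mono[of S UNIV \<omega>] by blast

text \<open>The conditional expectation of a cosine given the sites in \<open>K\<close> is a
  multiple of a cosine, so replacing each term by it gives an \<open>f0\<close> that is again
  trigonometric. Orthogonality to \<open>trig (lin \<omega> K)\<close> is the form in which this is
  recorded.\<close>

lemma trig_residual:
  assumes K: "finite K" and f: "f \<in> trig (lin \<omega> A)"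
  obtains f0 and n :: nat and c Z w t where "f0 \<in> trig (lin \<omega> K)"
    "(\<lambda>x. f x - f0 x) = (\<lambda>x. \<Sum>k<n. c k * cos_residual (Z k) (w k) (t k) x)"
    "\<forall>h\<in>trig (lin \<omega> K). ip M (\<lambda>x. f x - f0 x) h = 0"
    "\<forall>k<n. Z k \<in> lin \<omega> A \<and> w k \<in> lin \<omega> K \<and> (\<forall>j\<in>K. ip M (\<lambda>x. Z k x - w k x) (\<omega> j) = 0)"
proof -
  obtain n :: nat and c Z t where Z: "\<And>k. k < n \<Longrightarrow> Z k \<in> lin \<omega> A"
    and f_eq: "f = (\<lambda>x. \<Sum>k<n. c k * cos (Z k x + t k))"
    using trig_explicit[OF f] by metis
  have "\<forall>k. \<exists>w. k < n \<longrightarrow> w \<in> lin \<omega> K \<and> (\<forall>j\<in>K. ip M (\<lambda>x. Z k x - w x) (\<omega> j) = 0)"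
    using projection_exists[OF K lin_UNIV[OF Z]] by metis
  then obtain w where w: "\<And>k. k < n \<Longrightarrow> w k \<in> lin \<omega> K"
    and wo: "\<And>k j. k < n \<Longrightarrow> j \<in> K \<Longrightarrow> ip M (\<lambda>x. Z k x - w k x) (\<omega> j) = 0" by metis
  define f0 where "f0 = (\<lambda>x. \<Sum>k<n. (c k * exp (- (ip M (Z k) (Z k) - ip M (w k) (w k)) / 2)) * cos (w k x + t k))"
  have eq: "(\<lambda>x. f x - f0 x) = (\<lambda>x. \<Sum>k<n. c k * cos_residual (Z k) (w k) (t k) x)"
    unfolding f_eq f0_def cos_residual_def by (simp add: right_diff_distrib sum_subtractf mult.assoc)
  have perp: "ip M (cos_residual (Z k) (w k) (t k)) h = 0" if k: "k < n" and "h \<in> trig (lin \<omega> K)" for k h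
    using that(2)
  proof induction
    case (trig_cos u b)
    show ?case
      by (rule ip_cos_residual_cos[OF lin_UNIV[OF Z[OF k]] lin_UNIV[OF w[OF k]] lin_UNIV[OF trig_cos]
          residual_ip[OF Z[OF k] w[OF k] wo[OF k] trig_cos]])
  next
    case (trig_add h h')
    show ?case
      using ip_add_right[OF trig_sqint[OF trig_add.hyps(1)] trig_sqint[OF trig_add.hyps(2)]
        cos_residual_sqint[OF Z[OF k] w[OF k]]] trig_add.IH by simp
  next
    case (trig_scale h b)
    then show ?case by (simp add: ip_scale_right)
  qed
  show thesis
  proof (rule that[OF _ eq])
    show "f0 \<in> trig (lin \<omega> K)" unfolding f0_def
      by (rule trig_sum[OF trig_cos lin_zero]) (use w in simp)
    show "\<forall>k<n. Z k \<in> lin \<omega> A \<and> w k \<in> lin \<omega> K \<and> (\<forall>j\<in>K. ip M (\<lambda>x. Z k x - w k x) (\<omega> j) = 0)"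
      using Z w wo by simp
    show "\<forall>h\<in>trig (lin \<omega> K). ip M (\<lambda>x. f x - f0 x) h = 0"
    proof
      fix h assume h: "h \<in> trig (lin \<omega> K)"
      have "ip M (\<lambda>x. f x - f0 x) h = (\<Sum>k<n. c k * ip M (cos_residual (Z k) (w k) (t k)) h)"
        unfolding eq by (rule ip_sum_left[OF cos_residual_sqint[OF Z w] trig_sqint[OF h]]) simp_all
      also have "\<dots> = 0" by (rule sum.neutral) (use perp[OF _ h] in simp)
      finally show "ip M (\<lambda>x. f x - f0 x) h = 0" .
    qed
  qed
qed

text \<open>Both residuals are indexed over one disjoint sum, so a single application of
  \<open>psd_cos_residual\<close> controls their norms and their inner product together.\<close>

lemma residual_correlation:
  assumes K: "finite K" and bound: "residual_bound \<rho> I J K"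
    and f: "f \<in> trig (lin \<omega> (I \<union> K))" and g: "g \<in> trig (lin \<omega> (J \<union> K))"
  obtains f0 g0 where "f0 \<in> trig (lin \<omega> K)" "g0 \<in> trig (lin \<omega> K)"
    "\<forall>h\<in>trig (lin \<omega> K). ip M (\<lambda>x. f x - f0 x) h = 0" "\<forall>h\<in>trig (lin \<omega> K). ip M (\<lambda>x. g x - g0 x) h = 0"
    "0 \<le> \<rho> * ip M (\<lambda>x. f x - f0 x) (\<lambda>x. f x - f0 x) + \<rho> * ip M (\<lambda>x. g x - g0 x) (\<lambda>x. g x - g0 x) +
      2 * ip M (\<lambda>x. f x - f0 x) (\<lambda>x. g x - g0 x)"
proof -
  obtain f0 c Z w s and n :: nat where f0: "f0 \<in> trig (lin \<omega> K)"
    "(\<lambda>x. f x - f0 x) = (\<lambda>x. \<Sum>k<n. c k * cos_residual (Z k) (w k) (s k) x)"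
    "\<forall>h\<in>trig (lin \<omega> K). ip M (\<lambda>x. f x - f0 x) h = 0"
    and "\<forall>k<n. Z k \<in> lin \<omega> (I \<union> K) \<and> w k \<in> lin \<omega> K \<and> (\<forall>j\<in>K. ip M (\<lambda>x. Z k x - w k x) (\<omega> j) = 0)"
    by (rule trig_residual[OF K f]) (rule that)
  then have Z: "Z k \<in> lin \<omega> (I \<union> K)" and w: "w k \<in> lin \<omega> K"
    and wo: "j \<in> K \<Longrightarrow> ip M (\<lambda>x. Z k x - w k x) (\<omega> j) = 0" if "k < n" for k j using that by simp_all
  obtain g0 d Y v t and m :: nat where g0: "g0 \<in> trig (lin \<omega> K)"
    "(\<lambda>x. g x - g0 x) = (\<lambda>x. \<Sum>k<m. d k * cos_residual (Y k) (v k) (t k) x)"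
    "\<forall>h\<in>trig (lin \<omega> K). ip M (\<lambda>x. g x - g0 x) h = 0"
    and "\<forall>k<m. Y k \<in> lin \<omega> (J \<union> K) \<and> v k \<in> lin \<omega> K \<and> (\<forall>j\<in>K. ip M (\<lambda>x. Y k x - v k x) (\<omega> j) = 0)"
    by (rule trig_residual[OF K g]) (rule that)
  then have Y: "Y k \<in> lin \<omega> (J \<union> K)" and v: "v k \<in> lin \<omega> K"
    and vo: "j \<in> K \<Longrightarrow> ip M (\<lambda>x. Y k x - v k x) (\<omega> j) = 0" if "k < m" for k j using that by simp_all
  have KA: "lin \<omega> K \<subseteq> lin \<omega> (S \<union> K)" for S by (rule lin_mono) simp
  have R: "(\<lambda>x. Z k x - w k x) \<in> lin \<omega> (I \<union> K)" if "k < n" for k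
    using Z[OF that] w[OF that] KA by (intro lin_diff) auto
  have Q: "(\<lambda>x. Y k x - v k x) \<in> lin \<omega> (J \<union> K)" if "k < m" for k
    using Y[OF that] v[OF that] KA by (intro lin_diff) auto
  let ?F = "{..<n} <+> {..<m}"
  let ?\<psi> = "\<lambda>k l. if isl k = isl l then \<rho> else 1"
  let ?r = "case_sum (\<lambda>k x. Z k x - w k x) (\<lambda>k x. Y k x - v k x)"
  let ?h = "case_sum (\<lambda>k. cos_residual (Z k) (w k) (s k)) (\<lambda>k. cos_residual (Y k) (v k) (t k))"
  have "psd ?F (\<lambda>k l. ?\<psi> k l * ip M (cos_residual (case_sum Z Y k) (case_sum w v k) (case_sum s t k))
     (cos_residual (case_sum Z Y l) (case_sum w v l) (case_sum s t l)))"
  proof (rule psd_cos_residual)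
    show "case_sum Z Y k \<in> lin \<omega> UNIV" "case_sum w v k \<in> lin \<omega> UNIV" if "k \<in> ?F" for k
      using that lin_UNIV[OF Z] lin_UNIV[OF w] lin_UNIV[OF Y] lin_UNIV[OF v] by auto
    show "ip M (case_sum Z Y k) (case_sum w v l) = ip M (case_sum w v k) (case_sum w v l)"
      if "k \<in> ?F" "l \<in> ?F" for k l
    proof -
      have u: "case_sum w v l \<in> lin \<omega> K" using that(2) w v by auto
      have "ip M (Z i) (case_sum w v l) = ip M (w i) (case_sum w v l)" if "i < n" for i
        by (rule residual_ip[OF Z[OF that] w[OF that] wo[OF that] u])
      moreover have "ip M (Y i) (case_sum w v l) = ip M (v i) (case_sum w v l)" if "i < m" for i
        by (rule residual_ip[OF Y[OF that] v[OF that] vo[OF that] u])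
      ultimately show ?thesis using that(1) by auto
    qed
    have eq: "(\<lambda>x. case_sum Z Y k x - case_sum w v k x) = ?r k" for k
      by (cases k) auto
    show "psd ?F (\<lambda>k l. ?\<psi> k l * ip M (\<lambda>x. case_sum Z Y k x - case_sum w v k x)
        (\<lambda>x. case_sum Z Y l x - case_sum w v l x))"
      unfolding psd_def eq
    proof
      fix b
      \<comment> \<open>Coefficients on the two blocks select one linear residual on each side, so
        nonnegativity of the block form is an instance of \<open>residual_bound\<close>.\<close>
      let ?X = "\<lambda>x. \<Sum>k<n. b (Inl k) * (Z k x - w k x)" and ?Y = "\<lambda>x. \<Sum>k<m. b (Inr k) * (Y k x - v k x)"
      have "?X \<in> lin \<omega> (I \<union> K)" "?Y \<in> lin \<omega> (J \<union> K)"
        by (rule lin_sum, rule R, simp, rule lin_sum, rule Q, simp)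
      moreover have "ip M ?X (\<omega> j) = 0" if "j \<in> K" for j
      proof -
        have "ip M ?X (\<omega> j) = (\<Sum>k<n. b (Inl k) * ip M (\<lambda>x. Z k x - w k x) (\<omega> j))"
          by (rule ip_sum_left) (use lin_sqint[OF R] omega_sqint in auto)
        then show ?thesis using that wo by simp
      qed
      moreover have "ip M ?Y (\<omega> j) = 0" if "j \<in> K" for j
      proof -
        have "ip M ?Y (\<omega> j) = (\<Sum>k<m. b (Inr k) * ip M (\<lambda>x. Y k x - v k x) (\<omega> j))"
          by (rule ip_sum_left) (use lin_sqint[OF Q] omega_sqint in auto)
        then show ?thesis using that vo by simp
      qed
      ultimately have "0 \<le> \<rho> * ip M ?X ?X + \<rho> * ip M ?Y ?Y + 2 * ip M ?X ?Y"
        using bound unfolding residual_bound_def by blast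
      then show "0 \<le> (\<Sum>k\<in>?F. \<Sum>l\<in>?F. b k * b l * (?\<psi> k l * ip M (?r k) (?r l)))"
        by (subst ip_case_sum) (use lin_sqint[OF R] lin_sqint[OF Q] in auto)
    qed
  qed
  moreover have "cos_residual (case_sum Z Y k) (case_sum w v k) (case_sum s t k) = ?h k" for k
    by (cases k) auto
  ultimately have "0 \<le> (\<Sum>k\<in>?F. \<Sum>l\<in>?F. case_sum c d k * case_sum c d l * (?\<psi> k l * ip M (?h k) (?h l)))"
    by (simp only: psd_def)
  then have "0 \<le> \<rho> * ip M (\<lambda>x. f x - f0 x) (\<lambda>x. f x - f0 x) + \<rho> * ip M (\<lambda>x. g x - g0 x) (\<lambda>x. g x - g0 x) +
      2 * ip M (\<lambda>x. f x - f0 x) (\<lambda>x. g x - g0 x)"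
    by (subst (asm) ip_case_sum)
      (use cos_residual_sqint[OF Z w] cos_residual_sqint[OF Y v] in \<open>auto simp: f0(2) g0(2)\<close>)
  from that[OF f0(1) g0(1) f0(3) g0(3) this] show thesis .
qed

section \<open>Density of trigonometric functions and passage to the limit\<close>

definition generated :: "'i set \<Rightarrow> 'a measure" where
  "generated S = sigma (space M) {\<omega> i -` A \<inter> space M | i A. i \<in> S \<and> A \<in> sets borel}"

lemma trig_algebra: "bounded_algebra M (trig (lin \<omega> S))"
proof
  show "f \<in> borel_measurable M" if "f \<in> trig (lin \<omega> S)" for f
    using trig_sqint[OF that] by (rule sqint_measurable)
  show "\<exists>B. \<forall>x\<in>space M. \<bar>f x\<bar> \<le> B" if "f \<in> trig (lin \<omega> S)" for f
    using trig_bounded[OF that] by blast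
  have "(\<lambda>x. cos (0 + 0)) \<in> trig (lin \<omega> S)" by (rule trig_cos[OF lin_zero])
  then show "(\<lambda>x. 1) \<in> trig (lin \<omega> S)" by simp
qed (fact trig_add trig_scale trig_lin_mult)+

lemma scaled_sin_limit: "(\<lambda>n. real (Suc n) * sin (y / real (Suc n))) \<longlonglongrightarrow> y"
proof (cases "y = 0")
  case False
  have "((\<lambda>h. sin h / h) \<longlongrightarrow> 1) (at (0::real))"
    using DERIV_sin[of 0] by (simp add: DERIV_def)
  moreover have "filterlim (\<lambda>n. y / real (Suc n)) (at 0) sequentially"
    unfolding filterlim_at using False LIMSEQ_Suc[OF lim_const_over_n[of y]] by auto
  ultimately have "(\<lambda>n. sin (y / real (Suc n)) / (y / real (Suc n))) \<longlonglongrightarrow> 1"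
    by (rule filterlim_compose)
  from tendsto_mult_left[OF this, of y]
  have "(\<lambda>n. y * (sin (y / real (Suc n)) / (y / real (Suc n)))) \<longlonglongrightarrow> y" by simp
  moreover have "y * (sin (y / real (Suc n)) / (y / real (Suc n))) = real (Suc n) * sin (y / real (Suc n))" for n
    using False by (simp del: of_nat_Suc)
  ultimately show ?thesis by (simp only:)
qed simp

text \<open>The algebra contains only bounded functions, but \<open>n sin (\<omega> i / n)\<close>
  tends pointwise to \<open>\<omega> i\<close>. Hence the sigma-algebra generated by the algebra
  makes every spin in \<open>S\<close> measurable, and \<open>l2_dense\<close> applies.\<close>

lemma generated_dense:
  assumes f: "f \<in> borel_measurable (generated S)" "f \<in> sqint M"
  shows "f \<in> l2_closure M (trig (lin \<omega> S))"
proof -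
  interpret bounded_algebra M "trig (lin \<omega> S)" by (rule trig_algebra)
  let ?N = "sigma (space M) {{x \<in> space M. c < h x} |h c. h \<in> trig (lin \<omega> S)}"
  have sp: "space ?N = space M" by (rule space_measure_of) auto
  have sets_N: "sets ?N = sigma_sets (space M) {{x \<in> space M. c < h x} |h c. h \<in> trig (lin \<omega> S)}"
    by (rule sets_measure_of) auto
  have trig_N: "h \<in> borel_measurable ?N" if "h \<in> trig (lin \<omega> S)" for h
    unfolding borel_measurable_iff_greater sp sets_N
    by (intro allI sigma_sets.Basic) (use that in blast)
  have om: "\<omega> i \<in> borel_measurable ?N" if "i \<in> S" for i
  proof (rule borel_measurable_LIMSEQ_real)
    fix n
    \<comment> \<open>The phase \<open>- pi / 2\<close> turns the cosine into a sine.\<close>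
    have "(\<lambda>x. real (Suc n) * cos ((1 / real (Suc n)) * \<omega> i x + (- pi / 2))) \<in> trig (lin \<omega> S)"
      by (intro trig_scale trig_cos lin_scale lin_base that)
    from trig_N[OF this]
    show "(\<lambda>x. real (Suc n) * sin (\<omega> i x / real (Suc n))) \<in> borel_measurable ?N"
      by (simp add: cos_diff)
  qed (rule scaled_sin_limit)
  have "sets (generated S) \<subseteq> sets ?N"
    unfolding generated_def
  proof (subst sets_measure_of, blast, rule sets.sigma_sets_subset'[where M = ?N, unfolded sp])
    show "{\<omega> i -` A \<inter> space M |i A. i \<in> S \<and> A \<in> sets borel} \<subseteq> sets ?N"
      using measurable_sets[OF om] unfolding sp by blast
    show "space M \<in> sets ?N" using sets.top[of ?N] unfolding sp .
  qed
  moreover have "space (generated S) = space M" unfolding generated_def by (rule space_measure_of) auto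
  ultimately have "f \<in> borel_measurable ?N"
    using f(1) sp by (auto simp: measurable_def)
  then show ?thesis using f(2) by (rule l2_dense)
qed

text \<open>As \<open>F\<close> is orthogonal to the functions of \<open>K\<close>,
  \<open>f0\<close> is also the projection of \<open>f - F\<close>, so its norm is at most that of
  \<open>f - F\<close>. The error is \<open>(f - F) - f0\<close>, whence the factor 4, whatever
  \<open>K\<close> is.\<close>

lemma residual_close:
  assumes F: "F \<in> sqint M" "\<And>h. h \<in> trig (lin \<omega> K) \<Longrightarrow> ip M F h = 0"
    and f: "f \<in> sqint M" and f0: "f0 \<in> trig (lin \<omega> K)"
    and orth: "\<forall>h\<in>trig (lin \<omega> K). ip M (\<lambda>x. f x - f0 x) h = 0"
  shows "sqnorm M (\<lambda>x. (f x - f0 x) - F x) \<le> 4 * sqnorm M (\<lambda>x. F x - f x)"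
proof -
  note f0s = trig_sqint[OF f0]
  have d: "(\<lambda>x. f x - F x) \<in> sqint M" using f F(1) by (rule sqint_diff)
  let ?a = "ip M f0 f0" and ?b = "ip M (\<lambda>x. f x - F x) (\<lambda>x. f x - F x)"
  have "?a = ip M (\<lambda>x. f x - F x) f0"
    using bspec[OF orth f0] F(2)[OF f0] ip_diff_left[OF f f0s f0s] ip_diff_left[OF f F(1) f0s] by simp
  then have "?a \<le> sqrt ?b * sqrt ?a"
    using Cauchy_Schwarz_ip[OF d f0s] unfolding ip_self[symmetric] by linarith
  then have "sqrt ?a * sqrt ?a \<le> sqrt ?b * sqrt ?a" using ip_self_nonneg[of M f0] by simp
  then have "sqrt ?a \<le> sqrt ?b"
  proof (cases "?a = 0")
    case False
    then have "0 < sqrt ?a" using ip_self_nonneg[of M f0] by simp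
    then show ?thesis by (rule mult_right_le_imp_le[OF \<open>sqrt ?a * sqrt ?a \<le> sqrt ?b * sqrt ?a\<close>])
  qed (simp add: ip_self_nonneg)
  then have ab: "?a \<le> ?b" by simp
  have "sqnorm M (\<lambda>x. (f x - F x) + (-1) * f0 x) \<le> 2 * ?b + 2 * ip M (\<lambda>x. (-1) * f0 x) (\<lambda>x. (-1) * f0 x)"
    unfolding ip_self by (rule sqint_add_bound[OF d sqint_cmult[OF f0s]])
  also have "\<dots> \<le> 4 * ?b" using ab ip_scale_left[of M "-1" f0 "\<lambda>x. (-1) * f0 x"] ip_scale_right[of M f0 "-1" f0] by linarith
  finally show ?thesis by (simp add: ip_self power2_commute algebra_simps)
qed

text \<open>Orthogonality to all functions of \<open>K\<close> includes orthogonality to those of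
  any finite part \<open>K'\<close>, so \<open>residual_close\<close> applies with a constant
  independent of \<open>K'\<close>. The bound \<rho>, uniform in \<open>K'\<close>, then passes to
  the limit.\<close>

lemma conditional_correlation_form:
  assumes bound: "\<And>K'. finite K' \<Longrightarrow> K' \<subseteq> K \<Longrightarrow> residual_bound \<rho> I J K'"
    and F: "F \<in> borel_measurable (generated (I \<union> K))" "F \<in> sqint M"
      "\<And>h. h \<in> trig (lin \<omega> K) \<Longrightarrow> ip M F h = 0"
    and G: "G \<in> borel_measurable (generated (J \<union> K))" "G \<in> sqint M"
      "\<And>h. h \<in> trig (lin \<omega> K) \<Longrightarrow> ip M G h = 0"
  shows "0 \<le> \<rho> * ip M F F + \<rho> * ip M G G + 2 * ip M F G"
proof -
  define P where "P n p q \<longleftrightarrow> p \<in> sqint M \<and> q \<in> sqint M \<and>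
      sqnorm M (\<lambda>x. p x - F x) \<le> 4 * inverse (real (Suc n)) \<and>
      sqnorm M (\<lambda>x. q x - G x) \<le> 4 * inverse (real (Suc n)) \<and>
      0 \<le> \<rho> * ip M p p + \<rho> * ip M q q + 2 * ip M p q" for n p q
  have "\<forall>n. \<exists>p q. P n p q"
  proof
    fix n
    have e: "0 < inverse (real (Suc n))" by simp
    obtain f where f: "f \<in> trig (lin \<omega> (I \<union> K))" "sqnorm M (\<lambda>x. F x - f x) < inverse (real (Suc n))"
      using generated_dense[OF F(1,2)] e unfolding l2_closure_def by blast
    obtain g where g: "g \<in> trig (lin \<omega> (J \<union> K))" "sqnorm M (\<lambda>x. G x - g x) < inverse (real (Suc n))"
      using generated_dense[OF G(1,2)] e unfolding l2_closure_def by blast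
    obtain A where A: "finite A" "A \<subseteq> I \<union> K" "f \<in> trig (lin \<omega> A)"
      using trig_finite_support[OF f(1)] by metis
    obtain B where B: "finite B" "B \<subseteq> J \<union> K" "g \<in> trig (lin \<omega> B)"
      using trig_finite_support[OF g(1)] by metis
    \<comment> \<open>Both supports enter, so that the two residuals are taken given the same
      set.\<close>
    define K' where "K' = (A \<union> B) \<inter> K"
    have K': "finite K'" "K' \<subseteq> K" "A \<subseteq> I \<union> K'" "B \<subseteq> J \<union> K'"
      using A B by (auto simp: K'_def)
    have f': "f \<in> trig (lin \<omega> (I \<union> K'))" by (rule trig_mono[OF lin_mono[OF K'(3)] A(3)])
    have g': "g \<in> trig (lin \<omega> (J \<union> K'))" by (rule trig_mono[OF lin_mono[OF K'(4)] B(3)])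
    have sub: "h \<in> trig (lin \<omega> K)" if "h \<in> trig (lin \<omega> K')" for h
      by (rule trig_mono[OF lin_mono[OF K'(2)] that])
    obtain f0 g0 where r: "f0 \<in> trig (lin \<omega> K')" "g0 \<in> trig (lin \<omega> K')"
      "\<forall>h\<in>trig (lin \<omega> K'). ip M (\<lambda>x. f x - f0 x) h = 0" "\<forall>h\<in>trig (lin \<omega> K'). ip M (\<lambda>x. g x - g0 x) h = 0"
      "0 \<le> \<rho> * ip M (\<lambda>x. f x - f0 x) (\<lambda>x. f x - f0 x) + \<rho> * ip M (\<lambda>x. g x - g0 x) (\<lambda>x. g x - g0 x) +
        2 * ip M (\<lambda>x. f x - f0 x) (\<lambda>x. g x - g0 x)"
      by (rule residual_correlation[OF K'(1) bound[OF K'(1,2)] f' g']) (rule that)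
    have "sqnorm M (\<lambda>x. (f x - f0 x) - F x) \<le> 4 * sqnorm M (\<lambda>x. F x - f x)"
      by (rule residual_close[OF F(2) F(3)[OF sub] trig_sqint[OF f(1)] r(1,3)])
    moreover have "sqnorm M (\<lambda>x. (g x - g0 x) - G x) \<le> 4 * sqnorm M (\<lambda>x. G x - g x)"
      by (rule residual_close[OF G(2) G(3)[OF sub] trig_sqint[OF g(1)] r(2,4)])
    moreover have "(\<lambda>x. f x - f0 x) \<in> sqint M" "(\<lambda>x. g x - g0 x) \<in> sqint M"
      by (intro sqint_diff trig_sqint[OF f(1)] trig_sqint[OF g(1)] trig_sqint[OF r(1)] trig_sqint[OF r(2)])+
    ultimately have "P n (\<lambda>x. f x - f0 x) (\<lambda>x. g x - g0 x)" unfolding P_def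
      using f(2) g(2) r(5) by (intro conjI) linarith+
    then show "\<exists>p q. P n p q" by (intro exI)
  qed
  from choice[OF this] obtain p where "\<forall>n. \<exists>q. P n (p n) q" by (rule exE)
  from choice[OF this] obtain q where "\<forall>n. P n (p n) (q n)" by (rule exE)
  then have p: "p n \<in> sqint M" and q: "q n \<in> sqint M"
    and pF: "sqnorm M (\<lambda>x. p n x - F x) \<le> 4 * inverse (real (Suc n))"
    and qG: "sqnorm M (\<lambda>x. q n x - G x) \<le> 4 * inverse (real (Suc n))"
    and pq: "0 \<le> \<rho> * ip M (p n) (p n) + \<rho> * ip M (q n) (q n) + 2 * ip M (p n) (q n)" for n
    unfolding P_def by blast+
  have z: "(\<lambda>n. 4 * inverse (real (Suc n))) \<longlonglongrightarrow> 0"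
    using tendsto_mult_left[OF LIMSEQ_inverse_real_of_nat, of 4] by simp
  have lim: "(\<lambda>n. sqnorm M (\<lambda>x. p n x - F x)) \<longlonglongrightarrow> 0" "(\<lambda>n. sqnorm M (\<lambda>x. q n x - G x)) \<longlonglongrightarrow> 0"
    by (rule tendsto_sandwich[OF always_eventually always_eventually tendsto_const z]; use pF qG in simp)+
  have "(\<lambda>n. \<rho> * ip M (p n) (p n) + \<rho> * ip M (q n) (q n) + 2 * ip M (p n) (q n)) \<longlonglongrightarrow>
     \<rho> * ip M F F + \<rho> * ip M G G + 2 * ip M F G"
    by (intro tendsto_add tendsto_mult_left ip_tendsto p q F(2) G(2) lim)
  then show ?thesis by (rule LIMSEQ_le_const) (use pq in blast)
qed

text \<open>The form version holds for all multiples of \<open>F\<close> and \<open>G\<close>; the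
  discriminant criterion then separates the two norms.\<close>

theorem conditional_correlation:
  assumes bound: "\<And>K'. finite K' \<Longrightarrow> K' \<subseteq> K \<Longrightarrow> residual_bound \<rho> I J K'"
    and F: "F \<in> borel_measurable (generated (I \<union> K))" "F \<in> sqint M"
      "\<And>h. h \<in> trig (lin \<omega> K) \<Longrightarrow> ip M F h = 0"
    and G: "G \<in> borel_measurable (generated (J \<union> K))" "G \<in> sqint M"
      "\<And>h. h \<in> trig (lin \<omega> K) \<Longrightarrow> ip M G h = 0"
    and \<rho>: "0 \<le> \<rho>"
  shows "\<bar>ip M F G\<bar> \<le> \<rho> * sqrt (ip M F F) * sqrt (ip M G G)"
proof -
  have "\<bar>ip M F G\<bar> \<le> sqrt (\<rho> * ip M F F) * sqrt (\<rho> * ip M G G)"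
  proof (rule nonneg_quadratic_form)
    fix s t :: real
    have "0 \<le> \<rho> * ip M (\<lambda>x. s * F x) (\<lambda>x. s * F x) + \<rho> * ip M (\<lambda>x. t * G x) (\<lambda>x. t * G x) +
       2 * ip M (\<lambda>x. s * F x) (\<lambda>x. t * G x)"
    proof (rule conditional_correlation_form[of K \<rho> I J, OF bound])
      show "(\<lambda>x. s * F x) \<in> borel_measurable (generated (I \<union> K))" using F(1) by simp
      show "(\<lambda>x. t * G x) \<in> borel_measurable (generated (J \<union> K))" using G(1) by simp
    qed (simp_all add: F(2,3) G(2,3) sqint_cmult ip_scale_left)
    then show "0 \<le> s\<^sup>2 * (\<rho> * ip M F F) + t\<^sup>2 * (\<rho> * ip M G G) + 2 * (s * t * ip M F G)"
      by (simp add: ip_scale_left ip_scale_right power2_eq_square ac_simps)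
  qed
  also have "\<dots> = (sqrt \<rho> * sqrt \<rho>) * sqrt (ip M F F) * sqrt (ip M G G)"
    unfolding real_sqrt_mult by (simp only: ac_simps)
  finally show ?thesis using \<rho> by simp
qed

end

section \<open>The Green function\<close>

lemma summable_on_dominated:
  fixes f h :: "'b \<Rightarrow> real"
  assumes "f summable_on A" "\<And>x. x \<in> A \<Longrightarrow> \<bar>h x\<bar> \<le> f x"
  shows "h summable_on A"
proof -
  have "(\<lambda>x. \<bar>h x\<bar>) summable_on A"
    by (rule summable_on_comparison_test[OF assms(1)]) (use assms(2) in auto)
  then show ?thesis using abs_summable_summable[of h A] by simp
qed

lemma has_sum_diff_real:
  fixes f h :: "'b \<Rightarrow> real"
  assumes "(f has_sum s) A" "(h has_sum t) A"
  shows "((\<lambda>x. f x - h x) has_sum (s - t)) A"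
  using has_sum_add[OF assms(1), of "\<lambda>x. - h x" "- t"] assms(2) by (simp add: has_sum_uminus)

lemma has_sum_abs_bound:
  fixes f h :: "'b \<Rightarrow> real"
  assumes f: "(f has_sum s) A" and h: "(h has_sum t) A" and le: "\<And>x. \<bar>h x\<bar> \<le> f x"
  shows "\<bar>t\<bar> \<le> s"
proof -
  have "h x \<le> f x" "- h x \<le> f x" for x using le[of x] by auto
  then have "t \<le> s" "- t \<le> s"
    using has_sum_mono[OF h f] has_sum_mono[of "\<lambda>x. - h x" A "- t" f s] f h by (simp_all add: has_sum_uminus)
  then show ?thesis by simp
qed

text \<open>In the model, the symmetry of \<open>b\<close> is read off from the symmetry of the
  covariance.\<close>

locale green_function =
  fixes \<gamma> b :: "int ^ 'n \<Rightarrow> real"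
  assumes interaction: "interaction \<gamma>"
    and inverse: "conv_inverse (precision \<gamma>) b"
    and symmetric: "b (- z) = b z"
begin

definition g :: "int ^ 'n \<Rightarrow> real" where "g y = (if y = 0 then 0 else \<gamma> y)"

definition \<Gamma> :: real where "\<Gamma> = total_interaction \<gamma>"

definition a :: real where "a = 1 + \<Gamma>"

definition conv :: "(int ^ 'n \<Rightarrow> real) \<Rightarrow> int ^ 'n \<Rightarrow> real" where
  "conv x z = (\<Sum>\<^sub>\<infinity>y. g y * x (z - y))"

text \<open>Convolution with \<open>precision \<gamma>\<close>, used on bounded functions so that
  constants can serve for comparison: \<open>a - \<Gamma> = 1\<close> makes \<open>L\<close> map
  each constant to itself.\<close>

definition L :: "(int ^ 'n \<Rightarrow> real) \<Rightarrow> int ^ 'n \<Rightarrow> real" where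
  "L x z = a * x z - conv x z"

definition bdd :: "(int ^ 'n \<Rightarrow> real) \<Rightarrow> bool" where
  "bdd x \<longleftrightarrow> (\<exists>B. \<forall>z. \<bar>x z\<bar> \<le> B)"

lemma g_nonneg: "0 \<le> g y"
  using interaction by (auto simp: g_def interaction_def)

lemma g_minus: "g (- y) = g y"
  using interaction by (auto simp: g_def interaction_def)

lemma g_has_sum: "(g has_sum \<Gamma>) UNIV"
proof -
  have "(\<gamma> has_sum \<Gamma>) (- {0})"
    using interaction by (simp add: interaction_def \<Gamma>_def total_interaction_def)
  moreover have "(\<gamma> has_sum \<Gamma>) (- {0}) \<longleftrightarrow> (g has_sum \<Gamma>) UNIV"
    by (rule has_sum_cong_neutral) (auto simp: g_def)
  ultimately show ?thesis by simp
qed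

lemma \<Gamma>_nonneg: "0 \<le> \<Gamma>"
  using has_sum_nonneg[OF g_has_sum] g_nonneg by blast

lemma a_pos: "0 < a" and a_ge_1: "1 \<le> a" and \<Gamma>_less_a: "\<Gamma> < a"
  using \<Gamma>_nonneg by (auto simp: a_def)

lemma g_le: "g y \<le> \<Gamma>"
  using finite_sum_le_has_sum[OF g_has_sum, of "{y}"] g_nonneg by simp

lemma summable_bdd:
  assumes "bdd x"
  shows "(\<lambda>y. g y * x (z - y)) summable_on UNIV"
proof -
  obtain B where B: "\<And>z. \<bar>x z\<bar> \<le> B" using assms by (auto simp: bdd_def)
  show ?thesis
  proof (rule summable_on_dominated)
    show "(\<lambda>y. g y * B) summable_on UNIV"
      using g_has_sum by (intro summable_on_cmult_left) (rule has_sum_imp_summable)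
    show "\<bar>g y * x (z - y)\<bar> \<le> g y * B" for y
      using B[of "z - y"] g_nonneg[of y] by (simp add: abs_mult mult_left_mono)
  qed
qed

lemma conv_has_sum: "bdd x \<Longrightarrow> ((\<lambda>y. g y * x (z - y)) has_sum conv x z) UNIV"
  unfolding conv_def by (intro has_sum_infsum summable_bdd)

lemma bdd_add: "bdd x \<Longrightarrow> bdd y \<Longrightarrow> bdd (\<lambda>z. x z + y z)"
  unfolding bdd_def by (metis abs_triangle_ineq add_mono order_trans)

lemma bdd_cmult:
  assumes "bdd x"
  shows "bdd (\<lambda>z. c * x z)"
proof -
  obtain B where "\<And>z. \<bar>x z\<bar> \<le> B" using assms by (auto simp: bdd_def)
  then have "\<bar>c * x z\<bar> \<le> \<bar>c\<bar> * B" for z by (simp add: abs_mult mult_left_mono)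
  then show ?thesis unfolding bdd_def by blast
qed

lemma bdd_const: "bdd (\<lambda>z. c)"
  unfolding bdd_def by auto

lemma bdd_diff: "bdd x \<Longrightarrow> bdd y \<Longrightarrow> bdd (\<lambda>z. x z - y z)"
  using bdd_add[of x "\<lambda>z. -1 * y z"] bdd_cmult[of y "-1"] by simp

lemma bdd_shift: "bdd x \<Longrightarrow> bdd (\<lambda>z. x (z - i))"
  unfolding bdd_def by auto

lemma bdd_sum:
  assumes "\<And>k. k \<in> F \<Longrightarrow> bdd (x k)"
  shows "bdd (\<lambda>z. \<Sum>k\<in>F. c k * x k z)"
  using assms
proof (induction F rule: infinite_finite_induct)
  case (insert k F)
  then show ?case using bdd_add[OF bdd_cmult, of "x k" "\<lambda>z. \<Sum>k\<in>F. c k * x k z" "c k"] by simp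
qed (simp_all add: bdd_const)

lemma conv_add:
  assumes "bdd x" "bdd y"
  shows "conv (\<lambda>z. x z + y z) z = conv x z + conv y z"
  using infsumI[OF has_sum_add[OF conv_has_sum[OF assms(1)] conv_has_sum[OF assms(2)]]]
  by (simp add: conv_def[of "\<lambda>z. x z + y z"] distrib_left)

lemma conv_cmult: "conv (\<lambda>z. c * x z) z = c * conv x z"
  unfolding conv_def by (subst infsum_cmult_right'[symmetric]) (simp add: ac_simps)

lemma conv_const: "conv (\<lambda>z. c) z = \<Gamma> * c"
  using infsumI[OF has_sum_cmult_left[OF g_has_sum, of c]] by (simp add: conv_def)

lemma conv_mono:
  assumes "bdd x" "bdd y" "\<And>z. x z \<le> y z"
  shows "conv x z \<le> conv y z"
  by (rule has_sum_mono[OF conv_has_sum[OF assms(1)] conv_has_sum[OF assms(2)]])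
    (use assms(3) g_nonneg in \<open>simp add: mult_left_mono\<close>)

lemma L_add: "bdd x \<Longrightarrow> bdd y \<Longrightarrow> L (\<lambda>z. x z + y z) z = L x z + L y z"
  by (simp add: L_def conv_add algebra_simps)

lemma L_cmult: "L (\<lambda>z. c * x z) z = c * L x z"
  by (simp add: L_def conv_cmult algebra_simps)

lemma L_diff: "bdd x \<Longrightarrow> bdd y \<Longrightarrow> L (\<lambda>z. x z - y z) z = L x z - L y z"
  using L_add[of x "\<lambda>z. -1 * y z"] bdd_cmult[of y "-1"] L_cmult[of "-1" y] by simp

lemma L_const: "L (\<lambda>z. c) z = c"
  by (simp add: L_def conv_const a_def algebra_simps)

lemma L_shift: "L (\<lambda>z. x (z - i)) z = L x (z - i)"
  by (simp add: L_def conv_def diff_diff_eq add.commute)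

lemma L_sum:
  assumes "\<And>k. k \<in> F \<Longrightarrow> bdd (x k)"
  shows "L (\<lambda>z. \<Sum>k\<in>F. c k * x k z) z = (\<Sum>k\<in>F. c k * L (x k) z)"
  using assms
proof (induction F rule: infinite_finite_induct)
  case (insert k F)
  have "L (\<lambda>z. c k * x k z + (\<Sum>k\<in>F. c k * x k z)) z = c k * L (x k) z + (\<Sum>k\<in>F. c k * L (x k) z)"
    using insert by (subst L_add) (auto intro!: bdd_cmult bdd_sum simp: L_cmult)
  then show ?case using insert.hyps by simp
qed (simp_all add: L_const)

lemma b_summable: "(\<lambda>z. \<bar>b z\<bar>) summable_on UNIV"
  using inverse by (simp add: conv_inverse_def)

lemma bdd_abs_summable:
  assumes "(\<lambda>z. \<bar>x z\<bar>) summable_on UNIV"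
  shows "bdd x"
  using finite_sum_le_infsum[OF assms, of "{_}"] unfolding bdd_def by auto

lemma bdd_b: "bdd b"
  by (rule bdd_abs_summable[OF b_summable])

lemma L_b: "L b z = (if z = 0 then 1 else 0)"
proof -
  have "((\<lambda>y. (if y = 0 then a else 0) * b (z - y)) has_sum a * b z) UNIV"
    by (rule has_sum_finite_neutralI[of "{0}"]) auto
  from has_sum_diff_real[OF this conv_has_sum[OF bdd_b]]
  have "((\<lambda>y. (if y = 0 then a else 0) * b (z - y) - g y * b (z - y)) has_sum L b z) UNIV"
    by (simp add: L_def)
  moreover have "(if y = 0 then a else 0) * b (z - y) - g y * b (z - y) = precision \<gamma> y * b (z - y)" for y
    by (simp add: precision_def g_def a_def \<Gamma>_def)
  ultimately have "((\<lambda>y. precision \<gamma> y * b (z - y)) has_sum L b z) UNIV" by simp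
  then have "(\<Sum>\<^sub>\<infinity>y. precision \<gamma> y * b (z - y)) = L b z" by (rule infsumI)
  moreover have "(\<Sum>\<^sub>\<infinity>y. precision \<gamma> y * b (z - y)) = (if z = 0 then 1 else 0)"
    using inverse unfolding conv_inverse_def by blast
  ultimately show ?thesis by simp
qed

lemma L_b_sum:
  assumes "finite F"
  shows "L (\<lambda>z. \<Sum>k\<in>F. c k * b (z - k)) z = (if z \<in> F then c z else 0)"
proof -
  have "L (\<lambda>z. \<Sum>k\<in>F. c k * b (z - k)) z = (\<Sum>k\<in>F. c k * (if z = k then 1 else 0))"
    by (subst L_sum) (simp_all add: bdd_shift bdd_b L_shift L_b)
  then show ?thesis using assms by (simp add: if_distrib sum.delta cong: if_cong)
qed

text \<open>The infimum \<open>m\<close> need not be attained. If it were negative,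
  \<open>a c >= conv c >= \<Gamma> m\<close> off \<open>K\<close> and \<open>c >= 0\<close> on
  \<open>K\<close> would give \<open>c >= (\<Gamma> / a) m\<close> everywhere, hence
  \<open>m >= (\<Gamma> / a) m > m\<close>.\<close>

lemma maximum_principle:
  assumes c: "bdd c" and out: "\<And>z. z \<notin> K \<Longrightarrow> 0 \<le> L c z" and on: "\<And>z. z \<in> K \<Longrightarrow> 0 \<le> c z"
  shows "0 \<le> c z"
proof -
  obtain B where B: "\<And>z. \<bar>c z\<bar> \<le> B" using c by (auto simp: bdd_def)
  have "- B \<le> c z" for z using B[of z] by linarith
  then have bb: "bdd_below (range c)" by (intro bdd_belowI2)
  let ?m = "Inf (range c)"
  have m: "?m \<le> c z" for z by (rule cInf_lower[OF _ bb]) simp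
  have "0 \<le> ?m"
  proof (rule ccontr)
    assume "\<not> 0 \<le> ?m"
    then have neg: "?m < 0" by simp
    have "\<Gamma> / a * ?m \<le> c z" for z
    proof (cases "z \<in> K")
      case True
      have "\<Gamma> / a * ?m \<le> 0" using neg \<Gamma>_nonneg a_pos by (intro mult_nonneg_nonpos) auto
      then show ?thesis using on[OF True] by simp
    next
      case False
      have "\<Gamma> * ?m = conv (\<lambda>z. ?m) z" by (simp add: conv_const)
      also have "\<dots> \<le> conv c z" by (intro conv_mono bdd_const c m)
      also have "\<dots> \<le> a * c z" using out[OF False] by (simp add: L_def)
      finally show ?thesis using a_pos by (simp add: field_simps)
    qed
    then have "\<Gamma> / a * ?m \<le> ?m" by (intro cInf_greatest) auto
    moreover have "?m < \<Gamma> / a * ?m" using neg \<Gamma>_less_a a_pos by (simp add: field_simps)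
    ultimately show False by simp
  qed
  with m[of z] show ?thesis by simp
qed

lemma b_nonneg: "0 \<le> b z"
  by (rule maximum_principle[of b "{}"]) (simp_all add: bdd_b L_b)

lemma b_has_sum: "(b has_sum infsum b UNIV) UNIV"
  using b_summable b_nonneg by (simp add: has_sum_infsum)

text \<open>Here \<open>c\<close> is the covariance with the field of a residual at \<open>i\<close>
  whose own coefficient is 1: \<open>L c\<close> is the unit mass at \<open>i\<close> off
  \<open>K\<close>, and \<open>c\<close> vanishes on \<open>K\<close>. All bounds are comparisons,
  with 0, with the Green function at \<open>i\<close> and with a constant.\<close>

lemma partial_covariance:
  fixes K :: "(int ^ 'n) set"
  assumes K: "finite K" "i \<notin> K"
    and c_def: "c = (\<lambda>z. b (z - i) + (\<Sum>k\<in>K. w k * b (z - k)))"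
    and zero: "\<And>k. k \<in> K \<Longrightarrow> c k = 0"
  shows "0 \<le> c z" "c z \<le> b (z - i)" "1 / a \<le> c i" "z \<noteq> i \<Longrightarrow> c z \<le> \<Gamma> / a * c i"
proof -
  have bd: "bdd (\<lambda>z. b (z - i))" "bdd c"
    unfolding c_def by (intro bdd_add bdd_shift bdd_b bdd_sum)+
  have Lb: "L (\<lambda>z. b (z - i)) z = (if z = i then 1 else 0)" for z
    by (simp add: L_shift L_b)
  have Lc: "L c z = (if z = i then 1 else 0)" if "z \<notin> K" for z
    unfolding c_def using that L_b_sum[OF K(1)]
    by (subst L_add) (auto intro!: bdd_shift bdd_b bdd_sum simp: Lb)
  show nonneg: "0 \<le> c z" for z
    by (rule maximum_principle[OF bd(2), of K]) (simp_all add: Lc zero)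
  have "0 \<le> b (z - i) - c z"
    by (rule maximum_principle[of "\<lambda>z. b (z - i) - c z" K])
      (simp_all add: bdd_diff bd L_diff Lb Lc zero b_nonneg)
  then show "c z \<le> b (z - i)" by simp
  have "0 \<le> conv c i"
    using conv_mono[OF bdd_const bd(2) nonneg, of i] by (simp add: conv_const)
  then have "1 \<le> a * c i" using Lc[of i] K by (simp add: L_def)
  then show "1 / a \<le> c i" using a_pos by (simp add: field_simps)
  \<comment> \<open>\<open>L\<close> maps the constant \<open>c i\<close> to itself, and
    \<open>c i\<close> is nonnegative, so this constant dominates \<open>c\<close> off
    \<open>i\<close> and \<open>K\<close>.\<close>
  have "0 \<le> c i - c z" for z
  proof (rule maximum_principle[of "\<lambda>z. c i - c z" "insert i K"])
    show "bdd (\<lambda>z. c i - c z)" by (intro bdd_diff bdd_const bd)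
    show "0 \<le> L (\<lambda>z. c i - c z) z" if "z \<notin> insert i K" for z
      using that nonneg[of i] by (simp add: L_diff bdd_const bd L_const Lc)
  qed (auto simp: zero nonneg)
  then have le: "c z \<le> c i" for z by simp
  show "c z \<le> \<Gamma> / a * c i" if "z \<noteq> i"
  proof (cases "z \<in> K")
    case True
    then show ?thesis using zero nonneg[of i] \<Gamma>_nonneg a_pos by simp
  next
    case False
    \<comment> \<open>Inserting \<open>c <= c i\<close> once more into the equation at
      \<open>z\<close> gains the factor \<open>\<Gamma> / a\<close>.\<close>
    have "a * c z = conv c z" using Lc[OF False] that by (simp add: L_def)
    also have "\<dots> \<le> conv (\<lambda>z. c i) z" by (rule conv_mono[OF bd(2) bdd_const le])
    finally show ?thesis using a_pos by (simp add: conv_const field_simps)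
  qed
qed

text \<open>Keeps a single term of the nonnegative sum \<open>conv b z\<close>. Iterating it bounds
  \<open>b\<close> from below along an axis.\<close>

lemma b_step: "g e * b (z - e) \<le> a * b z"
proof -
  have "g e * b (z - e) \<le> conv b z"
    using finite_sum_le_has_sum[OF conv_has_sum[OF bdd_b], of "{e}" z] g_nonneg b_nonneg by simp
  also have "\<dots> \<le> a * b z" using L_b[of z] by (simp add: L_def split: if_splits)
  finally show ?thesis .
qed

lemma b_zero_pos: "0 < b 0"
proof -
  have "0 \<le> conv b 0"
    using conv_mono[OF bdd_const bdd_b b_nonneg, of 0] by (simp add: conv_const)
  then have "1 \<le> a * b 0" using L_b[of 0] by (simp add: L_def)
  then show ?thesis using b_nonneg[of 0] by (cases "b 0 = 0") auto
qed

subsection \<open>The energy form\<close>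

abbreviation l1 :: "(int ^ 'n \<Rightarrow> real) \<Rightarrow> bool" where
  "l1 x \<equiv> (\<lambda>z. \<bar>x z\<bar>) summable_on UNIV"

lemma has_sum_shift:
  fixes f :: "int ^ 'n \<Rightarrow> real"
  shows "(f has_sum s) UNIV \<Longrightarrow> ((\<lambda>z. f (z - y)) has_sum s) UNIV"
proof -
  have "bij_betw (\<lambda>z. z - y) UNIV (UNIV :: (int ^ 'n) set)"
    by (rule bij_betwI[where g = "\<lambda>z. z + y"]) auto
  from has_sum_reindex_bij_betw[OF this, of f s]
  show "(f has_sum s) UNIV \<Longrightarrow> ((\<lambda>z. f (z - y)) has_sum s) UNIV" by blast
qed

lemma l1_bdd_mult:
  assumes "l1 x" "bdd u"
  shows "l1 (\<lambda>z. u z * x z)"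
proof -
  obtain B where B: "\<And>z. \<bar>u z\<bar> \<le> B" using assms(2) by (auto simp: bdd_def)
  have "(\<lambda>z. B * \<bar>x z\<bar>) summable_on UNIV" by (rule summable_on_cmult_right[OF assms(1)])
  then show ?thesis
    by (rule summable_on_comparison_test) (use B in \<open>auto simp: abs_mult mult_right_mono\<close>)
qed

lemma l1_summable: "l1 x \<Longrightarrow> x summable_on UNIV"
  using abs_summable_summable[of x UNIV] by simp

lemma l1_mult_summable: "bdd u \<Longrightarrow> l1 x \<Longrightarrow> (\<lambda>z. u z * x z) summable_on UNIV"
  by (rule l1_summable[OF l1_bdd_mult])

lemma l1_add: "l1 x \<Longrightarrow> l1 y \<Longrightarrow> l1 (\<lambda>z. x z + y z)"
  by (rule summable_on_comparison_test[of "\<lambda>z. \<bar>x z\<bar> + \<bar>y z\<bar>"])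
    (auto simp: abs_triangle_ineq intro: summable_on_add)

lemma l1_cmult: "l1 x \<Longrightarrow> l1 (\<lambda>z. c * x z)"
  by (rule l1_bdd_mult[OF _ bdd_const])

lemma l1_shift: "l1 x \<Longrightarrow> l1 (\<lambda>z. x (z - i))"
  using has_sum_shift[of "\<lambda>z. \<bar>x z\<bar>" _ i] by (meson has_sum_imp_summable has_sum_infsum)

lemma l1_sum:
  assumes "\<And>k. k \<in> F \<Longrightarrow> l1 (x k)"
  shows "l1 (\<lambda>z. \<Sum>k\<in>F. c k * x k z)"
  using assms
proof (induction F rule: infinite_finite_induct)
  case (insert k F)
  then show ?case using l1_add[OF l1_cmult, of "x k" "\<lambda>z. \<Sum>k\<in>F. c k * x k z" "c k"] by simp
qed simp_all

lemma bdd_conv: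
  assumes "bdd x"
  shows "bdd (conv x)"
proof -
  obtain B where B: "\<And>z. \<bar>x z\<bar> \<le> B" using assms by (auto simp: bdd_def)
  have "conv x z \<le> \<Gamma> * B" "\<Gamma> * (- B) \<le> conv x z" for z
    unfolding conv_const[symmetric, of _ z]
    using B by (auto intro!: conv_mono assms bdd_const simp: abs_le_iff minus_le_iff)
  then have "\<bar>conv x z\<bar> \<le> \<Gamma> * B" for z by (simp add: abs_le_iff minus_le_iff)
  then show ?thesis unfolding bdd_def by blast
qed

lemma bdd_L: "bdd x \<Longrightarrow> bdd (L x)"
  unfolding L_def[abs_def] by (intro bdd_diff bdd_cmult bdd_conv)

abbreviation pair :: "(int ^ 'n \<Rightarrow> real) \<Rightarrow> (int ^ 'n \<Rightarrow> real) \<Rightarrow> real" where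
  "pair x y \<equiv> \<Sum>\<^sub>\<infinity>z. x z * y z"

definition energy :: "(int ^ 'n \<Rightarrow> real) \<Rightarrow> (int ^ 'n \<Rightarrow> real) \<Rightarrow> real" where
  "energy x y = pair (L x) y"

lemma energy_summable: "bdd x \<Longrightarrow> l1 y \<Longrightarrow> (\<lambda>z. L x z * y z) summable_on UNIV"
  by (rule l1_mult_summable[OF bdd_L])

lemma double_summable:
  assumes x: "bdd x" and y: "l1 y"
  shows "(\<lambda>(z, u). g u * x (z - u) * y z) summable_on UNIV \<times> UNIV"
proof -
  obtain B where B: "\<And>z. \<bar>x z\<bar> \<le> B" using x by (auto simp: bdd_def)
  have "(\<lambda>(z, u). \<bar>y z\<bar> * (B * g u)) summable_on UNIV \<times> UNIV"
  proof (rule summable_on_SigmaI)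
    show "((\<lambda>u. case (z, u) of (z, u) \<Rightarrow> \<bar>y z\<bar> * (B * g u)) has_sum \<bar>y z\<bar> * (B * \<Gamma>)) UNIV" for z
      unfolding prod.case by (intro has_sum_cmult_right g_has_sum)
    show "(\<lambda>z. \<bar>y z\<bar> * (B * \<Gamma>)) summable_on UNIV" by (rule summable_on_cmult_left[OF y])
    have "0 \<le> B" using B[of 0] by linarith
    then show "0 \<le> (case (z, u) of (z, u) \<Rightarrow> \<bar>y z\<bar> * (B * g u))" for z u using g_nonneg by simp
  qed
  then show ?thesis
  proof (rule summable_on_dominated, safe)
    fix z u
    have "\<bar>g u * x (z - u) * y z\<bar> = \<bar>y z\<bar> * (\<bar>x (z - u)\<bar> * g u)"
      using g_nonneg by (simp add: abs_mult)
    also have "\<dots> \<le> \<bar>y z\<bar> * (B * g u)"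
      by (intro mult_left_mono mult_right_mono B g_nonneg) simp
    finally show "\<bar>g u * x (z - u) * y z\<bar> \<le> \<bar>y z\<bar> * (B * g u)" .
  qed
qed

lemma conv_pairing:
  assumes x: "bdd x" and y: "l1 y"
  shows "pair (conv x) y = (\<Sum>\<^sub>\<infinity>u. g u * pair (\<lambda>z. x (z - u)) y)"
proof -
  have "pair (conv x) y = (\<Sum>\<^sub>\<infinity>z. \<Sum>\<^sub>\<infinity>u. g u * x (z - u) * y z)"
    unfolding conv_def by (intro infsum_cong infsum_cmult_left'[symmetric])
  also have "\<dots> = (\<Sum>\<^sub>\<infinity>u. \<Sum>\<^sub>\<infinity>z. g u * x (z - u) * y z)"
    by (rule infsum_swap_banach[OF double_summable[OF x y]])
  also have "\<dots> = (\<Sum>\<^sub>\<infinity>u. g u * pair (\<lambda>z. x (z - u)) y)"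
    unfolding mult.assoc by (intro infsum_cong infsum_cmult_right')
  finally show ?thesis .
qed

text \<open>Interchange the sums, reflect the jump using that \<open>g\<close> is even, and
  translate the inner sum.\<close>

lemma conv_symmetric:
  assumes x: "l1 x" and y: "l1 y"
  shows "pair (conv x) y = pair (conv y) x"
proof -
  have bij: "bij_betw uminus UNIV (UNIV :: (int ^ 'n) set)"
    by (rule bij_betwI[where g = uminus]) auto
  have bij2: "bij_betw (\<lambda>z. z - u) UNIV (UNIV :: (int ^ 'n) set)" for u
    by (rule bij_betwI[where g = "\<lambda>z. z + u"]) auto
  have "pair (conv x) y = (\<Sum>\<^sub>\<infinity>u. g u * pair (\<lambda>z. x (z - u)) y)"
    by (rule conv_pairing[OF bdd_abs_summable[OF x] y])
  also have "\<dots> = (\<Sum>\<^sub>\<infinity>u. g (- u) * (\<Sum>\<^sub>\<infinity>z. x (z - (- u)) * y z))"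
    by (rule infsum_reindex_bij_betw[OF bij, symmetric])
  also have "\<dots> = (\<Sum>\<^sub>\<infinity>u. g u * pair (\<lambda>z. y (z - u)) x)"
  proof (rule infsum_cong)
    fix u
    have "(\<Sum>\<^sub>\<infinity>z. x (z - (- u)) * y z) = (\<Sum>\<^sub>\<infinity>z. x ((z - u) - (- u)) * y (z - u))"
      by (rule infsum_reindex_bij_betw[OF bij2, symmetric])
    then show "g (- u) * (\<Sum>\<^sub>\<infinity>z. x (z - (- u)) * y z) = g u * pair (\<lambda>z. y (z - u)) x"
      by (simp add: g_minus mult.commute)
  qed
  also have "\<dots> = pair (conv y) x"
    by (rule conv_pairing[OF bdd_abs_summable[OF y] x, symmetric])
  finally show ?thesis .
qed

lemma energy_alt:
  assumes x: "bdd x" and y: "l1 y"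
  shows "energy x y = a * pair x y - pair (conv x) y"
proof -
  have s: "(\<lambda>z. x z * y z) summable_on UNIV" "(\<lambda>z. conv x z * y z) summable_on UNIV"
    by (intro l1_mult_summable bdd_conv x y)+
  have "((\<lambda>z. a * (x z * y z) - conv x z * y z) has_sum
      (a * pair x y - pair (conv x) y)) UNIV"
    by (intro has_sum_diff_real has_sum_cmult_right has_sum_infsum s)
  from infsumI[OF this] show ?thesis by (simp add: energy_def L_def algebra_simps)
qed

lemma energy_sym: "l1 x \<Longrightarrow> l1 y \<Longrightarrow> energy x y = energy y x"
  by (simp only: energy_alt bdd_abs_summable conv_symmetric[of x y] mult.commute[of "x _" "y _"])

lemma energy_add_right:
  "bdd x \<Longrightarrow> l1 y \<Longrightarrow> l1 w \<Longrightarrow> energy x (\<lambda>z. y z + c * w z) = energy x y + c * energy x w"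
proof -
  assume *: "bdd x" "l1 y" "l1 w"
  have "((\<lambda>z. L x z * y z + c * (L x z * w z)) has_sum (energy x y + c * energy x w)) UNIV"
    unfolding energy_def using * by (intro has_sum_add has_sum_cmult_right has_sum_infsum energy_summable)
  from infsumI[OF this] show ?thesis by (simp add: energy_def algebra_simps)
qed

text \<open>Young's inequality for an l1 kernel acting on l2: each shifted product sum is at most
  the square norm, by the arithmetic-geometric mean inequality and shift invariance, and
  \<open>g\<close> has total mass \<Gamma>.\<close>

lemma conv_form_bound:
  assumes x: "l1 x"
  shows "\<bar>pair (conv x) x\<bar> \<le> \<Gamma> * pair x x"
proof -
  have bx: "bdd x" by (rule bdd_abs_summable[OF x])
  let ?sq = "pair x x"
  let ?c = "\<lambda>u. \<Sum>\<^sub>\<infinity>z. x (z - u) * x z"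
  have sq: "((\<lambda>z. x z * x z) has_sum ?sq) UNIV"
    by (intro has_sum_infsum l1_mult_summable bx x)
  have c: "\<bar>?c u\<bar> \<le> ?sq" for u
  proof -
    have avg: "((\<lambda>z. (x (z - u) * x (z - u)) / 2 + (x z * x z) / 2) has_sum ?sq) UNIV"
      using has_sum_add[OF has_sum_cmult_left[OF has_sum_shift[OF sq, of u], of "1/2"]
        has_sum_cmult_left[OF sq, of "1/2"]] by simp
    have hc: "((\<lambda>z. x (z - u) * x z) has_sum ?c u) UNIV"
      by (intro has_sum_infsum l1_mult_summable bdd_shift bx x)
    have le: "\<bar>p * q\<bar> \<le> p * p / 2 + q * q / 2" for p q :: real
      using sum_squares_bound[of p q] sum_squares_bound[of p "- q"] by (simp add: power2_eq_square abs_le_iff)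
    show ?thesis by (rule has_sum_abs_bound[OF avg hc le])
  qed
  have gs: "((\<lambda>u. g u * ?sq) has_sum \<Gamma> * ?sq) UNIV" by (rule has_sum_cmult_left[OF g_has_sum])
  have gc: "\<bar>g u * ?c u\<bar> \<le> g u * ?sq" for u
    using c[of u] g_nonneg[of u] by (simp add: abs_mult mult_left_mono)
  have "((\<lambda>u. g u * ?c u) has_sum (\<Sum>\<^sub>\<infinity>u. g u * ?c u)) UNIV"
    by (intro has_sum_infsum summable_on_dominated[OF has_sum_imp_summable[OF gs] gc])
  from has_sum_abs_bound[OF gs this gc]
  show ?thesis unfolding conv_pairing[OF bx x] .
qed

text \<open>The two energies differ only in the interaction terms, which are dominated by \<open>\<Gamma>\<close> times
  the diagonal ones.\<close>

lemma energy_sign_flip: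
  assumes x: "l1 x" and s: "\<And>z. s z = 1 \<or> s z = (-1 :: real)" and \<Gamma>: "\<Gamma> < 1"
  shows "(1 - \<Gamma>) * energy (\<lambda>z. s z * x z) (\<lambda>z. s z * x z) \<le> (1 + \<Gamma>) * energy x x"
proof -
  have "\<bar>s z\<bar> \<le> 1" for z using s[of z] by auto
  then have bs: "bdd s" unfolding bdd_def by blast
  have lsx: "l1 (\<lambda>z. s z * x z)" by (rule l1_bdd_mult[OF x bs])
  let ?sq = "pair x x"
  let ?A = "pair (conv x) x" and ?B = "pair (conv (\<lambda>z. s z * x z)) (\<lambda>z. s z * x z)"
  have sx: "s z * x z * (s z * x z) = x z * x z" for z using s[of z] by auto
  have E: "energy x x = a * ?sq - ?A" "energy (\<lambda>z. s z * x z) (\<lambda>z. s z * x z) = a * ?sq - ?B"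
    unfolding energy_alt[OF bdd_abs_summable[OF x] x] energy_alt[OF bdd_abs_summable[OF lsx] lsx] sx
    by (rule refl)+
  have AB: "?A \<le> \<Gamma> * ?sq" "- ?B \<le> \<Gamma> * ?sq"
    using conv_form_bound[OF x] conv_form_bound[OF lsx] unfolding sx by linarith+
  have "0 \<le> ?sq" by (rule infsum_nonneg) simp
  \<comment> \<open>The two interaction bounds, with their weights, add up to
    \<open>2 * \<Gamma> * ?sq\<close>, whereas the diagonal terms leave room for
    \<open>2 * \<Gamma> * a * ?sq\<close>; the difference is twice this product.\<close>
  then have "0 \<le> (\<Gamma> * \<Gamma>) * ?sq" by simp
  moreover have "(1 + \<Gamma>) * ?A \<le> (1 + \<Gamma>) * (\<Gamma> * ?sq)" "(1 - \<Gamma>) * - ?B \<le> (1 - \<Gamma>) * (\<Gamma> * ?sq)"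
    using AB \<Gamma>_nonneg \<Gamma> by (intro mult_left_mono; simp)+
  ultimately show ?thesis unfolding E a_def by (simp add: algebra_simps)
qed

lemma energy_nonneg:
  assumes x: "l1 x"
  shows "0 \<le> energy x x"
proof -
  let ?sq = "pair x x"
  have "\<Gamma> * ?sq \<le> a * ?sq"
    using \<Gamma>_less_a by (intro mult_right_mono infsum_nonneg) auto
  then show ?thesis
    unfolding energy_alt[OF bdd_abs_summable[OF x] x] using conv_form_bound[OF x] by linarith
qed

text \<open>\<open>x\<close> is the potential of the finite charge \<open>p\<close>:
  \<open>L x\<close> is \<open>p\<close> on \<open>F\<close> and 0 elsewhere, so the pairing
  collapses to a finite sum.\<close>

lemma energy_potential:
  assumes F: "finite F" and x: "x = (\<lambda>z. \<Sum>k\<in>F. p k * b (z - k))"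
  shows "energy x u = (\<Sum>k\<in>F. p k * u k)"
proof -
  have "((\<lambda>z. L x z * u z) has_sum (\<Sum>k\<in>F. p k * u k)) UNIV"
    by (rule has_sum_finite_neutralI[OF F]) (auto simp: x L_b_sum[OF F])
  then show ?thesis unfolding energy_def by (rule infsumI)
qed

text \<open>With \<open>h\<close> and \<open>y\<close> the potentials of \<open>p\<close> and \<open>s p\<close>, expand the energy of \<open>h - t s y\<close> for
  \<open>t = (1 - \<Gamma>) / (1 + \<Gamma>)\<close>.\<close>

lemma covariance_sign_flip:
  assumes F: "finite F" and s: "\<And>z. s z = 1 \<or> s z = (-1 :: real)" and \<Gamma>: "\<Gamma> < 1"
  shows "(1 - \<Gamma>) * (\<Sum>i\<in>F. \<Sum>j\<in>F. (s i * p i) * (s j * p j) * b (j - i)) \<le>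
     (1 + \<Gamma>) * (\<Sum>i\<in>F. \<Sum>j\<in>F. p i * p j * b (j - i))"
proof -
  define h where "h = (\<lambda>z. \<Sum>k\<in>F. p k * b (z - k))"
  define y where "y = (\<lambda>z. \<Sum>k\<in>F. (s k * p k) * b (z - k))"
  define C where "C = (\<Sum>i\<in>F. \<Sum>j\<in>F. p i * p j * b (j - i))"
  define D where "D = (\<Sum>i\<in>F. \<Sum>j\<in>F. (s i * p i) * (s j * p j) * b (j - i))"
  define t where "t = (1 - \<Gamma>) / (1 + \<Gamma>)"
  let ?sy = "\<lambda>z. s z * y z"
  have "\<bar>s z\<bar> \<le> 1" for z using s[of z] by auto
  then have bs: "bdd s" unfolding bdd_def by blast
  have h: "l1 h" and y: "l1 y"
    unfolding h_def y_def by (intro l1_sum l1_shift b_summable)+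
  have sy: "l1 ?sy" by (rule l1_bdd_mult[OF y bs])
  have hsy: "l1 (\<lambda>z. h z + - t * ?sy z)" by (intro l1_add l1_cmult h sy)
  have b_sym: "b (i - j) = b (j - i)" for i j using symmetric[of "j - i"] by simp
  have hh: "energy h h = C"
    unfolding energy_potential[OF F h_def] C_def
    by (simp add: h_def sum_distrib_left mult.assoc b_sym)
  have yy: "energy y y = D"
    unfolding energy_potential[OF F y_def] D_def
    by (simp add: y_def sum_distrib_left mult.assoc b_sym)
  \<comment> \<open>Only the charge \<open>p\<close> of \<open>h\<close> enters, and the sign in the
    test function combines with it into the charge of \<open>y\<close>.\<close>
  have hy: "energy h ?sy = D"
    unfolding energy_potential[OF F h_def] D_def
    by (simp add: y_def sum_distrib_left ac_simps b_sym)
  have "0 \<le> energy (\<lambda>z. h z + - t * ?sy z) (\<lambda>z. h z + - t * ?sy z)" by (rule energy_nonneg[OF hsy])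
  also have "\<dots> = energy (\<lambda>z. h z + - t * ?sy z) h + - t * energy (\<lambda>z. h z + - t * ?sy z) ?sy"
    by (rule energy_add_right[OF bdd_abs_summable[OF hsy] h sy])
  also have "energy (\<lambda>z. h z + - t * ?sy z) h = C + - t * D"
    unfolding energy_sym[OF hsy h] using energy_add_right[OF bdd_abs_summable[OF h] h sy, of "- t"] hh hy by simp
  also have "energy (\<lambda>z. h z + - t * ?sy z) ?sy = D + - t * energy ?sy ?sy"
    unfolding energy_sym[OF hsy sy] using energy_add_right[OF bdd_abs_summable[OF sy] h sy, of "- t"]
      energy_sym[OF sy h] hy by simp
  \<comment> \<open>Duality between a form and its inverse: a lower bound on \<open>C\<close> costs
    an upper bound on the energy of \<open>?sy\<close>, which \<open>energy_sign_flip\<close>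
    supplies in terms of \<open>D\<close>.\<close>
  finally have 1: "0 \<le> C - 2 * t * D + t * (t * energy ?sy ?sy)" by (simp add: algebra_simps)
  have pos: "0 < 1 + \<Gamma>" "0 \<le> t" using \<Gamma>_nonneg \<Gamma> by (auto simp: t_def)
  have "(1 - \<Gamma>) * energy ?sy ?sy \<le> (1 + \<Gamma>) * D"
    using energy_sign_flip[OF y s \<Gamma>] yy by simp
  then have "t * energy ?sy ?sy \<le> D" using pos by (simp add: t_def field_simps)
  then have "t * (t * energy ?sy ?sy) \<le> t * D" using pos(2) by (rule mult_left_mono)
  with 1 have "t * D \<le> C" by simp
  then show ?thesis using pos unfolding C_def[symmetric] D_def[symmetric] by (simp add: t_def field_simps)
qed

end

section \<open>Decay of the Green function\<close>

lemma lattice_bigo_iff: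
  fixes u h :: "int ^ 'n \<Rightarrow> real"
  shows "u \<in> O[lattice_at_infinity N](h) \<longleftrightarrow> (\<exists>c R. 0 < c \<and> (\<forall>z. R \<le> lattice_norm N z \<longrightarrow> \<bar>u z\<bar> \<le> c * \<bar>h z\<bar>))"
  unfolding bigo_def lattice_at_infinity_def by (auto simp: eventually_filtercomap_at_top_linorder)

text \<open>Convexity makes \<open>N\<close> continuous, so it has a positive minimum on the compact
  unit sphere; homogeneity does the rest.\<close>

lemma is_norm_lower:
  fixes N :: "real ^ 'n \<Rightarrow> real"
  assumes N: "is_norm N"
  obtains c where "0 < c" "\<And>x. c * norm x \<le> N x"
proof -
  have "convex_on UNIV N"
  proof (rule convex_onI)
    fix t :: real and x y :: "real ^ 'n" assume t: "0 < t" "t < 1"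
    have "N ((1 - t) *\<^sub>R x + t *\<^sub>R y) \<le> N ((1 - t) *\<^sub>R x) + N (t *\<^sub>R y)"
      using N unfolding is_norm_def by blast
    also have "\<dots> = \<bar>1 - t\<bar> * N x + \<bar>t\<bar> * N y" using N unfolding is_norm_def by metis
    finally show "N ((1 - t) *\<^sub>R x + t *\<^sub>R y) \<le> (1 - t) * N x + t * N y" using t by simp
  qed simp
  then have cont: "continuous_on UNIV N" by (intro convex_on_continuous) simp_all
  obtain e :: "real ^ 'n" where e: "norm e = 1"
    using vector_choose_size[of 1] by (metis zero_le_one)
  have ne: "sphere (0 :: real ^ 'n) 1 \<noteq> {}" using e by auto
  obtain m where m: "m \<in> sphere 0 1" "\<And>x. x \<in> sphere 0 1 \<Longrightarrow> N m \<le> N x"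
    using continuous_attains_inf[OF compact_sphere ne continuous_on_subset[OF cont subset_UNIV]] by blast
  have "m \<noteq> 0" using m(1) by auto
  then have pos: "0 < N m" using N unfolding is_norm_def by (metis less_eq_real_def)
  have "N m * norm x \<le> N x" for x
  proof (cases "x = 0")
    case True
    have "0 \<le> N x" using N unfolding is_norm_def by blast
    then show ?thesis using True by simp
  next
    case False
    have "N m \<le> N ((1 / norm x) *\<^sub>R x)" by (rule m(2)) (use False in simp)
    also have "\<dots> = \<bar>1 / norm x\<bar> * N x" using N unfolding is_norm_def by metis
    finally show ?thesis using False by (simp add: field_simps)
  qed
  with pos show ?thesis by (rule that)
qed

lemma
  assumes N: "is_norm N"
  shows lattice_norm_nonneg: "0 \<le> lattice_norm N z"
    and lattice_norm_zero: "lattice_norm N 0 = 0"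
    and lattice_norm_pos: "z \<noteq> 0 \<Longrightarrow> 0 < lattice_norm N z"
    and lattice_norm_triangle: "lattice_norm N z \<le> lattice_norm N y + lattice_norm N (z - y)"
proof -
  show nn: "0 \<le> lattice_norm N z" for z using N unfolding is_norm_def lattice_norm_def by blast
  have iff: "lattice_norm N z = 0 \<longleftrightarrow> (\<chi> k. real_of_int (z $ k)) = 0" for z
    using N unfolding is_norm_def lattice_norm_def by blast
  have "(\<chi> k. real_of_int (z $ k)) = 0 \<longleftrightarrow> z = 0" for z :: "int ^ 'b"
    by (simp add: vec_eq_iff)
  with iff nn show "lattice_norm N 0 = 0" "z \<noteq> 0 \<Longrightarrow> 0 < lattice_norm N z"
    by (metis, metis less_eq_real_def)
  have "(\<chi> k. real_of_int (z $ k)) = (\<chi> k. real_of_int (y $ k)) + (\<chi> k. real_of_int ((z - y) $ k))"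
    by (simp add: vec_eq_iff)
  then show "lattice_norm N z \<le> lattice_norm N y + lattice_norm N (z - y)"
    using N unfolding is_norm_def lattice_norm_def by metis
qed

lemma lattice_norm_scaled_axis:
  assumes N: "is_norm N"
  shows "lattice_norm N (\<chi> k. int m * (z $ k)) = real m * lattice_norm N z"
proof -
  have "(\<chi> k. real_of_int ((\<chi> k. int m * (z $ k)) $ k)) = real m *\<^sub>R (\<chi> k. real_of_int (z $ k))"
    by (simp add: vec_eq_iff)
  then show ?thesis using N unfolding is_norm_def lattice_norm_def by (metis abs_of_nat)
qed

lemma summable_exp_abs_int:
  assumes "0 < (\<delta> :: real)"
  shows "(\<lambda>m :: int. exp (- \<delta> * \<bar>real_of_int m\<bar>)) summable_on UNIV"
proof -
  let ?f = "\<lambda>m :: int. exp (- \<delta> * \<bar>real_of_int m\<bar>)"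
  have "summable (\<lambda>n. exp (- \<delta>) ^ n)" using assms by (intro summable_geometric) simp
  moreover have "exp (- \<delta>) ^ n = exp (- \<delta> * real n)" for n
    unfolding exp_of_nat_mult[symmetric] by (simp add: mult.commute)
  ultimately have "summable (\<lambda>n :: nat. exp (- \<delta> * real n))" by simp
  then have s: "(\<lambda>n :: nat. exp (- \<delta> * real n)) summable_on UNIV"
    by (subst summable_on_UNIV_nonneg_real_iff) auto
  have "?f summable_on range int" "?f summable_on range (\<lambda>n. - int n)"
    by (subst summable_on_reindex; use s in \<open>auto simp: inj_on_def o_def\<close>)+
  then have "?f summable_on (range int \<union> range (\<lambda>n. - int n))" by (rule summable_on_union)
  moreover have "x \<in> range int \<union> range (\<lambda>n. - int n)" for x :: int
    by (cases x rule: int_cases2) auto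
  then have "range int \<union> range (\<lambda>n. - int n) = UNIV" by (intro UNIV_eq_I[symmetric])
  ultimately show ?thesis by simp
qed

text \<open>A finite set of lattice points lies in a box, over which the sum of products is a
  product of one-dimensional sums; this bounds all finite partial sums at once.\<close>

lemma summable_prod_lattice:
  fixes f :: "int \<Rightarrow> real"
  assumes f: "f summable_on UNIV" "\<And>m. 0 \<le> f m"
  shows "(\<lambda>z :: int ^ 'n. \<Prod>k\<in>UNIV. f (z $ k)) summable_on UNIV"
proof (rule nonneg_bdd_above_summable_on)
  show "0 \<le> (\<Prod>k\<in>UNIV. f (z $ k))" for z :: "int ^ 'n" by (intro prod_nonneg f(2) ballI)
  have "sum (\<lambda>z :: int ^ 'n. \<Prod>k\<in>UNIV. f (z $ k)) F \<le> (infsum f UNIV) ^ CARD('n)" if F: "finite F" for F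
  proof -
    let ?G = "(\<lambda>(z, k). z $ k) ` (F \<times> (UNIV :: 'n set))"
    have G: "finite ?G" using F by auto
    have inj: "inj_on vec_nth F" by (auto simp: inj_on_def vec_nth_inject)
    have "sum (\<lambda>z :: int ^ 'n. \<Prod>k\<in>UNIV. f (z $ k)) F = sum (\<lambda>h. \<Prod>k\<in>UNIV. f (h k)) (vec_nth ` F)"
      by (simp add: sum.reindex[OF inj])
    also have "\<dots> \<le> sum (\<lambda>h. \<Prod>k\<in>UNIV. f (h k)) (PiE (UNIV :: 'n set) (\<lambda>_. ?G))"
    proof (rule sum_mono2)
      show "finite (PiE UNIV (\<lambda>_ :: 'n. ?G))" using G by (intro finite_PiE) auto
      show "vec_nth ` F \<subseteq> PiE UNIV (\<lambda>_ :: 'n. ?G)" by (auto simp: PiE_def image_iff)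
    qed (use f(2) in \<open>auto intro: prod_nonneg\<close>)
    also have "\<dots> = (\<Prod>k\<in>(UNIV :: 'n set). \<Sum>m\<in>?G. f m)"
      using G by (intro prod_sum_PiE[symmetric]) auto
    also have "\<dots> \<le> (\<Prod>k\<in>(UNIV :: 'n set). infsum f UNIV)"
      using G f by (intro prod_mono conjI sum_nonneg finite_sum_le_infsum) auto
    finally show ?thesis by simp
  qed
  then show "bdd_above (sum (\<lambda>z :: int ^ 'n. \<Prod>k\<in>UNIV. f (z $ k)) ` {F. F \<subseteq> UNIV \<and> finite F})"
    by (auto intro!: bdd_aboveI2[where M = "(infsum f UNIV) ^ CARD('n)"])
qed

lemma summable_exp_lattice_norm:
  fixes N :: "real ^ 'n \<Rightarrow> real"
  assumes N: "is_norm N" and \<delta>: "0 < \<delta>"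
  shows "(\<lambda>z. exp (- \<delta> * lattice_norm N z)) summable_on UNIV"
proof -
  obtain c where c: "0 < c" "\<And>x. c * norm x \<le> N x" using is_norm_lower[OF N] by blast
  let ?n = "real CARD('n)"
  have n: "0 < ?n" by simp
  \<comment> \<open>The sum of the coordinates in absolute value is at most \<open>n\<close> times
    the Euclidean norm, and \<open>c\<close> compares that norm with \<open>N\<close>.\<close>
  define d where "d = \<delta> * c / ?n"
  have d: "0 < d" using \<delta> c n by (simp add: d_def)
  have le: "d * (\<Sum>k\<in>UNIV. \<bar>real_of_int (z $ k)\<bar>) \<le> \<delta> * lattice_norm N z" for z :: "int ^ 'n"
  proof -
    let ?x = "\<chi> k. real_of_int (z $ k)"
    have "(\<Sum>k\<in>UNIV. \<bar>real_of_int (z $ k)\<bar>) \<le> (\<Sum>k\<in>(UNIV :: 'n set). norm ?x)"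
      using component_le_norm_cart[of ?x] by (intro sum_mono) simp
    then have "(\<Sum>k\<in>UNIV. \<bar>real_of_int (z $ k)\<bar>) \<le> ?n * norm ?x" by simp
    then have "d * (\<Sum>k\<in>UNIV. \<bar>real_of_int (z $ k)\<bar>) \<le> d * (?n * norm ?x)"
      using d by (intro mult_left_mono) auto
    also have "\<dots> = \<delta> * (c * norm ?x)" using n by (simp add: d_def)
    also have "\<dots> \<le> \<delta> * lattice_norm N z"
      unfolding lattice_norm_def using \<delta> c(2) by (intro mult_left_mono) auto
    finally show ?thesis .
  qed
  show ?thesis
  proof (rule summable_on_dominated[OF summable_prod_lattice[OF summable_exp_abs_int[OF d]]])
    fix z :: "int ^ 'n"
    have "exp (- \<delta> * lattice_norm N z) \<le> exp (\<Sum>k\<in>UNIV. - d * \<bar>real_of_int (z $ k)\<bar>)"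
      using le[of z] by (simp add: sum_distrib_left sum_negf)
    then show "\<bar>exp (- \<delta> * lattice_norm N z)\<bar> \<le> (\<Prod>k\<in>UNIV. exp (- d * \<bar>real_of_int (z $ k)\<bar>))"
      by (simp add: exp_sum)
  qed simp
qed

section \<open>Weighted bounds for the Green function\<close>

context green_function
begin

lemma b_reflected_has_sum: "((\<lambda>y. b (z - y)) has_sum infsum b UNIV) UNIV"
proof -
  have "bij_betw (\<lambda>y. z - y) UNIV (UNIV :: (int ^ 'n) set)"
    by (rule bij_betwI[where g = "\<lambda>y. z - y"]) auto
  from has_sum_reindex_bij_betw[OF this, of b] b_has_sum show ?thesis by blast
qed

text \<open>Along the renewal equation \<open>a b = conv b\<close> off \<open>0\<close> the weighted supremum \<open>S\<close> satisfies a
  contraction inequality. The weight has to be bounded for \<open>S\<close> to be finite; below, weights are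
  truncated at a radius on which the resulting bounds do not depend.\<close>

lemma weighted_bound:
  assumes w: "\<And>u. 0 \<le> w u" "\<And>u. w u \<le> W" and h: "(h has_sum P) UNIV" "P < a" and c: "0 \<le> c"
    and step: "\<And>S u y. 0 \<le> S \<Longrightarrow> (\<And>v. w v * b v \<le> S) \<Longrightarrow>
      w u * (g y * b (u - y)) \<le> h y * S + c * b (u - y)"
  shows "w z * b z \<le> (c * infsum b UNIV + w 0) / (a - P)"
proof -
  define S where "S = Sup (range (\<lambda>u. w u * b u))"
  obtain B where B: "\<And>z. \<bar>b z\<bar> \<le> B" using bdd_b by (auto simp: bdd_def)
  have "w u * b u \<le> W * B" for u
  proof (rule mult_mono)
    show "b u \<le> B" using B[of u] by linarith
    show "0 \<le> W" using w[of u] by linarith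
  qed (rule w b_nonneg)+
  then have S: "w u * b u \<le> S" for u unfolding S_def by (intro cSup_upper bdd_aboveI2) simp
  have S0: "0 \<le> S" using S[of z] mult_nonneg_nonneg[OF w(1) b_nonneg, of z z] by linarith
  have "a * (w u * b u) \<le> P * S + c * infsum b UNIV + w 0" for u
  proof -
    have "w u * conv b u \<le> P * S + c * infsum b UNIV"
    proof (rule has_sum_mono[OF _ _ step[OF S0 S]])
      show "((\<lambda>y. w u * (g y * b (u - y))) has_sum w u * conv b u) UNIV"
        by (intro has_sum_cmult_right conv_has_sum bdd_b)
      show "((\<lambda>y. h y * S + c * b (u - y)) has_sum (P * S + c * infsum b UNIV)) UNIV"
        by (intro has_sum_add has_sum_cmult_left has_sum_cmult_right h(1) b_reflected_has_sum)
    qed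
    moreover have "a * b u = conv b u + (if u = 0 then 1 else 0)" using L_b[of u] by (simp add: L_def)
    ultimately show ?thesis
      using w(1)[of 0] by (cases "u = 0") (simp_all add: mult.left_commute[of a] distrib_left)
  qed
  then have "w u * b u \<le> (P * S + c * infsum b UNIV + w 0) / a" for u
    using a_pos by (simp add: pos_le_divide_eq mult.commute)
  then have "S \<le> (P * S + c * infsum b UNIV + w 0) / a" unfolding S_def by (intro cSup_least) auto
  then have "S * a \<le> P * S + c * infsum b UNIV + w 0" using a_pos by (simp add: pos_le_divide_eq)
  then have "S * (a - P) \<le> c * infsum b UNIV + w 0" by (simp add: algebra_simps)
  then have "S \<le> (c * infsum b UNIV + w 0) / (a - P)" using h(2) by (simp add: pos_le_divide_eq)
  with S[of z] show ?thesis by linarith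
qed

text \<open>A jump \<open>y\<close> short compared with \<open>u\<close> leaves \<open>u - y\<close>
  at norm at least \<open>\<kappa> |u|\<close>, which costs only the factor
  \<open>\<kappa>^(-s)\<close>. After a long jump the decay of \<open>g\<close> pays for the whole
  weight, and the remaining factor \<open>b (u - y)\<close> is summable.\<close>

lemma polynomial_decay:
  fixes N :: "real ^ 'n \<Rightarrow> real"
  assumes N: "is_norm N" and s: "0 < s" and A: "0 \<le> A"
    and decay: "\<And>y. y \<noteq> 0 \<Longrightarrow> g y \<le> A * lattice_norm N y powr - s"
  shows "\<exists>D. \<forall>z. lattice_norm N z powr s * b z \<le> D"
proof -
  let ?n = "lattice_norm N"
  define q where "q = \<Gamma> / a"
  have q: "0 \<le> q" "q < 1" using \<Gamma>_nonneg \<Gamma>_less_a a_pos by (auto simp: q_def)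
  \<comment> \<open>Chosen so that \<open>\<kappa>^s\<close> lies midway between
    \<open>q = \<Gamma> / a\<close> and 1; hence \<open>\<Gamma> \<kappa>^(-s) < a\<close>, as the
    contraction requires.\<close>
  define \<kappa> where "\<kappa> = exp (ln ((1 + q) / 2) / s)"
  have "ln ((1 + q) / 2) < 0" using q by (subst ln_less_zero_iff) auto
  then have \<kappa>: "0 < \<kappa>" "\<kappa> < 1" using s by (auto simp: \<kappa>_def divide_less_0_iff)
  have \<kappa>s: "\<kappa> powr s = (1 + q) / 2"
    unfolding powr_def \<kappa>_def using q s by simp
  define \<theta> where "\<theta> = 1 - \<kappa>"
  have \<theta>: "0 < \<theta>" using \<kappa> by (simp add: \<theta>_def)
  define P where "P = \<Gamma> * \<kappa> powr - s"
  have "q < \<kappa> powr s" using q \<kappa>s by simp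
  then have P: "P < a" unfolding P_def q_def powr_minus using \<kappa> a_pos by (simp add: field_simps)
  have "?n z powr s * b z \<le> A * \<theta> powr - s * infsum b UNIV / (a - P)" for z
  proof (cases "z = 0")
    case True
    have "0 \<le> infsum b UNIV" using b_nonneg by (rule infsum_nonneg)
    then show ?thesis using True A P lattice_norm_zero[OF N] by simp
  next
    case False
    define l where "l = ?n z"
    have l: "0 < l" unfolding l_def by (rule lattice_norm_pos[OF N False])
    \<comment> \<open>The truncation at \<open>l = |z|\<close> is inactive at \<open>z\<close>, so
      evaluating there gives a bound in which \<open>l\<close> does not appear.\<close>
    define w where "w u = min (?n u) l powr s" for u
    have "w z * b z \<le> (A * \<theta> powr - s * infsum b UNIV + w 0) / (a - P)"
    proof (rule weighted_bound[OF _ _ _ P])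
      show w0: "0 \<le> w u" and "w u \<le> l powr s" for u
        unfolding w_def using lattice_norm_nonneg[OF N, of u] l s by (auto intro!: powr_mono2)
      show "((\<lambda>y. g y * \<kappa> powr - s) has_sum P) UNIV"
        unfolding P_def by (rule has_sum_cmult_left[OF g_has_sum])
      show "0 \<le> A * \<theta> powr - s" using A by simp
      fix S u y assume S0: "0 \<le> S" and S: "\<And>v. w v * b v \<le> S"
      show "w u * (g y * b (u - y)) \<le> g y * \<kappa> powr - s * S + A * \<theta> powr - s * b (u - y)"
      proof (cases "?n y \<le> \<theta> * ?n u")
        case True
        have "\<kappa> * ?n u \<le> ?n (u - y)"
          using lattice_norm_triangle[OF N, of u y] True by (simp add: \<theta>_def algebra_simps)
        moreover have "\<kappa> * l \<le> l" using \<kappa> l by simp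
        ultimately have "\<kappa> * min (?n u) l \<le> min (?n (u - y)) l"
          using \<kappa> by (simp add: min_def split: if_splits) (smt (verit) mult_left_mono)+
        then have "(\<kappa> * min (?n u) l) powr s \<le> w (u - y)"
          unfolding w_def using \<kappa> l s lattice_norm_nonneg[OF N, of u] by (intro powr_mono2) auto
        then have "\<kappa> powr s * w u \<le> w (u - y)"
          unfolding w_def using \<kappa> l lattice_norm_nonneg[OF N, of u] by (simp add: powr_mult)
        then have "\<kappa> powr - s * (\<kappa> powr s * w u) \<le> \<kappa> powr - s * w (u - y)"
          by (intro mult_left_mono) auto
        then have "w u \<le> \<kappa> powr - s * w (u - y)"
          using \<kappa> by (simp add: powr_minus mult.assoc[symmetric])
        then have "w u * (g y * b (u - y)) \<le> (\<kappa> powr - s * w (u - y)) * (g y * b (u - y))"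
          using g_nonneg b_nonneg by (intro mult_right_mono) auto
        also have "\<dots> = g y * \<kappa> powr - s * (w (u - y) * b (u - y))" by (simp only: ac_simps)
        also have "\<dots> \<le> g y * \<kappa> powr - s * S"
          using g_nonneg S by (intro mult_left_mono) auto
        moreover have "0 \<le> A * \<theta> powr - s * b (u - y)" using A b_nonneg by simp
        ultimately show ?thesis by linarith
      next
        case far: False
        have y: "y \<noteq> 0"
        proof
          assume "y = 0"
          then show False using far lattice_norm_zero[OF N] lattice_norm_nonneg[OF N, of u] \<theta> by simp
        qed
        have ny: "0 < ?n y" by (rule lattice_norm_pos[OF N y])
        have "\<theta> * min (?n u) l \<le> \<theta> * ?n u" using \<theta> by (intro mult_left_mono) auto
        then have "min (?n u) l * \<theta> \<le> ?n y" using far by (simp only: mult.commute[of "min _ _"])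
        then have "min (?n u) l \<le> ?n y / \<theta>" unfolding pos_le_divide_eq[OF \<theta>] .
        then have "w u \<le> (?n y / \<theta>) powr s"
          unfolding w_def using l s lattice_norm_nonneg[OF N, of u] by (intro powr_mono2) auto
        then have "w u * g y \<le> (?n y / \<theta>) powr s * (A * ?n y powr - s)"
          using decay[OF y] g_nonneg w0 by (intro mult_mono) auto
        also have "\<dots> = A * \<theta> powr - s"
          using ny \<theta> by (simp add: powr_divide powr_minus field_simps)
        finally have "w u * g y * b (u - y) \<le> A * \<theta> powr - s * b (u - y)"
          using b_nonneg by (rule mult_right_mono)
        moreover have "0 \<le> g y * \<kappa> powr - s * S" using g_nonneg S0 by simp
        ultimately show ?thesis by (simp add: mult.assoc)
      qed
    qed
    moreover have "w 0 = 0" unfolding w_def using lattice_norm_zero[OF N] l s by simp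
    ultimately show ?thesis by (simp add: w_def l_def)
  qed
  then show ?thesis by blast
qed

text \<open>Convexity of exp between 0 and \<open>x\<close>: two instances of
  \<open>1 + t <= exp t\<close>, averaged with weights \<mu> and \<open>1 - \<mu>\<close> so that
  the linear terms cancel.\<close>

lemma exp_interpolation:
  assumes "0 \<le> \<mu>" "\<mu> \<le> 1"
  shows "exp (\<mu> * x) \<le> (1 - \<mu>) + \<mu> * exp (x :: real)"
proof -
  have "exp (\<mu> * x) * (1 + (1 - \<mu>) * x) \<le> exp (\<mu> * x) * exp ((1 - \<mu>) * x)"
    by (intro mult_left_mono exp_ge_add_one_self) simp
  also have "\<dots> = exp x" unfolding exp_add[symmetric] by (simp add: algebra_simps)
  finally have 1: "exp (\<mu> * x) * (1 + (1 - \<mu>) * x) \<le> exp x" .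
  have "exp (\<mu> * x) * (1 + - \<mu> * x) \<le> exp (\<mu> * x) * exp (- \<mu> * x)"
    by (intro mult_left_mono exp_ge_add_one_self) simp
  also have "\<dots> = 1" unfolding exp_add[symmetric] by simp
  finally have 2: "exp (\<mu> * x) * (1 + - \<mu> * x) \<le> 1" .
  have "exp (\<mu> * x) = \<mu> * (exp (\<mu> * x) * (1 + (1 - \<mu>) * x)) + (1 - \<mu>) * (exp (\<mu> * x) * (1 + - \<mu> * x))"
    by (simp add: algebra_simps)
  also have "\<dots> \<le> \<mu> * exp x + (1 - \<mu>) * 1"
    using 1 2 assms by (intro add_mono mult_left_mono) auto
  finally show ?thesis by simp
qed

text \<open>The exponential moment \<open>Q\<close> of \<open>g\<close> at rate \<open>t\<close> is
  finite but may exceed \<open>a\<close>. Interpolating with the rate 0, where the moment is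
  \<Gamma>, brings it below \<open>a\<close> at a smaller positive rate; this is where the rate of
  \<gamma> is lost.\<close>

lemma exponential_decay:
  fixes N :: "real ^ 'n \<Rightarrow> real"
  assumes N: "is_norm N" and \<beta>: "0 < \<beta>" and decay: "\<And>y. g y \<le> A * exp (- \<beta> * lattice_norm N y)"
  shows "\<exists>\<tau>>0. \<exists>D. \<forall>z. exp (\<tau> * lattice_norm N z) * b z \<le> D"
proof -
  let ?n = "lattice_norm N"
  \<comment> \<open>Half the rate is spent on the weight; the other half keeps the sum over the
    lattice finite.\<close>
  define t where "t = \<beta> / 2"
  have t: "0 < t" using \<beta> by (simp add: t_def)
  have "(\<lambda>y. g y * exp (t * ?n y)) summable_on UNIV"
  proof (rule summable_on_dominated)
    show "(\<lambda>y. A * exp (- t * ?n y)) summable_on UNIV"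
      by (intro summable_on_cmult_right summable_exp_lattice_norm N t)
    fix y
    have "g y * exp (t * ?n y) \<le> A * exp (- \<beta> * ?n y) * exp (t * ?n y)"
      by (intro mult_right_mono decay) simp
    also have "\<dots> = A * exp (- t * ?n y)"
      unfolding mult.assoc exp_add[symmetric] by (simp add: t_def field_simps)
    finally show "\<bar>g y * exp (t * ?n y)\<bar> \<le> A * exp (- t * ?n y)" using g_nonneg by simp
  qed
  then obtain Q where Q: "((\<lambda>y. g y * exp (t * ?n y)) has_sum Q) UNIV"
    by (auto simp: summable_on_def)
  have "g y * 1 \<le> g y * exp (t * ?n y)" for y
    using t lattice_norm_nonneg[OF N, of y] by (intro mult_left_mono g_nonneg) simp
  then have "\<Gamma> \<le> Q" by (intro has_sum_mono[OF g_has_sum Q]) simp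
  then have Q0: "0 \<le> Q" using \<Gamma>_nonneg by simp
  \<comment> \<open>This gives \<open>\<mu> Q < 1\<close>, hence
    \<open>P < \<Gamma> + 1 = a\<close>.\<close>
  define \<mu> where "\<mu> = 1 / (1 + Q)"
  have \<mu>: "0 < \<mu>" "\<mu> \<le> 1" using Q0 by (auto simp: \<mu>_def)
  define \<tau> where "\<tau> = \<mu> * t"
  have \<tau>: "0 < \<tau>" using \<mu> t by (simp add: \<tau>_def)
  define P where "P = (1 - \<mu>) * \<Gamma> + \<mu> * Q"
  have P: "((\<lambda>y. (1 - \<mu>) * g y + \<mu> * (g y * exp (t * ?n y))) has_sum P) UNIV"
    unfolding P_def by (intro has_sum_add has_sum_cmult_right g_has_sum Q)
  have g_exp: "g y * exp (\<tau> * ?n y) \<le> (1 - \<mu>) * g y + \<mu> * (g y * exp (t * ?n y))" for y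
    using mult_left_mono[OF exp_interpolation[of \<mu> "t * ?n y"] g_nonneg[of y]] \<mu>
    by (simp add: \<tau>_def algebra_simps)
  have "\<mu> * Q < 1" using Q0 by (simp add: \<mu>_def)
  moreover have "0 \<le> \<mu> * \<Gamma>" using \<mu> \<Gamma>_nonneg by simp
  ultimately have Pa: "P < a" by (simp add: P_def a_def algebra_simps)
  have "exp (\<tau> * ?n z) * b z \<le> 1 / (a - P)" for z
  proof -
    define l where "l = ?n z"
    define w where "w u = exp (\<tau> * min (?n u) l)" for u
    have "w z * b z \<le> (0 * infsum b UNIV + w 0) / (a - P)"
    proof (rule weighted_bound[OF _ _ P Pa])
      show "0 \<le> w u" "w u \<le> exp (\<tau> * l)" for u using \<tau> by (simp_all add: w_def)
      fix S u y assume S0: "0 \<le> S" and S: "\<And>v. w v * b v \<le> S"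
      \<comment> \<open>Truncation preserves subadditivity of the norm, so the truncated weight is
        still submultiplicative.\<close>
      have "min (?n u) l \<le> ?n y + min (?n (u - y)) l"
        using lattice_norm_triangle[OF N, of u y] lattice_norm_nonneg[OF N, of y] by (simp add: min_def)
      then have "w u \<le> exp (\<tau> * (?n y + min (?n (u - y)) l))" using \<tau> by (simp add: w_def)
      then have "w u \<le> exp (\<tau> * ?n y) * w (u - y)"
        by (simp add: w_def distrib_left exp_add)
      then have "w u * (g y * b (u - y)) \<le> (exp (\<tau> * ?n y) * w (u - y)) * (g y * b (u - y))"
        using g_nonneg b_nonneg by (intro mult_right_mono) auto
      also have "\<dots> = g y * exp (\<tau> * ?n y) * (w (u - y) * b (u - y))" by (simp only: ac_simps)
      also have "\<dots> \<le> g y * exp (\<tau> * ?n y) * S"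
        using g_nonneg S by (intro mult_left_mono) auto
      also have "\<dots> \<le> ((1 - \<mu>) * g y + \<mu> * (g y * exp (t * ?n y))) * S"
        by (intro mult_right_mono g_exp S0)
      finally show "w u * (g y * b (u - y)) \<le>
        ((1 - \<mu>) * g y + \<mu> * (g y * exp (t * ?n y))) * S + 0 * b (u - y)" by simp
    qed simp
    moreover have "w 0 = 1" "w z = exp (\<tau> * ?n z)"
      using lattice_norm_zero[OF N] lattice_norm_nonneg[OF N, of z] by (simp_all add: w_def l_def)
    ultimately show ?thesis by simp
  qed
  then show ?thesis using \<tau> by blast
qed

end

section \<open>Correlation coefficients\<close>

context centred_gaussian
begin

lemma space_generated: "space (generated S) = space M"
  unfolding generated_def by (rule space_measure_of) auto

lemma sets_generated:
  "sets (generated S) = sigma_sets (space M) {\<omega> i -` A \<inter> space M | i A. i \<in> S \<and> A \<in> sets borel}"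
  unfolding generated_def by (rule sets_measure_of) auto

lemma omega_generated:
  assumes "i \<in> S"
  shows "\<omega> i \<in> borel_measurable (generated S)"
proof (rule measurableI)
  fix A :: "real set" assume "A \<in> sets borel"
  then show "\<omega> i -` A \<inter> space (generated S) \<in> sets (generated S)"
    unfolding space_generated sets_generated using assms by (intro sigma_sets.Basic) blast
qed simp

lemma generated_subalgebra: "subalgebra M (generated S)"
  unfolding subalgebra_def space_generated sets_generated
proof (intro conjI refl sets.sigma_sets_subset)
  show "{\<omega> i -` A \<inter> space M | i A. i \<in> S \<and> A \<in> sets borel} \<subseteq> sets M"
    using measurable_sets[OF sqint_measurable[OF omega_sqint]] by blast
qed

lemma spins_generated:
  assumes "I \<subseteq> S"
  shows "spins \<omega> I \<in> measurable (generated S) (Pi\<^sub>M I (\<lambda>_. borel))"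
proof -
  have "spins \<omega> I = (\<lambda>x. \<lambda>i\<in>I. \<omega> i x)" by (simp add: spins_def fun_eq_iff)
  then show ?thesis using assms by (auto intro!: measurable_restrict omega_generated)
qed

lemma spins_space: "spins \<omega> I \<in> space M \<rightarrow> space (Pi\<^sub>M I (\<lambda>_. borel))"
  by (auto simp: spins_def space_PiM)

abbreviation spin_algebra :: "'i set \<Rightarrow> 'a measure" where
  "spin_algebra K \<equiv> vimage_algebra (space M) (spins \<omega> K) (Pi\<^sub>M K (\<lambda>_. borel))"

abbreviation site_algebra :: "'i \<Rightarrow> 'a measure" where
  "site_algebra i \<equiv> vimage_algebra (space M) (\<omega> i) borel"

abbreviation adm :: "'i \<Rightarrow> 'i set \<Rightarrow> ('a \<Rightarrow> real) set" where
  "adm i K \<equiv> admissible M (site_algebra i) (spin_algebra K)"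

lemma spin_algebra_generated: "sets (spin_algebra K) \<subseteq> sets (generated (S \<union> K))"
  unfolding sets_vimage_algebra2[OF spins_space]
  using measurable_sets[OF spins_generated[of K "S \<union> K"]] unfolding space_generated by auto

lemma site_algebra_generated: "i \<in> S \<Longrightarrow> sets (site_algebra i) \<subseteq> sets (generated S)"
  using measurable_sets[OF omega_generated[of i S]] unfolding space_generated
  by (subst sets_vimage_algebra2) auto

lemma spin_algebra_subalgebra: "subalgebra M (spin_algebra K)"
  using spin_algebra_generated[of K "{}"] generated_subalgebra[of K] by (auto simp: subalgebra_def)

lemma omega_spin_algebra:
  assumes "k \<in> K"
  shows "\<omega> k \<in> borel_measurable (spin_algebra K)"
proof -
  have "(\<lambda>x. spins \<omega> K x k) \<in> borel_measurable (spin_algebra K)"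
    using measurable_compose[OF measurable_vimage_algebra1[OF spins_space] measurable_component_singleton[OF assms]]
    by (simp add: o_def)
  then show ?thesis using assms by (simp add: spins_def)
qed

text \<open>Translates vanishing conditional expectation into orthogonality to the trigonometric
  functions of the spins in \<open>K\<close>, the form used by
  \<open>conditional_correlation\<close>.\<close>

lemma admissible_generated:
  assumes "f \<in> adm i K"
  shows "f \<in> borel_measurable (generated ({i} \<union> K))" "f \<in> sqint M"
    "\<And>h. h \<in> trig (lin \<omega> K) \<Longrightarrow> ip M f h = 0"
proof -
  let ?H = "spin_algebra K" and ?G = "generated ({i} \<union> K)"
  have f: "f \<in> borel_measurable (sig_join (site_algebra i) ?H)" "integrable M (\<lambda>x. (f x)\<^sup>2)"
    "AE x in M. real_cond_exp M ?H f x = 0"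
    using assms by (auto simp: admissible_def)
  have sub: "sets (site_algebra i) \<union> sets ?H \<subseteq> sets ?G"
    using spin_algebra_generated[of K "{i}"] site_algebra_generated[of i "{i} \<union> K"] by auto
  have "sets (site_algebra i) \<union> sets ?H \<subseteq> Pow (space M)"
    using sets.sets_into_space[of _ "site_algebra i"] sets.sets_into_space[of _ ?H] by auto
  then have "sets (sig_join (site_algebra i) ?H) = sigma_sets (space M) (sets (site_algebra i) \<union> sets ?H)"
    "space (sig_join (site_algebra i) ?H) = space M"
    by (simp_all add: sig_join_def space_measure_of_conv)
  moreover have "sigma_sets (space M) (sets (site_algebra i) \<union> sets ?H) \<subseteq> sets ?G"
    using sets.sigma_sets_subset[OF sub] unfolding space_generated .
  ultimately show fG: "f \<in> borel_measurable ?G"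
    using f(1) by (auto simp: measurable_def space_generated)
  then have fM: "f \<in> borel_measurable M"
    by (rule measurable_from_subalg[OF generated_subalgebra])
  then show fsq: "f \<in> sqint M" using f(2) by (simp add: sqint_def)
  interpret H: finite_measure_subalgebra M ?H
    by unfold_locales (rule spin_algebra_subalgebra)
  fix h assume h: "h \<in> trig (lin \<omega> K)"
  have hH: "h \<in> borel_measurable ?H"
    by (rule trig_measurable[OF h]) (blast intro: lin_measurable omega_spin_algebra)
  have int: "integrable M (\<lambda>x. h x * f x)" by (rule sqint_mult[OF trig_sqint[OF h] fsq])
  have "ip M f h = (\<integral>x. h x * real_cond_exp M ?H f x \<partial>M)"
    unfolding H.real_cond_exp_intg(2)[OF int hH fM] by (simp add: ip_def mult.commute)
  also have "\<dots> = (\<integral>x. 0 \<partial>M)"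
  proof (rule integral_cong_AE)
    show "(\<lambda>x. h x * real_cond_exp M ?H f x) \<in> borel_measurable M"
      using H.real_cond_exp_intg(1)[OF int hH fM] by (rule borel_measurable_integrable)
  qed (use f(3) in \<open>auto elim: eventually_mono\<close>)
  finally show "ip M f h = 0" by simp
qed

lemma trig_const: "(\<lambda>x. c) \<in> trig (lin \<omega> S)"
proof -
  have "(\<lambda>x. c * cos (0 + 0)) \<in> trig (lin \<omega> S)" by (intro trig_scale trig_cos lin_zero)
  then show ?thesis by simp
qed

lemma covar_centred: "integral\<^sup>L M f = 0 \<Longrightarrow> integral\<^sup>L M h = 0 \<Longrightarrow> covar M f h = ip M f h"
  by (simp add: covar_def ip_def)

lemma admissible_sd:
  assumes "f \<in> adm i K"
  shows "sd M f = sqrt (ip M f f)"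
proof -
  have "ip M f (\<lambda>x. 1) = 0" by (rule admissible_generated(3)[OF assms trig_const])
  then have "integral\<^sup>L M f = 0" by (simp add: ip_def)
  then show ?thesis by (simp add: sd_def covar_centred)
qed

abbreviation covariance_bound :: "'i \<Rightarrow> 'i \<Rightarrow> 'i set \<Rightarrow> real \<Rightarrow> bool" where
  "covariance_bound i j K \<epsilon> \<equiv> \<forall>f\<in>adm i K.
     \<forall>h\<in>adm j K. \<bar>\<integral>x. f x * h x \<partial>M\<bar> \<le> \<epsilon> * sd M f * sd M h"

lemma residual_covariance_bound:
  assumes bound: "\<And>K'. finite K' \<Longrightarrow> K' \<subseteq> K \<Longrightarrow> residual_bound \<rho> {i} {j} K'" and \<rho>: "0 \<le> \<rho>"
  shows "covariance_bound i j K \<rho>"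
proof (intro ballI)
  fix f h assume f: "f \<in> adm i K"
    and h: "h \<in> adm j K"
  show "\<bar>\<integral>x. f x * h x \<partial>M\<bar> \<le> \<rho> * sd M f * sd M h"
    unfolding admissible_sd[OF f] admissible_sd[OF h] ip_def[of M f h, symmetric]
    by (rule conditional_correlation[of K \<rho> "{i}" "{j}", OF bound admissible_generated[OF f]
          admissible_generated[OF h] \<rho>])
qed

lemma cond_corr_le:
  assumes bound: "\<And>K'. finite K' \<Longrightarrow> K' \<subseteq> K \<Longrightarrow> residual_bound \<rho> {i} {j} K'" and \<rho>: "0 \<le> \<rho>" "\<rho> \<le> 1"
  shows "cond_corr M (site_algebra i) (site_algebra j) (spin_algebra K) \<le> \<rho>"
  unfolding cond_corr_def
proof (rule cInf_lower)
  show "\<rho> \<in> {\<epsilon> \<in> {0..1}. covariance_bound i j K \<epsilon>}"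
    using residual_covariance_bound[OF bound \<rho>(1)] \<rho> by simp
qed (auto intro: bdd_belowI[of _ 0])

text \<open>Nonnegativity of the square norm of \<open>X + Y\<close>. It makes the set in
  \<open>cond_corr\<close> nonempty and bounds the supremum in \<open>star_corr\<close>.\<close>

lemma residual_bound_one: "residual_bound 1 I J K"
  unfolding residual_bound_def
proof (intro ballI impI)
  fix X Y assume X: "X \<in> lin \<omega> (I \<union> K)" and Y: "Y \<in> lin \<omega> (J \<union> K)"
  note sq = lin_sqint[OF X] lin_sqint[OF Y]
  have "ip M (\<lambda>x. X x + Y x) (\<lambda>x. X x + Y x) = ip M X X + ip M Y Y + 2 * ip M X Y"
    using sq sqint_add[OF sq] by (simp add: ip_add_left ip_add_right ip_commute[of M Y X])
  then show "0 \<le> 1 * ip M X X + 1 * ip M Y Y + 2 * ip M X Y"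
    using ip_self_nonneg[of M "\<lambda>x. X x + Y x"] by simp
qed

lemma star_corr_le:
  assumes "\<And>K. finite K \<Longrightarrow> residual_bound \<rho> {i} {j} K" and "0 \<le> \<rho>" "\<rho> \<le> 1"
  shows "star_corr M \<omega> i j \<le> \<rho>"
  unfolding star_corr_def
  by (rule cSUP_least) (simp, rule cond_corr_le[OF assms])

text \<open>Makes the spin itself a test function when nothing is conditioned on, so that lower
  bounds on \<open>star_corr\<close> become available.\<close>

lemma omega_admissible: "\<omega> i \<in> adm i {}"
proof -
  let ?F = "site_algebra i" and ?H = "spin_algebra {}"
  have sub: "sets ?F \<union> sets ?H \<subseteq> Pow (space M)"
    using sets.sets_into_space[of _ ?F] sets.sets_into_space[of _ ?H] by auto
  have "\<omega> i \<in> borel_measurable (sig_join ?F ?H)"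
  proof (rule measurableI)
    fix A :: "real set" assume "A \<in> sets borel"
    then have "\<omega> i -` A \<inter> space M \<in> sets ?F" by (subst sets_vimage_algebra2) auto
    then show "\<omega> i -` A \<inter> space (sig_join ?F ?H) \<in> sets (sig_join ?F ?H)"
      using sub by (auto simp: sig_join_def space_measure_of_conv)
  qed simp
  moreover have "AE x in M. real_cond_exp M ?H (\<omega> i) x = 0"
  proof -
    interpret H: finite_measure_subalgebra M ?H
      by unfold_locales (rule spin_algebra_subalgebra)
    have int: "integrable M (\<omega> i)"
      using omega_sqint[of i] by (auto simp: sqint_def intro: square_integrable_imp_integrable)
    show ?thesis
    proof (rule H.real_cond_exp_charact)
      fix A assume "A \<in> sets ?H"
      then obtain B where A: "A = spins \<omega> {} -` B \<inter> space M"
        unfolding sets_vimage_algebra2[OF spins_space] by blast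
      \<comment> \<open>\<open>spins \<omega> {}\<close> is constant and generates the trivial
        sigma-algebra, for which the conditional expectation is the mean.\<close>
      have "A = {} \<or> A = space M" unfolding A by (auto simp: spins_def restrict_def)
      then have "(\<integral>x\<in>A. \<omega> i x \<partial>M) = 0"
      proof
        assume "A = {}"
        then show ?thesis by (simp add: set_lebesgue_integral_def)
      next
        assume "A = space M"
        then show ?thesis using set_integral_space[OF int] centred[of i] by simp
      qed
      then show "(\<integral>x\<in>A. \<omega> i x \<partial>M) = (\<integral>x\<in>A. 0 \<partial>M)"
        by (simp add: set_lebesgue_integral_def)
    qed (use int in auto)
  qed
  ultimately show ?thesis using sqint_integrable[OF omega_sqint[of i]] by (simp add: admissible_def)
qed

text \<open>With \<open>K = {}\<close> and the two spins themselves as test functions,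
  \<open>cond_corr\<close> is at least their linear correlation.\<close>

lemma star_corr_ge:
  assumes pos: "0 < ip M (\<omega> i) (\<omega> i)" "0 < ip M (\<omega> j) (\<omega> j)"
  shows "\<bar>ip M (\<omega> i) (\<omega> j)\<bar> / (sqrt (ip M (\<omega> i) (\<omega> i)) * sqrt (ip M (\<omega> j) (\<omega> j))) \<le> star_corr M \<omega> i j"
    (is "?r \<le> _")
proof -
  have "?r \<le> cond_corr M (site_algebra i) (site_algebra j) (spin_algebra {})"
    unfolding cond_corr_def
  proof (rule cInf_greatest)
    have "covariance_bound i j {} 1" by (rule residual_covariance_bound[OF residual_bound_one]) simp
    then have "1 \<in> {\<epsilon> \<in> {0..1}. covariance_bound i j {} \<epsilon>}" by simp
    then show "{\<epsilon> \<in> {0..1}. covariance_bound i j {} \<epsilon>} \<noteq> {}" by blast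
    fix \<epsilon> assume "\<epsilon> \<in> {\<epsilon> \<in> {0..1}. covariance_bound i j {} \<epsilon>}"
    then have "\<bar>ip M (\<omega> i) (\<omega> j)\<bar> \<le> \<epsilon> * sd M (\<omega> i) * sd M (\<omega> j)"
      using omega_admissible unfolding ip_def by blast
    then show "?r \<le> \<epsilon>"
      unfolding admissible_sd[OF omega_admissible] using pos by (simp add: pos_divide_le_eq mult.assoc)
  qed
  also have "\<dots> \<le> star_corr M \<omega> i j"
    unfolding star_corr_def
    by (rule cSUP_upper) (auto intro!: bdd_aboveI2[of _ _ 1] cond_corr_le[OF residual_bound_one])
  finally show ?thesis .
qed

lemma trig_empty:
  assumes "h \<in> trig (lin \<omega> {})"
  shows "\<exists>c. \<forall>x. h x = c"
  using assms
proof induction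
  case (trig_cos X t)
  then show ?case by (auto simp: lin_empty)
next
  case (trig_add f g)
  then obtain c d where "\<forall>x. f x = c" "\<forall>x. g x = d" by auto
  then show ?case by auto
next
  case (trig_scale f c)
  then obtain d where "\<forall>x. f x = d" by auto
  then show ?case by auto
qed

text \<open>The case \<open>K = {}\<close> of the conditional theorem: by \<open>trig_empty\<close>
  only constants must be tested against, and orthogonality to them is centring.\<close>

lemma max_corr_spins_le:
  assumes hyp: "\<And>X Y. X \<in> lin \<omega> I \<Longrightarrow> Y \<in> lin \<omega> J \<Longrightarrow>
      0 \<le> \<rho> * ip M X X + \<rho> * ip M Y Y + 2 * ip M X Y"
    and \<rho>: "0 \<le> \<rho>"
  shows "max_corr_spins M \<omega> I J \<le> ennreal \<rho>"
  unfolding max_corr_spins_def max_corr_def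
proof (rule Sup_least, safe)
  fix f :: "('i \<Rightarrow> real) \<Rightarrow> real" and h :: "('i \<Rightarrow> real) \<Rightarrow> real"
  assume f: "f \<in> borel_measurable (Pi\<^sub>M I (\<lambda>_. borel))" "integrable M (\<lambda>x. (f (spins \<omega> I x))\<^sup>2)"
      "0 < sd M (f \<circ> spins \<omega> I)"
    and h: "h \<in> borel_measurable (Pi\<^sub>M J (\<lambda>_. borel))" "integrable M (\<lambda>x. (h (spins \<omega> J x))\<^sup>2)"
      "0 < sd M (h \<circ> spins \<omega> J)"
  define centre where "centre u = (\<lambda>x. u x - integral\<^sup>L M u)" for u :: "'a \<Rightarrow> real"
  have facts: "centre (u \<circ> spins \<omega> S) \<in> borel_measurable (generated (S \<union> {}))"
      "centre (u \<circ> spins \<omega> S) \<in> sqint M" "\<And>k. k \<in> trig (lin \<omega> {}) \<Longrightarrow> ip M (centre (u \<circ> spins \<omega> S)) k = 0"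
    if u: "u \<in> borel_measurable (Pi\<^sub>M S (\<lambda>_. borel))" "integrable M (\<lambda>x. (u (spins \<omega> S x))\<^sup>2)" for u S
  proof -
    let ?u = "u \<circ> spins \<omega> S"
    have m: "?u \<in> borel_measurable (generated S)"
      by (rule measurable_comp[OF spins_generated[OF subset_refl] u(1)])
    then have mM: "?u \<in> borel_measurable M"
      by (rule measurable_from_subalg[OF generated_subalgebra])
    show "centre ?u \<in> borel_measurable (generated (S \<union> {}))"
      unfolding centre_def Un_empty_right by (intro borel_measurable_diff m borel_measurable_const)
    have us: "?u \<in> sqint M" using mM u(2) by (simp add: sqint_def)
    show "centre ?u \<in> sqint M"
      unfolding centre_def by (rule sqint_diff[OF us]) (simp add: sqint_def)
    have int: "integrable M ?u"
      using us by (auto simp: sqint_def intro: square_integrable_imp_integrable)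
    fix k assume "k \<in> trig (lin \<omega> {})"
    then obtain c where c: "\<And>x. k x = c" using trig_empty by blast
    show "ip M (centre ?u) k = 0"
    proof -
      have "(\<integral>x. ?u x - integral\<^sup>L M ?u \<partial>M) = 0"
        by (subst Bochner_Integration.integral_diff[OF int]) (simp_all add: prob_space)
      then show ?thesis unfolding ip_def centre_def c by simp
    qed
  qed
  have cov: "covar M u v = ip M (centre u) (centre v)" for u v
    by (simp add: covar_def ip_def centre_def)
  let ?F = "f \<circ> spins \<omega> I" and ?H = "h \<circ> spins \<omega> J"
  let ?f = "centre ?F" and ?h = "centre ?H"
  have "\<bar>ip M ?f ?h\<bar> \<le> \<rho> * sqrt (ip M ?f ?f) * sqrt (ip M ?h ?h)"
  proof (rule conditional_correlation[where K = "{}" and I = I and J = J])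
    show "residual_bound \<rho> I J K'" if "K' \<subseteq> {}" for K'
      using that hyp by (simp add: residual_bound_def)
  qed (use facts[OF f(1,2)] facts[OF h(1,2)] \<rho> in simp_all)
  then have "\<bar>covar M ?F ?H\<bar> \<le> \<rho> * (sd M ?F * sd M ?H)"
    by (simp add: cov sd_def mult.assoc)
  then have "\<bar>covar M ?F ?H\<bar> / (sd M ?F * sd M ?H) \<le> \<rho>"
    using f(3) h(3) by (simp add: pos_divide_le_eq)
  then show "ennreal (\<bar>covar M ?F ?H\<bar> / (sd M ?F * sd M ?H)) \<le> ennreal \<rho>"
    by (rule ennreal_leI)
qed

end

section \<open>The quadratic model\<close>

locale quadratic_field =
  centred_gaussian M \<omega> + green_function \<gamma> b
  for M :: "'a measure" and \<omega> :: "int ^ 'n \<Rightarrow> 'a \<Rightarrow> real" and \<gamma> b :: "int ^ 'n \<Rightarrow> real" +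
  assumes covariance: "ip M (\<omega> i) (\<omega> j) = b (j - i)"
begin

text \<open>The factor \<open>a\<close> bounds the reciprocal of a normalised residual variance; the
  cap at 1 keeps the rate in the range required of a mixing rate.\<close>

definition \<epsilon> :: "int ^ 'n \<Rightarrow> real" where "\<epsilon> z = min 1 (a * b z)"

lemma ip_sum_omega: "ip M (\<lambda>x. \<Sum>k\<in>K. c k * \<omega> k x) (\<omega> z) = (\<Sum>k\<in>K. c k * b (z - k))"
  by (subst ip_sum_left) (simp_all add: omega_sqint covariance)

lemma normalised_residual:
  assumes K: "finite K" "i \<notin> K"
    and X: "X = (\<lambda>x. \<omega> i x + (\<Sum>k\<in>K. c k * \<omega> k x))"
    and orth: "\<And>k. k \<in> K \<Longrightarrow> ip M X (\<omega> k) = 0"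
  shows "ip M X X = ip M X (\<omega> i)" "1 / a \<le> ip M X X" "0 \<le> ip M X (\<omega> z)" "ip M X (\<omega> z) \<le> b (z - i)"
    "z \<noteq> i \<Longrightarrow> ip M X (\<omega> z) \<le> \<Gamma> / a * ip M X X"
proof -
  have sq: "(\<lambda>x. \<Sum>k\<in>K. c k * \<omega> k x) \<in> sqint M"
    by (intro sqint_sum sqint_cmult omega_sqint)
  have Xs: "X \<in> sqint M" unfolding X by (intro sqint_add omega_sqint sq)
  have eq: "ip M X (\<omega> z) = b (z - i) + (\<Sum>k\<in>K. c k * b (z - k))" for z
    unfolding X by (subst ip_add_left[OF omega_sqint sq omega_sqint]) (simp add: covariance ip_sum_omega)
  have "ip M X X = ip M X (\<omega> i) + ip M X (\<lambda>x. \<Sum>k\<in>K. c k * \<omega> k x)"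
    by (subst (2) X) (rule ip_add_right[OF omega_sqint sq Xs])
  also have "ip M X (\<lambda>x. \<Sum>k\<in>K. c k * \<omega> k x) = 0"
    using orth by (subst ip_sum_right) (simp_all add: omega_sqint Xs)
  finally show XX: "ip M X X = ip M X (\<omega> i)" by simp
  note pc = partial_covariance[OF K, of "\<lambda>z. ip M X (\<omega> z)" c, OF _ orth]
  have fn: "(\<lambda>z. ip M X (\<omega> z)) = (\<lambda>z. b (z - i) + (\<Sum>k\<in>K. c k * b (z - k)))" using eq by (rule ext)
  show "1 / a \<le> ip M X X" "0 \<le> ip M X (\<omega> z)" "ip M X (\<omega> z) \<le> b (z - i)"
    "z \<noteq> i \<Longrightarrow> ip M X (\<omega> z) \<le> \<Gamma> / a * ip M X X"
    unfolding XX using pc[OF fn] by simp_all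
qed

text \<open>Reduces an arbitrary residual to one with coefficient 1 at \<open>i\<close>, unless it
  lies in the span of \<open>K\<close>; being orthogonal to \<open>K\<close> as well, it is then
  null.\<close>

lemma residual_cases:
  assumes K: "finite K" and X: "X \<in> lin \<omega> ({i} \<union> K)" and orth: "\<And>k. k \<in> K \<Longrightarrow> ip M X (\<omega> k) = 0"
  obtains (degenerate) "ip M X X = 0"
  | (main) \<alpha> c Y where "i \<notin> K" "X = (\<lambda>x. \<alpha> * Y x)" "Y = (\<lambda>x. \<omega> i x + (\<Sum>k\<in>K. c k * \<omega> k x))"
      "\<And>k. k \<in> K \<Longrightarrow> ip M Y (\<omega> k) = 0"
proof -
  have zero: "ip M X X = 0" if "X \<in> lin \<omega> K"
    by (rule ip_lin_zero[OF lin_sqint[OF that] orth that])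
  show thesis
  proof (cases "i \<in> K")
    case True
    then have "{i} \<union> K = K" by auto
    then show thesis using zero X that(1) by simp
  next
    case False
    have "finite ({i} \<union> K)" using K by simp
    then obtain c where c: "X = (\<lambda>x. \<Sum>k\<in>{i} \<union> K. c k * \<omega> k x)" using lin_finite[OF X] by metis
    have Xc: "X = (\<lambda>x. c i * \<omega> i x + (\<Sum>k\<in>K. c k * \<omega> k x))"
      unfolding c using K False by simp
    show thesis
    proof (cases "c i = 0")
      case True
      then have "X = (\<lambda>x. \<Sum>k\<in>K. c k * \<omega> k x)" unfolding Xc by simp
      then have "X \<in> lin \<omega> K" unfolding lin_def using K by blast
      then show thesis using zero that(1) by blast
    next
      case ci: False
      define Y where "Y = (\<lambda>x. \<omega> i x + (\<Sum>k\<in>K. (c k / c i) * \<omega> k x))"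
      have XY: "X = (\<lambda>x. c i * Y x)"
        unfolding Xc Y_def using ci by (simp add: distrib_left sum_distrib_left)
      have "ip M Y (\<omega> k) = 0" if "k \<in> K" for k
        using orth[OF that] ci unfolding XY ip_scale_left by simp
      then show thesis by (rule that(2)[OF False XY Y_def])
    qed
  qed
qed

text \<open>For normalised residuals \<open>U\<close> at \<open>i\<close> and \<open>V\<close> at
  \<open>j\<close>, their covariance \<open>p\<close> is nonnegative and at most \<rho> times either
  variance; the sign is what lets the form be completed to a square.\<close>

lemma partial_correlation:
  assumes ij: "i \<noteq> j" and K: "finite K"
    and X: "X \<in> lin \<omega> ({i} \<union> K)" "\<And>k. k \<in> K \<Longrightarrow> ip M X (\<omega> k) = 0"
    and Y: "Y \<in> lin \<omega> ({j} \<union> K)" "\<And>k. k \<in> K \<Longrightarrow> ip M Y (\<omega> k) = 0"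
    and \<rho>: "\<rho> = min (\<epsilon> (j - i)) (\<Gamma> / a)"
  shows "0 \<le> \<rho> * ip M X X + \<rho> * ip M Y Y + 2 * ip M X Y"
proof -
  have \<rho>0: "0 \<le> \<rho>" unfolding \<rho> \<epsilon>_def using a_pos \<Gamma>_nonneg b_nonneg by simp
  have nn: "0 \<le> \<rho> * ip M X X" "0 \<le> \<rho> * ip M Y Y" 
    by (intro mult_nonneg_nonneg \<rho>0 ip_self_nonneg)+
  have Xs: "X \<in> sqint M" and Ys: "Y \<in> sqint M" using X(1) Y(1) lin_sqint by blast+
  show ?thesis
  proof (cases rule: residual_cases[OF K X, case_names orth degenerate main])
    case (orth k)
    then show ?case .
  next
    case degenerate
    then show ?thesis using ip_null[OF Xs Ys] nn by simp
  next
    case X': (main \<alpha> c U)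
    show ?thesis
    proof (cases rule: residual_cases[OF K Y, case_names orth degenerate main])
      case (orth k)
      then show ?case .
    next
      case degenerate
      then show ?thesis using ip_null[OF Ys Xs] nn by (simp add: ip_commute)
    next
      case Y': (main \<beta> d V)
      note nU = normalised_residual[OF K X'(1,3,4)] and nV = normalised_residual[OF K Y'(1,3,4)]
      have sq: "(\<lambda>x. \<Sum>k\<in>K. e k * \<omega> k x) \<in> sqint M" for e
        by (intro sqint_sum sqint_cmult omega_sqint)
      have Us: "U \<in> sqint M" unfolding X'(3) by (intro sqint_add omega_sqint sq)
      have Vs: "V \<in> sqint M" unfolding Y'(3) by (intro sqint_add omega_sqint sq)
      \<comment> \<open>\<open>U\<close> is orthogonal to the sites in \<open>K\<close>, so only the
        component \<open>\<omega> j\<close> of \<open>V\<close> counts. Exchanging the roles bounds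
        the same number by the variance of \<open>V\<close>.\<close>
      have UV: "ip M U V = ip M U (\<omega> j)"
        unfolding Y'(3) ip_add_right[OF omega_sqint sq Us]
        using X'(4) by (subst ip_sum_right) (simp_all add: omega_sqint Us)
      have "ip M V U = ip M V (\<omega> i)"
        unfolding X'(3) ip_add_right[OF omega_sqint sq Vs]
        using Y'(4) by (subst ip_sum_right) (simp_all add: omega_sqint Vs)
      then have VU: "ip M U V = ip M V (\<omega> i)" by (simp only: ip_commute[of M U V])
      define p where "p = ip M U V"
      have p0: "0 \<le> p" unfolding p_def UV by (rule nU(3))
      have bound: "p \<le> \<rho> * P" if "p \<le> b (j - i)" "1 / a \<le> P" "p \<le> \<Gamma> / a * P" for P
      proof -
        have P: "0 \<le> P" using that(2) a_pos by (meson divide_nonneg_pos order_trans zero_le_one)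
        \<comment> \<open>As \<open>a * P >= 1\<close>, the absolute bound by
          \<open>b (j - i)\<close> becomes a bound relative to the variance
          \<open>P\<close>.\<close>
        have "1 * p \<le> (a * P) * b (j - i)"
          using that(1,2) a_pos p0 by (intro mult_mono) (auto simp: field_simps)
        moreover have "\<Gamma> / a * P \<le> 1 * P"
          using \<Gamma>_less_a a_pos P by (intro mult_right_mono) auto
        ultimately have "p \<le> a * b (j - i) * P" "p \<le> 1 * P" "p \<le> \<Gamma> / a * P"
          using that(3) by (simp_all add: ac_simps)
        then show ?thesis unfolding \<rho> \<epsilon>_def by (simp add: min_def)
      qed
      have pP: "p \<le> \<rho> * ip M U U"
      proof (rule bound)
        show "p \<le> b (j - i)" unfolding p_def UV by (rule nU(4))
        show "p \<le> \<Gamma> / a * ip M U U" unfolding p_def UV by (rule nU(5)) (use ij in auto)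
      qed (rule nU(2))
      have pQ: "p \<le> \<rho> * ip M V V"
      proof (rule bound)
        show "p \<le> b (j - i)" unfolding p_def VU using nV(4)[of i] symmetric[of "j - i"] by simp
        show "p \<le> \<Gamma> / a * ip M V V" unfolding p_def VU by (rule nV(5)) (use ij in auto)
      qed (rule nV(2))
      \<comment> \<open>Lowering both diagonal entries to \<open>p\<close> leaves \<open>p\<close>
        times a square.\<close>
      have "0 \<le> (\<alpha> + \<beta>)\<^sup>2 * p" using p0 by simp
      also have "\<dots> = \<alpha>\<^sup>2 * p + \<beta>\<^sup>2 * p + 2 * (\<alpha> * \<beta> * p)" by (simp add: power2_eq_square algebra_simps)
      also have "\<dots> \<le> \<alpha>\<^sup>2 * (\<rho> * ip M U U) + \<beta>\<^sup>2 * (\<rho> * ip M V V) + 2 * (\<alpha> * \<beta> * p)"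
        using mult_left_mono[OF pP, of "\<alpha>\<^sup>2"] mult_left_mono[OF pQ, of "\<beta>\<^sup>2"] by simp
      also have "\<dots> = \<rho> * ip M X X + \<rho> * ip M Y Y + 2 * ip M X Y"
        unfolding X'(2) Y'(2) p_def ip_scale_left ip_scale_right
        by (simp add: power2_eq_square ac_simps)
      finally show ?thesis .
    qed
  qed
qed

lemma star_corr_bound:
  assumes "i \<noteq> j"
  shows "star_corr M \<omega> i j \<le> min (\<epsilon> (j - i)) (\<Gamma> / a)" (is "_ \<le> ?\<rho>")
proof (rule star_corr_le)
  show "residual_bound ?\<rho> {i} {j} K" if "finite K" for K
    unfolding residual_bound_def by (intro ballI impI partial_correlation[OF assms that]) auto
  show "0 \<le> ?\<rho>" "?\<rho> \<le> 1"
    unfolding \<epsilon>_def using a_pos \<Gamma>_nonneg b_nonneg by simp_all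
qed

lemma \<epsilon>_nonneg: "0 \<le> \<epsilon> z" and \<epsilon>_le: "\<epsilon> z \<le> a * b z"
  unfolding \<epsilon>_def using a_pos b_nonneg by simp_all

lemma rho_mixing: "rho_mixing_with M \<omega> \<epsilon>"
  unfolding rho_mixing_with_def
proof (intro conjI allI impI)
  show "\<epsilon> z \<in> {0..1}" for z using \<epsilon>_nonneg by (simp add: \<epsilon>_def)
  have "\<epsilon> summable_on UNIV"
  proof (rule summable_on_dominated)
    show "(\<lambda>z. a * b z) summable_on UNIV"
      by (rule summable_on_cmult_right[OF has_sum_imp_summable[OF b_has_sum]])
    show "\<bar>\<epsilon> z\<bar> \<le> a * b z" for z using \<epsilon>_nonneg \<epsilon>_le by simp
  qed
  then show "\<epsilon> summable_on - {0}" by (rule summable_on_subset) simp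
  show "\<exists>k\<^sub>0<1. \<forall>i j. i \<noteq> j \<longrightarrow> star_corr M \<omega> i j \<le> min (\<epsilon> (j - i)) k\<^sub>0"
    using star_corr_bound \<Gamma>_less_a a_pos by (intro exI[of _ "\<Gamma> / a"]) simp
qed

text \<open>\<open>X - Y\<close> arises from \<open>X + Y\<close> by flipping signs on the sites of
  \<open>Y\<close>. Expanding both variances in the inequality of
  \<open>covariance_sign_flip\<close> and cancelling leaves the stated form.\<close>

lemma disjoint_correlation:
  assumes IJ: "I \<inter> J = {}" and \<Gamma>: "\<Gamma> < 1" and X: "X \<in> lin \<omega> I" and Y: "Y \<in> lin \<omega> J"
  shows "0 \<le> \<Gamma> * ip M X X + \<Gamma> * ip M Y Y + 2 * ip M X Y"
proof -
  obtain F c where F: "finite F" "F \<subseteq> I" "X = (\<lambda>x. \<Sum>i\<in>F. c i * \<omega> i x)" using X by (auto simp: lin_def)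
  obtain G d where G: "finite G" "G \<subseteq> J" "Y = (\<lambda>x. \<Sum>i\<in>G. d i * \<omega> i x)" using Y by (auto simp: lin_def)
  \<comment> \<open>Disjointness makes one coefficient vector serve for \<open>X\<close> and
    \<open>Y\<close> together.\<close>
  define p where "p i = (if i \<in> F then c i else d i)" for i
  define s where "s i = (if i \<in> F then 1 else - 1 :: real)" for i
  have FG: "F \<inter> G = {}" using F(2) G(2) IJ by auto
  have split: "(\<Sum>i\<in>F \<union> G. q i * \<omega> i x) = (\<Sum>i\<in>F. q i * \<omega> i x) + (\<Sum>i\<in>G. q i * \<omega> i x)" for q x
    by (rule sum.union_disjoint[OF F(1) G(1) FG])
  have notF: "i \<notin> F" if "i \<in> G" for i using that FG by auto
  have plus: "(\<lambda>x. X x + Y x) = (\<lambda>x. \<Sum>i\<in>F \<union> G. p i * \<omega> i x)"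
    unfolding split F(3) G(3) p_def using notF by (intro ext arg_cong2[of _ _ _ _ "(+)"] sum.cong) auto
  have "X x - Y x = (\<Sum>i\<in>F \<union> G. (s i * p i) * \<omega> i x)" for x
  proof -
    have "(\<Sum>i\<in>F. (s i * p i) * \<omega> i x) = X x" unfolding F(3) by (intro sum.cong) (auto simp: s_def p_def)
    moreover have "(\<Sum>i\<in>G. (s i * p i) * \<omega> i x) = - Y x"
      unfolding G(3) sum_negf[symmetric] by (intro sum.cong) (auto simp: s_def p_def notF)
    ultimately show ?thesis unfolding split by simp
  qed
  then have minus: "(\<lambda>x. X x - Y x) = (\<lambda>x. \<Sum>i\<in>F \<union> G. (s i * p i) * \<omega> i x)" by (rule ext)
  have var: "ip M (\<lambda>x. \<Sum>i\<in>F \<union> G. q i * \<omega> i x) (\<lambda>x. \<Sum>i\<in>F \<union> G. q i * \<omega> i x) =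
     (\<Sum>i\<in>F \<union> G. \<Sum>j\<in>F \<union> G. q i * q j * b (j - i))" for q
    by (subst ip_sum_sum) (simp_all add: omega_sqint covariance)
  have "(1 - \<Gamma>) * ip M (\<lambda>x. X x - Y x) (\<lambda>x. X x - Y x) \<le> (1 + \<Gamma>) * ip M (\<lambda>x. X x + Y x) (\<lambda>x. X x + Y x)"
    unfolding plus minus var
    by (rule covariance_sign_flip) (use F(1) G(1) \<Gamma> in \<open>auto simp: s_def\<close>)
  moreover have "ip M (\<lambda>x. X x - Y x) (\<lambda>x. X x - Y x) = ip M X X + ip M Y Y - 2 * ip M X Y"
    using lin_sqint[OF X] lin_sqint[OF Y]
    by (simp add: ip_diff_left ip_diff_right sqint_diff ip_commute[of M Y X])
  moreover have "ip M (\<lambda>x. X x + Y x) (\<lambda>x. X x + Y x) = ip M X X + ip M Y Y + 2 * ip M X Y"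
    using lin_sqint[OF X] lin_sqint[OF Y]
    by (simp add: ip_add_left ip_add_right sqint_add ip_commute[of M Y X])
  ultimately show ?thesis by (simp add: algebra_simps)
qed

lemma max_corr_disjoint:
  assumes "I \<inter> J = {}" "\<Gamma> < 1"
  shows "max_corr_spins M \<omega> I J \<le> ennreal \<Gamma>"
  by (rule max_corr_spins_le[OF disjoint_correlation[OF assms] \<Gamma>_nonneg])

section \<open>Transfer of decay from the interaction to the mixing rate\<close>

lemma g_le_bigo:
  assumes \<gamma>: "\<gamma> \<in> O[lattice_at_infinity N](h)" and h: "\<And>y. y \<noteq> 0 \<Longrightarrow> 0 < h y"
    and near: "\<And>R. \<exists>m>0. \<forall>y. y \<noteq> 0 \<longrightarrow> lattice_norm N y < R \<longrightarrow> m \<le> h y"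
  shows "\<exists>A\<ge>0. \<forall>y. y \<noteq> 0 \<longrightarrow> g y \<le> A * h y"
proof -
  obtain C R where C: "0 < C" and R: "\<And>z. R \<le> lattice_norm N z \<Longrightarrow> \<bar>\<gamma> z\<bar> \<le> C * \<bar>h z\<bar>"
    using \<gamma> unfolding lattice_bigo_iff by blast
  obtain m where m: "0 < m" "\<And>y. y \<noteq> 0 \<Longrightarrow> lattice_norm N y < R \<Longrightarrow> m \<le> h y" using near[of R] by blast
  \<comment> \<open>Beyond the radius \<open>R\<close> the constant \<open>C\<close> serves; inside
    it, \<open>g <= \<Gamma>\<close> and \<open>h >= m\<close>.\<close>
  have "g y \<le> (C + \<Gamma> / m) * h y" if y: "y \<noteq> 0" for y
  proof (cases "R \<le> lattice_norm N y")
    case True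
    have "g y \<le> C * h y" using R[OF True] h[OF y] y by (simp add: g_def)
    moreover have "0 \<le> \<Gamma> / m * h y" using \<Gamma>_nonneg m h[OF y] by simp
    ultimately show ?thesis by (simp add: distrib_right)
  next
    case False
    have "\<Gamma> * m \<le> \<Gamma> * h y" using m(2)[OF y] False \<Gamma>_nonneg by (intro mult_left_mono) auto
    then have "\<Gamma> \<le> \<Gamma> / m * h y" using m(1) by (simp add: field_simps)
    moreover have "0 \<le> C * h y" using C h[OF y] by simp
    ultimately show ?thesis using g_le[of y] by (simp add: distrib_right)
  qed
  moreover have "0 \<le> C + \<Gamma> / m" using C m \<Gamma>_nonneg by simp
  ultimately show ?thesis by blast
qed

lemma \<epsilon>_bigo:
  assumes D: "\<And>z. h z * b z \<le> D" and h: "\<And>z. R \<le> lattice_norm N z \<Longrightarrow> 0 < h z"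
  shows "\<epsilon> \<in> O[lattice_at_infinity N](\<lambda>z. 1 / h z)"
  unfolding lattice_bigo_iff
proof (intro exI conjI allI impI)
  show "0 < a * \<bar>D\<bar> + 1" using a_pos by (simp add: add_nonneg_pos)
  fix z assume "R \<le> lattice_norm N z"
  then have pos: "0 < h z" by (rule h)
  have "h z * \<epsilon> z \<le> h z * (a * b z)" using pos by (intro mult_left_mono \<epsilon>_le) simp
  also have "\<dots> = a * (h z * b z)" by simp
  also have "\<dots> \<le> a * \<bar>D\<bar>" using D[of z] a_pos by (intro mult_left_mono) auto
  finally show "\<bar>\<epsilon> z\<bar> \<le> (a * \<bar>D\<bar> + 1) * \<bar>1 / h z\<bar>"
    using pos \<epsilon>_nonneg[of z] by (simp add: field_simps)
qed

lemma poly_rho_mixing: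
  fixes N :: "real ^ 'n \<Rightarrow> real"
  assumes N: "is_norm N" and \<alpha>: "0 < \<alpha>" and decay: "poly_decay N \<alpha> \<gamma>"
  shows "poly_rho_mixing N \<alpha> M \<omega>"
proof -
  let ?n = "lattice_norm N"
  define s where "s = real CARD('n) + \<alpha>"
  have s: "0 < s" using \<alpha> by (simp add: s_def add_nonneg_pos)
  note pos = lattice_norm_pos[OF N]
  have "\<exists>A\<ge>0. \<forall>y. y \<noteq> 0 \<longrightarrow> g y \<le> A * (1 / ?n y powr s)"
  proof (rule g_le_bigo)
    show "\<gamma> \<in> O[lattice_at_infinity N](\<lambda>z. 1 / ?n z powr s)"
      using decay by (simp add: poly_decay_def s_def)
    fix R
    \<comment> \<open>The maximum with 1 keeps the base of the power positive for every
      \<open>R\<close>.\<close>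
    have "1 / max R 1 powr s \<le> 1 / ?n y powr s" if "y \<noteq> 0" "?n y < R" for y
      using pos[OF that(1)] that(2) s by (intro divide_left_mono powr_mono2) auto
    then show "\<exists>m>0. \<forall>y. y \<noteq> 0 \<longrightarrow> ?n y < R \<longrightarrow> m \<le> 1 / ?n y powr s"
      by (intro exI[of _ "1 / max R 1 powr s"]) auto
    show "0 < 1 / ?n y powr s" if "y \<noteq> 0" for y using pos[OF that] by simp
  qed
  then obtain A where "0 \<le> A" "\<And>y. y \<noteq> 0 \<Longrightarrow> g y \<le> A * ?n y powr - s"
    by (auto simp: powr_minus divide_inverse)
  from polynomial_decay[OF N s this]
  obtain D where D: "\<And>z. ?n z powr s * b z \<le> D" by blast
  have "poly_decay N \<alpha> \<epsilon>"
    unfolding poly_decay_def s_def[symmetric] by (rule \<epsilon>_bigo[OF D, of 1]) simp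
  then show ?thesis unfolding poly_rho_mixing_def using rho_mixing by blast
qed

lemma exp_rho_mixing:
  fixes N :: "real ^ 'n \<Rightarrow> real"
  assumes N: "is_norm N" and decay: "exp_decay N \<gamma>"
  shows "exp_rho_mixing N M \<omega>"
proof -
  let ?n = "lattice_norm N"
  obtain \<beta> where \<beta>: "0 < \<beta>" "exp_decay_at N \<beta> \<gamma>" using decay by (auto simp: exp_decay_def)
  \<comment> \<open>\<open>exp_decay_at\<close> gives bounds only at rates strictly below
    \<beta>.\<close>
  define \<delta> where "\<delta> = \<beta> / 2"
  have \<delta>: "0 < \<delta>" "\<delta> < \<beta>" using \<beta>(1) by (auto simp: \<delta>_def)
  have "\<exists>A\<ge>0. \<forall>y. y \<noteq> 0 \<longrightarrow> g y \<le> A * exp (- \<delta> * ?n y)"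
  proof (rule g_le_bigo)
    show "\<gamma> \<in> O[lattice_at_infinity N](\<lambda>z. exp (- \<delta> * ?n z))"
      using \<beta>(2) \<delta>(2) unfolding exp_decay_at_def by blast
    show "\<exists>m>0. \<forall>y. y \<noteq> 0 \<longrightarrow> ?n y < R \<longrightarrow> m \<le> exp (- \<delta> * ?n y)" for R
      using \<delta>(1) by (intro exI[of _ "exp (- \<delta> * R)"]) auto
  qed simp
  then obtain A where A: "0 \<le> A" "\<And>y. y \<noteq> 0 \<Longrightarrow> g y \<le> A * exp (- \<delta> * ?n y)" by blast
  have "g y \<le> A * exp (- \<delta> * ?n y)" for y using A by (cases "y = 0") (auto simp: g_def)
  from exponential_decay[OF N \<delta>(1) this]
  obtain \<tau> D where \<tau>: "0 < \<tau>" and D: "\<And>z. exp (\<tau> * ?n z) * b z \<le> D" by auto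
  have "\<epsilon> \<in> O[lattice_at_infinity N](\<lambda>z. exp (- \<beta>' * ?n z))" if "\<beta>' < \<tau>" for \<beta>'
  proof -
    have "exp (\<beta>' * ?n z) * b z \<le> D" for z
    proof -
      have "exp (\<beta>' * ?n z) * b z \<le> exp (\<tau> * ?n z) * b z"
        using that lattice_norm_nonneg[OF N, of z] b_nonneg[of z] by (simp add: mult_right_mono)
      with D[of z] show ?thesis by simp
    qed
    from \<epsilon>_bigo[OF this, of 0] show ?thesis by (simp add: exp_minus inverse_eq_divide)
  qed
  then have "exp_decay_at N \<tau> \<epsilon>" by (simp add: exp_decay_at_def)
  then show ?thesis unfolding exp_rho_mixing_def exp_decay_def using rho_mixing \<tau> by blast
qed

section \<open>Lower bounds and the loss in the rate of decay\<close>

lemma star_corr_lower: "b (j - i) / b 0 \<le> star_corr M \<omega> i j"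
  using star_corr_ge[of i j] b_zero_pos b_nonneg[of "j - i"] by (simp add: covariance)

text \<open>Each step along \<open>e\<close> loses at most the factor \<open>a\<close>, by
  \<open>b_step\<close> and \<open>g e >= 1\<close>.\<close>

lemma b_axis:
  assumes "1 \<le> g e"
  shows "b 0 * (1 / a) ^ m \<le> b (\<chi> k. int m * (e $ k))"
proof (induction m)
  case 0
  have "(\<chi> k. int 0 * (e $ k)) = 0" by (simp add: vec_eq_iff)
  then show ?case by simp
next
  case (Suc m)
  let ?z = "\<lambda>m. \<chi> k. int m * (e $ k)"
  have "?z (Suc m) - e = ?z m" by (simp add: vec_eq_iff algebra_simps)
  then have "g e * b (?z m) \<le> a * b (?z (Suc m))" using b_step[of e "?z (Suc m)"] by simp
  moreover have "1 * b (?z m) \<le> g e * b (?z m)" by (rule mult_right_mono[OF assms b_nonneg])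
  ultimately have "b (?z m) \<le> a * b (?z (Suc m))" by simp
  with Suc.IH have "b 0 * (1 / a) ^ m \<le> a * b (?z (Suc m))" by simp
  then show ?case using a_pos by (simp add: field_simps)
qed

end

lemma quadratic_model_field:
  fixes \<gamma> :: "int ^ 'n \<Rightarrow> real"
  assumes "interaction \<gamma>" "quadratic_model \<gamma> M \<omega>"
  obtains b where "quadratic_field M \<omega> \<gamma> b"
proof -
  have gf: "prob_space M" "\<And>F c. finite F \<Longrightarrow> gaussian_var M (\<lambda>x. \<Sum>i\<in>F. c i * \<omega> i x)"
    and zero: "\<And>i. integral\<^sup>L M (\<omega> i) = 0"
    using assms(2) by (auto simp: quadratic_model_def gaussian_field_def)
  obtain b where b: "conv_inverse (precision \<gamma>) b" "\<And>i j. covar M (\<omega> i) (\<omega> j) = b (j - i)"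
    using assms(2) by (auto simp: quadratic_model_def)
  interpret prob_space M by (rule gf(1))
  interpret centred_gaussian M \<omega>
  proof
    show "gaussian_var M X" if "X \<in> lin \<omega> UNIV" for X using that gf(2) by (auto simp: lin_def)
  qed (rule zero)
  have cov: "ip M (\<omega> i) (\<omega> j) = b (j - i)" for i j
    using b(2)[of i j] zero by (simp add: covar_centred)
  have "b (- z) = b z" for z using cov[of z 0] cov[of 0 z] by (simp add: ip_commute)
  then have "quadratic_field M \<omega> \<gamma> b"
    using assms(1) b(1) cov by unfold_locales auto
  then show ?thesis by (rule that)
qed

text \<open>For the nearest-neighbour interaction along one axis, \<open>b\<close> decays no faster than
  \<open>(1 + \<Gamma>) ^ (-m)\<close> along this axis, although \<open>\<gamma>\<close> has finite support.\<close>

lemma slow_exponential_mixing: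
  fixes N :: "real ^ 'n \<Rightarrow> real"
  assumes N: "is_norm N"
  shows "\<exists>(\<gamma> :: int ^ 'n \<Rightarrow> real) \<beta>. 0 < \<beta> \<and> interaction \<gamma> \<and> exp_decay_at N \<beta> \<gamma> \<and>
    (\<forall>(M :: 'a measure) \<omega>. quadratic_model \<gamma> M \<omega> \<longrightarrow>
      \<not> (\<exists>\<epsilon>. rho_mixing_with M \<omega> \<epsilon> \<and> exp_decay_at N \<beta> \<epsilon>))"
proof -
  let ?n = "lattice_norm N"
  define e :: "int ^ 'n" where "e = axis undefined 1"
  define \<gamma> :: "int ^ 'n \<Rightarrow> real" where "\<gamma> z = (if z = e \<or> z = - e then 1 else 0)" for z
  define A where "A = 1 + total_interaction \<gamma>"
  \<comment> \<open>Twice the rate of the lower bound \<open>A^(-m)\<close> along the axis, where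
    the norm is \<open>m |e|\<close>.\<close>
  define \<beta> where "\<beta> = 2 * ln A / ?n e"
  have e0: "e \<noteq> 0" by (simp add: e_def axis_eq_0_iff)
  have ne: "0 < ?n e" by (rule lattice_norm_pos[OF N e0])
  have summable: "\<gamma> summable_on S" for S
    by (rule finite_nonzero_values_imp_summable_on, rule finite_subset[of _ "{e, - e}"])
      (auto simp: \<gamma>_def split: if_splits)
  have "- z = e \<longleftrightarrow> z = - e" for z by auto
  then have int: "interaction \<gamma>"
    using summable by (auto simp: interaction_def \<gamma>_def)
  have "sum \<gamma> {e} \<le> total_interaction \<gamma>"
    unfolding total_interaction_def
    by (rule finite_sum_le_infsum[OF summable]) (use e0 in \<open>auto simp: \<gamma>_def\<close>)
  then have A: "1 < A" by (simp add: A_def \<gamma>_def)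
  have \<beta>: "0 < \<beta>" using A ne by (simp add: \<beta>_def)
  have "exp_decay_at N \<beta> \<gamma>"
    unfolding exp_decay_at_def lattice_bigo_iff
  proof (intro exI conjI allI impI)
    \<comment> \<open>Beyond this radius \<gamma> vanishes, so it has every rate of decay.\<close>
    fix \<beta>' z assume "?n e + ?n (- e) + 1 \<le> ?n z"
    then have "z \<noteq> e" "z \<noteq> - e"
      using lattice_norm_nonneg[OF N, of e] lattice_norm_nonneg[OF N, of "- e"] by auto
    then show "\<bar>\<gamma> z\<bar> \<le> 1 * \<bar>exp (- \<beta>' * ?n z)\<bar>" by (simp add: \<gamma>_def)
  qed simp
  moreover have False
    if model: "quadratic_model \<gamma> M \<omega>" and mix: "rho_mixing_with M \<omega> \<epsilon>" and decay: "exp_decay_at N \<beta> \<epsilon>"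
    for M :: "'a measure" and \<omega> \<epsilon>
  proof -
    obtain b where "quadratic_field M \<omega> \<gamma> b" using quadratic_model_field[OF int model] .
    then interpret q: quadratic_field M \<omega> \<gamma> b .
    have qA: "q.a = A" by (simp add: q.a_def q.\<Gamma>_def A_def)
    have ge: "1 \<le> q.g e" using e0 by (simp add: q.g_def \<gamma>_def)
    let ?z = "\<lambda>m :: nat. \<chi> k. int m * (e $ k)"
    have nz: "?n (?z m) = real m * ?n e" for m by (rule lattice_norm_scaled_axis[OF N])
    have lower: "(1 / A) ^ m \<le> \<epsilon> (?z m)" if "0 < m" for m
    proof -
      have "0 < ?n (?z m)" unfolding nz using that ne by simp
      then have "?z m \<noteq> 0" using lattice_norm_zero[OF N] by auto
      then have "star_corr M \<omega> 0 (?z m) \<le> \<epsilon> (?z m)"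
        using mix unfolding rho_mixing_with_def by (metis diff_zero min.boundedE)
      moreover have "(1 / A) ^ m \<le> b (?z m) / b 0"
        using q.b_axis[OF ge, of m] q.b_zero_pos by (simp add: qA field_simps)
      ultimately show ?thesis using q.star_corr_lower[of "?z m" 0] by simp
    qed
    \<comment> \<open>Strictly between the rate of the lower bound and \<beta>, because decay at
      \<beta> controls only smaller rates.\<close>
    define \<beta>' where "\<beta>' = 3 / 2 * ln A / ?n e"
    have "\<beta>' < \<beta>"
      unfolding \<beta>_def \<beta>'_def using A ne by (intro divide_strict_right_mono mult_strict_right_mono) simp_all
    then have "\<epsilon> \<in> O[lattice_at_infinity N](\<lambda>z. exp (- \<beta>' * ?n z))"
      using decay unfolding exp_decay_at_def by blast
    then obtain C R where R: "\<And>z. R \<le> ?n z \<Longrightarrow> \<bar>\<epsilon> z\<bar> \<le> C * \<bar>exp (- \<beta>' * ?n z)\<bar>"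
      unfolding lattice_bigo_iff by blast
    \<comment> \<open>Large enough that \<open>m\<close> is positive, \<open>?z m\<close> lies
      beyond the radius \<open>R\<close>, and \<open>m ln A\<close> exceeds \<open>2 C\<close>. The
      last contradicts \<open>exp (m ln A / 2) <= C\<close>, derived from the upper and lower
      bounds.\<close>
    obtain m :: nat where m: "max (max 1 (R / ?n e)) (2 * C / ln A) < real m"
      using reals_Archimedean2 by blast
    have lnA: "0 < ln A" using A by simp
    have mR: "R \<le> ?n (?z m)" unfolding nz using m ne by (simp add: field_simps)
    have eq: "- \<beta>' * ?n (?z m) = - (3 / 2 * (real m * ln A))" unfolding nz \<beta>'_def using ne by simp
    have upper: "\<epsilon> (?z m) \<le> C * exp (- (3 / 2 * (real m * ln A)))"
      using R[OF mR] unfolding eq by simp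
    have "(1 / A) ^ m = exp (- (real m * ln A))"
      using A by (simp add: exp_minus exp_of_nat_mult power_one_over inverse_eq_divide)
    with lower[of m] upper m have "exp (- (real m * ln A)) \<le> C * exp (- (3 / 2 * (real m * ln A)))" by simp
    then have "exp (- (real m * ln A)) * exp (3 / 2 * (real m * ln A)) \<le>
       C * exp (- (3 / 2 * (real m * ln A))) * exp (3 / 2 * (real m * ln A))"
      by (rule mult_right_mono) simp
    then have "exp (real m * ln A / 2) \<le> C"
      unfolding mult.assoc exp_add[symmetric] by (simp add: field_simps)
    moreover have "1 + real m * ln A / 2 \<le> exp (real m * ln A / 2)" by (rule exp_ge_add_one_self)
    moreover have "2 * C < real m * ln A" using m lnA by (simp add: field_simps)
    ultimately show False by linarith
  qed
  ultimately show ?thesis using \<beta> int by blast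
qed

theorem theorem5p2p10:
  fixes \<gamma> :: "int ^ 'n \<Rightarrow> real"
    and N :: "real ^ 'n \<Rightarrow> real"
    and M :: "'a measure"
    and \<omega> :: "int ^ 'n \<Rightarrow> 'a \<Rightarrow> real"
  assumes "is_norm N"
    and "interaction \<gamma>"
    and "quadratic_model \<gamma> M \<omega>"
  shows
    "(well_rho_mixing M \<omega> \<and>
      (total_interaction \<gamma> < 1 \<longrightarrow>
        (\<forall>I J. I \<inter> J = {} \<longrightarrow> max_corr_spins M \<omega> I J \<le> ennreal (total_interaction \<gamma>)))) \<and>
     (\<forall>\<alpha>>0. poly_decay N \<alpha> \<gamma> \<longrightarrow> poly_rho_mixing N \<alpha> M \<omega>) \<and>
     (exp_decay N \<gamma> \<longrightarrow> exp_rho_mixing N M \<omega>) \<and>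
     (\<exists>(\<gamma>' :: int ^ 'n \<Rightarrow> real) \<beta>. 0 < \<beta> \<and> interaction \<gamma>' \<and> exp_decay_at N \<beta> \<gamma>' \<and>
       (\<forall>(M' :: 'a measure) \<omega>'. quadratic_model \<gamma>' M' \<omega>' \<longrightarrow>
         \<not> (\<exists>\<epsilon>. rho_mixing_with M' \<omega>' \<epsilon> \<and> exp_decay_at N \<beta> \<epsilon>)))"
proof -
  obtain b where "quadratic_field M \<omega> \<gamma> b" using quadratic_model_field[OF assms(2,3)] .
  then interpret quadratic_field M \<omega> \<gamma> b .
  show ?thesis
  proof (intro conjI allI impI)
    show "well_rho_mixing M \<omega>" unfolding well_rho_mixing_def using rho_mixing by blast
    show "max_corr_spins M \<omega> I J \<le> ennreal (total_interaction \<gamma>)"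
      if "total_interaction \<gamma> < 1" "I \<inter> J = {}" for I J
      using max_corr_disjoint[OF that(2)] that(1) by (simp add: \<Gamma>_def)
    show "poly_rho_mixing N \<alpha> M \<omega>" if "0 < \<alpha>" "poly_decay N \<alpha> \<gamma>" for \<alpha>
      by (rule poly_rho_mixing[OF assms(1) that])
    show "exp_rho_mixing N M \<omega>" if "exp_decay N \<gamma>"
      by (rule exp_rho_mixing[OF assms(1) that])
  qed (rule slow_exponential_mixing[OF assms(1)])
qed

end
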